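(* The construction described in the context can be carried out so that the resulting group $A$ is lightface $\Delta^0_3$, with no oracle. Here $A$ is the $\mathbb{Q}$-vector subspace of $\mathbb{R}$ spanned by the generators with irrational multiplier parameter, and it satisfies $\dim_{\mathrm H}A=0$ and $X_A=\mathbb{R}\setminus\mathbb{Q}$. More precisely, the construction can be carried out so that the set $F$ of all admissible finite rational sums of the extended generators, and the set $F_{\mathrm{rat}}$ of those sums having an admissible representation with at least one rational multiplier (both defined in the context), are both lightface $\Sigma^0_2$, and $$A=(F\cup\{0\})\setminus F_{\mathrm{rat}}\in\Delta^0_3\quad\text{(lightface)}.$$ Moreover, this $A$ is neither $F_\sigma$ nor $G_\delta$ in $\mathbb{R}$.
   Context: **Basic notation.** $\dim_{\mathrm H}$ is Hausdorff dimension in Euclidean space. For an additive subgroup $A$ of $\mathbb{R}$ and $\xi\in\mathbb{R}$, $A+\xi A=\{a+\xi b:a,b\in A\}$ and $X_A=\{\xi\in\mathbb{R}:A+\xi A=\mathbb{R}\}$. In arithmetic expressions, $\beta\in2^\omega$ denotes the real $\sum_i\beta(i)2^{-i-1}$ and a finite binary string $\sigma$ denotes $\sum_{i<|\sigma|}\sigma(i)2^{-i-1}$. Write $[\sigma]$ for the set of $\beta\in2^\omega$ extending $\sigma$, $D_\sigma=[\sigma,\sigma+2^{-|\sigma|}]\subseteq\mathbb{R}$, and $\beta\upharpoonright n$ for the initial segment of length $n$. **Effective pointclasses (no oracle).** A set is effectively open if it is the union of a computably enumerable family of open intervals with rational endpoints; sequences or double sequences are uniformly effectively open if one algorithm, taking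 the indices as input, gives such enumerations. A subset of $\mathbb{R}$ is lightface $\Sigma^0_2$ if it is $\bigcup_i(\mathbb{R}\setminus U_i)$ with $(U_i)$ uniformly effectively open; lightface $\Sigma^0_3$ if it is $\bigcup_i\bigcap_jU_{i,j}$ with $(U_{i,j})$ uniformly effectively open; lightface $\Pi^0_3$ if its complement is lightface $\Sigma^0_3$; lightface $\Delta^0_3$ if it is both. **Target sets.** Fix a computable enumeration $(q_\ell)_{\ell\ge1}$ of $\mathbb{Q}\setminus\{0\}$, let $r_{n,\ell}=\min\{|q_\ell|/2,\,2^{-n(n+\ell)-2}\}$, $O_n=\bigcup_{\ell\ge1}(q_\ell-r_{n,\ell},q_\ell+r_{n,\ell})$ and $G_j=\bigcap_{n=1}^jO_n$. Each $G_j$ is dense and open and omits $0$, and $G=\bigcap_jG_j$ has Hausdorff dimension zero. **The construction.** One chooses by induction integers $0=n_0<n_1<\cdots$ and $2=m_0<m_1<\cdots$ and strings $\theta^j_{\sigma,\tau}\in2^{m_j}$ for $\sigma,\tau\in2^{n_j}$, with $\theta^0_{\varnothing,\varnothing}=01$ and each $\theta^j_{\sigma,\tau}$ ($j\ge1$) extending $\theta^{j-1}_{\sigma\upharpoonright n_{j-1},\tau\upharpoonright n_{j-1}}$. Stage $j\ge1$ ensures the following. Let $Q_j=\{p/q:p\in\mathbb{Z},\,q\in\mathbb{N},\,|p|\le j,\,1\le q\le j\}$, and list all pairs of strings in $2^{n_{j-1}}\times2^{n_{j-1}}$ as $(\sigma_i,\tau_i)$, $1\le i\le k$. For every list $(a_i,b_i)\in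 Q_j^2$, $1\le i\le k$, not all zero, such that $\min_{\xi\in1+D_{\sigma_i}}|a_i-b_i\xi|>0$ whenever $(a_i,b_i)\ne(0,0)$, one has $$\sum_{i=1}^k\bigl((a_i-b_i\xi_i)u_i+b_i\alpha_i\bigr)\in G_j$$ whenever $\gamma_i\in[\sigma_i]$, $\xi_i=1+\gamma_i$, $\alpha_i\in[\tau_i]$ and $u_i\in D_{\theta^j_{\gamma_i\upharpoonright n_j,\,\alpha_i\upharpoonright n_j}}$ for all $i$ (rational values of $\xi_i$ included). **Extended generators.** For $p=(\gamma,\beta)\in\widehat P=2^\omega\times2^\omega$ put $\xi_p=1+\gamma$, let $g_p$ be the real with binary expansion $\bigcup_{\ell\ge0}\theta^\ell_{\gamma\upharpoonright n_\ell,\,\beta\upharpoonright n_\ell}$, and put $h_p=\beta-\xi_pg_p$. **The group and the two sets.** $A$ is the $\mathbb{Q}$-linear span of $\{g_p,h_p:p\in\widehat P,\ \xi_p\notin\mathbb{Q}\}$. An admissible representation is an expression $\sum_{i=1}^r(a_ig_{p_i}+b_ih_{p_i})$ with $r\ge1$, $a_i,b_i\in\mathbb{Q}$, $p_1,\dots,p_r\in\widehat P$ pairwise distinct, and $a_i-b_i\xi_{p_i}\ne0$ for all $1\le i\le r$. $F$ is the set of all reals having an admissible representation, and $F_{\mathrm{rat}}$ is the set of all reals having an admissible representation with at least one $\xi_{p_i}\in\mathbb{Q}$. *)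

theory Defs
  imports "HOL-Analysis.Analysis" "HOL-Library.Nat_Bijection" "HOL-Library.Sublist"
begin

datatype recf =
    Zero
  | Succ
  | Proj nat
  | Comp recf "recf list"
  | Prec recf recf
  | Mu recf

text \<open>
  \<open>computes f xs y\<close>: the program \<open>f\<close> halts on the arguments \<open>xs\<close> with output \<open>y\<close>.
  The recursion argument and the search argument both come first.
\<close>

inductive computes :: "recf \<Rightarrow> nat list \<Rightarrow> nat \<Rightarrow> bool" where
  zero: "computes Zero xs 0"
| succ: "computes Succ [x] (Suc x)"
| proj: "i < length xs \<Longrightarrow> computes (Proj i) xs (xs ! i)"
| comp: "list_all2 (\<lambda>g y. computes g xs y) gs ys \<Longrightarrow> computes f ys z
          \<Longrightarrow> computes (Comp f gs) xs z"
| prec_0: "computes f xs y \<Longrightarrow> computes (Prec f g) (0 # xs) y"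
| prec_Suc: "computes (Prec f g) (k # xs) y \<Longrightarrow> computes g (k # y # xs) z
          \<Longrightarrow> computes (Prec f g) (Suc k # xs) z"
| mu: "computes f (k # xs) 0 \<Longrightarrow> (\<forall>i<k. \<exists>y>0. computes f (i # xs) y)
          \<Longrightarrow> computes (Mu f) xs k"

definition halts :: "recf \<Rightarrow> nat list \<Rightarrow> bool" where
  "halts f xs \<longleftrightarrow> (\<exists>y. computes f xs y)"

text \<open>A surjective, effective, non-injective coding of the rationals by natural numbers.\<close>

definition rat_decode :: "nat \<Rightarrow> real" where
  "rat_decode c = (case prod_decode c of (k, d) \<Rightarrow> real_of_int (int_decode k) / real (Suc d))"

definition computable_enum_nonzero_rats :: "(nat \<Rightarrow> real) \<Rightarrow> bool" where
  "computable_enum_nonzero_rats q \<longleftrightarrow>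
     q ` {1..} = \<rat> - {0} \<and>
     (\<exists>f. \<forall>l\<ge>1. \<exists>c. computes f [l] c \<and> rat_decode c = q l)"

text \<open>
  For fixed \<open>f\<close>, the pairs of endpoint codes on which \<open>f\<close> halts (given the indices
  \<open>is\<close>) range over the computably enumerable families, uniformly in \<open>is\<close>.
  Intervals whose endpoints are not in increasing order are empty.
\<close>

definition coded_open :: "recf \<Rightarrow> nat list \<Rightarrow> real set" where
  "coded_open f is =
     (\<Union>(c, d) \<in> {(c, d). halts f (is @ [c, d])}. {rat_decode c <..< rat_decode d})"

definition unif_effectively_open :: "(nat \<Rightarrow> real set) \<Rightarrow> bool" where
  "unif_effectively_open U \<longleftrightarrow> (\<exists>f. \<forall>i. U i = coded_open f [i])"

definition unif_effectively_open2 :: "(nat \<Rightarrow> nat \<Rightarrow> real set) \<Rightarrow> bool" where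
  "unif_effectively_open2 U \<longleftrightarrow> (\<exists>f. \<forall>i j. U i j = coded_open f [i, j])"

definition lightface_Sigma2 :: "real set \<Rightarrow> bool" where
  "lightface_Sigma2 S \<longleftrightarrow> (\<exists>U. unif_effectively_open U \<and> S = (\<Union>i. - U i))"

definition lightface_Sigma3 :: "real set \<Rightarrow> bool" where
  "lightface_Sigma3 S \<longleftrightarrow> (\<exists>U. unif_effectively_open2 U \<and> S = (\<Union>i. \<Inter>j. U i j))"

definition lightface_Pi3 :: "real set \<Rightarrow> bool" where
  "lightface_Pi3 S \<longleftrightarrow> lightface_Sigma3 (- S)"

definition lightface_Delta3 :: "real set \<Rightarrow> bool" where
  "lightface_Delta3 S \<longleftrightarrow> lightface_Sigma3 S \<and> lightface_Pi3 S"

text \<open>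
  Boundedness is required because \<^const>\<open>diameter\<close> is only meaningful on bounded sets.
  The exponent \<open>s\<close> is meant to be positive (\<open>0 powr 0 = 0\<close>); restricting to such
  \<open>s\<close> does not change the infimum defining the dimension.
\<close>

definition hausdorff_premeasure :: "real \<Rightarrow> real \<Rightarrow> 'a::metric_space set \<Rightarrow> ennreal" where
  "hausdorff_premeasure s \<delta> E =
     (INF U \<in> {U :: nat \<Rightarrow> 'a set. E \<subseteq> (\<Union>i. U i) \<and> (\<forall>i. bounded (U i) \<and> diameter (U i) \<le> \<delta>)}.
        (\<Sum>i. ennreal (diameter (U i) powr s)))"

definition hausdorff_measure :: "real \<Rightarrow> 'a::metric_space set \<Rightarrow> ennreal" where
  "hausdorff_measure s E = (SUP \<delta>\<in>{0<..}. hausdorff_premeasure s \<delta> E)"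

definition hausdorff_dim :: "'a::metric_space set \<Rightarrow> ennreal" where
  "hausdorff_dim E = Inf {ennreal s | s. s > 0 \<and> hausdorff_measure s E = 0}"

type_synonym str = "bool list"
type_synonym seq = "nat \<Rightarrow> bool"

definition seq_real :: "seq \<Rightarrow> real" where
  "seq_real \<beta> = (\<Sum>i. of_bool (\<beta> i) / 2 ^ (i + 1))"

definition str_real :: "str \<Rightarrow> real" where
  "str_real \<sigma> = (\<Sum>i<length \<sigma>. of_bool (\<sigma> ! i) / 2 ^ (i + 1))"

definition strings :: "nat \<Rightarrow> str set" where
  "strings n = {\<sigma>. length \<sigma> = n}"

definition initial :: "seq \<Rightarrow> nat \<Rightarrow> str" where
  "initial \<beta> n = map \<beta> [0..<n]"

definition cylinder :: "str \<Rightarrow> seq set" where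
  "cylinder \<sigma> = {\<beta>. initial \<beta> (length \<sigma>) = \<sigma>}"

definition dyadic :: "str \<Rightarrow> real set" where
  "dyadic \<sigma> = {str_real \<sigma> .. str_real \<sigma> + 1 / 2 ^ length \<sigma>}"

definition radius :: "(nat \<Rightarrow> real) \<Rightarrow> nat \<Rightarrow> nat \<Rightarrow> real" where
  "radius q n l = min (\<bar>q l\<bar> / 2) (1 / 2 ^ (n * (n + l) + 2))"

definition O_set :: "(nat \<Rightarrow> real) \<Rightarrow> nat \<Rightarrow> real set" where
  "O_set q n = (\<Union>l\<in>{1..}. {q l - radius q n l <..< q l + radius q n l})"

definition G_set :: "(nat \<Rightarrow> real) \<Rightarrow> nat \<Rightarrow> real set" where
  "G_set q j = (\<Inter>n\<in>{1..j}. O_set q n)"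

definition Q_set :: "nat \<Rightarrow> real set" where
  "Q_set j = {real_of_int k / real d | k d. \<bar>k\<bar> \<le> int j \<and> 1 \<le> d \<and> d \<le> j}"

text \<open>
  The requirement of stage \<open>j\<close>. The list of pairs \<open>(\<sigma>\<^sub>i, \<tau>\<^sub>i)\<close> is indexed by the pairs
  themselves, so \<open>a\<close>, \<open>b\<close>, \<open>\<gamma>\<close>, \<open>\<alpha>\<close>, \<open>u\<close> are families over \<open>I\<close>. The
  infimum below is the minimum, the set being compact.
\<close>

definition stage_requirement ::
  "(nat \<Rightarrow> real) \<Rightarrow> (nat \<Rightarrow> nat) \<Rightarrow> (nat \<Rightarrow> str \<Rightarrow> str \<Rightarrow> str) \<Rightarrow> nat \<Rightarrow> bool" where
  "stage_requirement q n \<theta> j \<longleftrightarrow>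
    (let I = strings (n (j - 1)) \<times> strings (n (j - 1)) in
     \<forall>(a :: str \<times> str \<Rightarrow> real) (b :: str \<times> str \<Rightarrow> real).
       (\<forall>i\<in>I. a i \<in> Q_set j \<and> b i \<in> Q_set j) \<and>
       (\<exists>i\<in>I. (a i, b i) \<noteq> (0, 0)) \<and>
       (\<forall>i\<in>I. (a i, b i) \<noteq> (0, 0) \<longrightarrow>
          (INF \<xi>\<in>(\<lambda>x. 1 + x) ` dyadic (fst i). \<bar>a i - b i * \<xi>\<bar>) > 0)
       \<longrightarrow>
       (\<forall>(\<gamma> :: str \<times> str \<Rightarrow> seq) (\<alpha> :: str \<times> str \<Rightarrow> seq) (u :: str \<times> str \<Rightarrow> real).
          (\<forall>i\<in>I. \<gamma> i \<in> cylinder (fst i) \<and> \<alpha> i \<in> cylinder (snd i) \<and>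
                 u i \<in> dyadic (\<theta> j (initial (\<gamma> i) (n j)) (initial (\<alpha> i) (n j))))
          \<longrightarrow> (\<Sum>i\<in>I. (a i - b i * (1 + seq_real (\<gamma> i))) * u i + b i * seq_real (\<alpha> i))
                \<in> G_set q j))"

definition construction ::
  "(nat \<Rightarrow> real) \<Rightarrow> (nat \<Rightarrow> nat) \<Rightarrow> (nat \<Rightarrow> nat) \<Rightarrow> (nat \<Rightarrow> str \<Rightarrow> str \<Rightarrow> str) \<Rightarrow> bool" where
  "construction q n m \<theta> \<longleftrightarrow>
     n 0 = 0 \<and> strict_mono n \<and> m 0 = 2 \<and> strict_mono m \<and>
     (\<forall>j. \<forall>\<sigma>\<in>strings (n j). \<forall>\<tau>\<in>strings (n j). \<theta> j \<sigma> \<tau> \<in> strings (m j)) \<and>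
     \<theta> 0 [] [] = [False, True] \<and>
     (\<forall>j\<ge>1. \<forall>\<sigma>\<in>strings (n j). \<forall>\<tau>\<in>strings (n j).
        prefix (\<theta> (j - 1) (take (n (j - 1)) \<sigma>) (take (n (j - 1)) \<tau>)) (\<theta> j \<sigma> \<tau>)) \<and>
     (\<forall>j\<ge>1. stage_requirement q n \<theta> j)"

definition xi :: "seq \<times> seq \<Rightarrow> real" where
  "xi p = 1 + seq_real (fst p)"

text \<open>
  For a \<open>\<theta>\<close> produced by the construction the strings below extend one another and have
  unbounded length, so the description picks out their union.
\<close>

definition gen_g :: "(nat \<Rightarrow> nat) \<Rightarrow> (nat \<Rightarrow> str \<Rightarrow> str \<Rightarrow> str) \<Rightarrow> seq \<times> seq \<Rightarrow> real" where
  "gen_g n \<theta> p =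
     seq_real (THE \<delta>. \<forall>l. \<delta> \<in> cylinder (\<theta> l (initial (fst p) (n l)) (initial (snd p) (n l))))"

definition gen_h :: "(nat \<Rightarrow> nat) \<Rightarrow> (nat \<Rightarrow> str \<Rightarrow> str \<Rightarrow> str) \<Rightarrow> seq \<times> seq \<Rightarrow> real" where
  "gen_h n \<theta> p = seq_real (snd p) - xi p * gen_g n \<theta> p"

definition rat_scale :: "rat \<Rightarrow> real \<Rightarrow> real" where
  "rat_scale c x = of_rat c * x"

lemma vector_space_rat_scale: "vector_space rat_scale"
  by unfold_locales (simp_all add: rat_scale_def algebra_simps of_rat_add of_rat_mult)

definition group_A :: "(nat \<Rightarrow> nat) \<Rightarrow> (nat \<Rightarrow> str \<Rightarrow> str \<Rightarrow> str) \<Rightarrow> real set" where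
  "group_A n \<theta> =
     module.span rat_scale (\<Union>p\<in>{p. xi p \<notin> \<rat>}. {gen_g n \<theta> p, gen_h n \<theta> p})"

definition admissible_rep ::
  "(nat \<Rightarrow> nat) \<Rightarrow> (nat \<Rightarrow> str \<Rightarrow> str \<Rightarrow> str) \<Rightarrow> nat \<Rightarrow> (nat \<Rightarrow> real) \<Rightarrow> (nat \<Rightarrow> real)
     \<Rightarrow> (nat \<Rightarrow> seq \<times> seq) \<Rightarrow> real \<Rightarrow> bool" where
  "admissible_rep n \<theta> r a b p x \<longleftrightarrow>
     r \<ge> 1 \<and> (\<forall>i\<in>{1..r}. a i \<in> \<rat> \<and> b i \<in> \<rat>) \<and> inj_on p {1..r} \<and>
     (\<forall>i\<in>{1..r}. a i - b i * xi (p i) \<noteq> 0) \<and>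
     x = (\<Sum>i=1..r. a i * gen_g n \<theta> (p i) + b i * gen_h n \<theta> (p i))"

definition F_set :: "(nat \<Rightarrow> nat) \<Rightarrow> (nat \<Rightarrow> str \<Rightarrow> str \<Rightarrow> str) \<Rightarrow> real set" where
  "F_set n \<theta> = {x. \<exists>r a b p. admissible_rep n \<theta> r a b p x}"

definition F_rat :: "(nat \<Rightarrow> nat) \<Rightarrow> (nat \<Rightarrow> str \<Rightarrow> str \<Rightarrow> str) \<Rightarrow> real set" where
  "F_rat n \<theta> = {x. \<exists>r a b p. admissible_rep n \<theta> r a b p x \<and> (\<exists>i\<in>{1..r}. xi (p i) \<in> \<rat>)}"

definition X_set :: "real set \<Rightarrow> real set" where
  "X_set A = {\<xi>. {a + \<xi> * b | a b. a \<in> A \<and> b \<in> A} = UNIV}"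

end

theory Submission
  imports Defs
begin

text \<open>
  The group consists of the sums \<open>a * g + b * h\<close> over finitely many generators whose multiplier \<open>\<xi>\<close>
  is irrational.  Since \<open>\<xi> * g + h = \<beta>\<close>, such a sum is linear in the digits \<open>g\<close> with coefficients
  \<open>a - b * \<xi>\<close>, and everything rests on one property of the tables \<open>\<theta>\<close>: a sum all of whose
  coefficients \<open>a - b * \<xi>\<close> are nonzero lies in every \<open>G_set q j\<close>.  For positive \<open>j\<close> these sets
  omit 0, and their intersection has dimension 0.  So no admissible sum vanishes (\<open>zero_notin_F\<close>), and
  subtracting two representations of one real shows that a real with a representation by irrational
  multipliers has none involving a rational multiplier (\<open>group_A_eq_F\<close>).

  The tables are built one constraint at a time (\<open>certify_one\<close>).  A constraint is a list of cells with
  coefficients.  The free digits can push each summand next to a point of a shifted rational grid, so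
  that the whole sum is close to a nonzero rational; there are only finitely many possible values, each
  of them is the centre of an interval of every \<open>O_set q n\<close>, and the next level is chosen so fine that
  the remaining error is below all radii involved.  Success at a stage is witnessed by finitely many strict
  inequalities between rationals, so a stage can be found by unbounded search, and the tables are computable
  (\<open>computable_state\<close>).

  The reals represented over fixed cells with fixed coefficients form the continuous image of a compact
  product of Cantor spaces.  The tables enclose it at each level in a finite union of closed rational
  intervals, and by Koenig's lemma (\<open>near_imp_sums\<close>) every point outside is excluded at some level.  Hence
  the complement is effectively open, uniformly in the cells and coefficients, and the set of all admissible
  sums is lightface \<open>\<Sigma>\<^sup>0\<^sub>2\<close>; the same holds with one multiplier fixed to a given rational.  A difference of
  two such sets is lightface \<open>\<Delta>\<^sup>0\<^sub>3\<close> (\<open>Sigma2_search_diff_Delta3\<close>).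

  The group is a dense proper subgroup of the line, so Baire's theorem forbids it to be \<open>G\<^sub>\<delta>\<close>
  (\<open>not_gdelta_A\<close>).  For fixed \<open>\<beta>\<close> the continuous map \<open>\<gamma> \<mapsto> g\<close> pulls it back to the set of irrational
  points of Cantor space, which is not \<open>F\<^sub>\<sigma>\<close> (\<open>not_fsigma_A\<close>).
\<close>

section \<open>Programs and total computable functions\<close>

inductive_cases computes_ZeroE: "computes Zero xs y"
inductive_cases computes_SuccE: "computes Succ xs y"
inductive_cases computes_ProjE: "computes (Proj i) xs y"
inductive_cases computes_CompE: "computes (Comp f gs) xs y"
inductive_cases computes_Prec0E: "computes (Prec f g) (0 # xs) y"
inductive_cases computes_PrecSucE: "computes (Prec f g) (Suc k # xs) y"
inductive_cases computes_MuE: "computes (Mu f) xs y"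

lemma computes_functional: "computes f xs y \<Longrightarrow> computes f xs z \<Longrightarrow> y = z"
proof (induction f xs y arbitrary: z rule: computes.induct)
  case (comp xs gs ys f z z')
  from comp.prems obtain ys' where ys': "list_all2 (\<lambda>g y. computes g xs y) gs ys'" "computes f ys' z'"
    by (rule computes_CompE)
  have "ys = ys'"
    using comp.IH(1) ys'(1)
    by (auto simp: list_all2_conv_all_nth intro!: nth_equalityI)
  with comp.IH(2) ys'(2) show ?case by simp
next
  case (mu f k xs)
  from mu.prems have "computes f (z # xs) 0" "\<forall>i<z. \<exists>y>0. computes f (i # xs) y"
    by (auto elim: computes_MuE)
  then have "\<not> z < k" "\<not> k < z"
    using mu.IH by force+
  then show ?case by simp
next
  case (prec_Suc f g k xs y w)
  from prec_Suc.prems obtain y' where "computes (Prec f g) (k # xs) y'" "computes g (k # y' # xs) z"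
    by (rule computes_PrecSucE)
  with prec_Suc.IH show ?case by blast
next
  case (prec_0 f xs y g)
  from prec_0.prems have "computes f xs z" by (rule computes_Prec0E)
  with prec_0.IH show ?case by blast
qed (auto elim: computes_ZeroE computes_SuccE computes_ProjE)

definition total_computable :: "nat \<Rightarrow> (nat list \<Rightarrow> nat) \<Rightarrow> bool" where
  "total_computable k F \<longleftrightarrow> (\<exists>f. \<forall>xs. length xs = k \<longrightarrow> computes f xs (F xs))"

lemma total_computable_cong:
  "total_computable k F \<Longrightarrow> (\<And>xs. length xs = k \<Longrightarrow> F xs = G xs) \<Longrightarrow> total_computable k G"
  by (auto simp: total_computable_def)

lemma total_computable_nth: "i < k \<Longrightarrow> total_computable k (\<lambda>xs. xs ! i)"
  unfolding total_computable_def by (auto intro: computes.proj)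

lemma total_computable_comp:
  assumes H: "total_computable (length Gs) H" and G: "\<forall>G\<in>set Gs. total_computable k G"
  shows "total_computable k (\<lambda>xs. H (map (\<lambda>G. G xs) Gs))"
proof -
  obtain f where f: "\<And>xs. length xs = length Gs \<Longrightarrow> computes f xs (H xs)"
    using H by (auto simp: total_computable_def)
  obtain p where p: "\<And>G xs. G \<in> set Gs \<Longrightarrow> length xs = k \<Longrightarrow> computes (p G) xs (G xs)"
    using G unfolding total_computable_def by metis
  have "computes (Comp f (map p Gs)) xs (H (map (\<lambda>G. G xs) Gs))" if "length xs = k" for xs
    by (rule computes.comp[where ys = "map (\<lambda>G. G xs) Gs"])
       (auto simp: list_all2_conv_all_nth p that f)
  then show ?thesis by (auto simp: total_computable_def)
qed

lemma total_computable_Suc: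
  assumes "total_computable k F"
  shows "total_computable k (\<lambda>xs. Suc (F xs))"
proof -
  have "total_computable (length [F]) (\<lambda>xs. Suc (xs ! 0))"
    unfolding total_computable_def
  proof (intro exI[of _ Succ] allI impI)
    fix xs :: "nat list" assume "length xs = length [F]"
    then obtain x where "xs = [x]" by (auto simp: length_Suc_conv)
    then show "computes Succ xs (Suc (xs ! 0))" by (simp add: computes.succ)
  qed
  from total_computable_comp[OF this, of k] assms show ?thesis by simp
qed

lemma total_computable_const: "total_computable k (\<lambda>xs. c)"
proof (induction c)
  case 0
  show ?case unfolding total_computable_def by (auto intro: computes.zero)
qed (rule total_computable_Suc)

lemma total_computable_rec:
  assumes A: "total_computable k A"
    and S: "total_computable (Suc (Suc k)) (\<lambda>zs. S (zs ! 0) (zs ! 1) (drop 2 zs))"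
    and N: "total_computable k N"
  shows "total_computable k (\<lambda>xs. rec_nat (A xs) (\<lambda>i y. S i y xs) (N xs))"
proof -
  obtain a s m where a: "\<And>xs. length xs = k \<Longrightarrow> computes a xs (A xs)"
    and s: "\<And>xs. length xs = Suc (Suc k) \<Longrightarrow> computes s xs (S (xs ! 0) (xs ! 1) (drop 2 xs))"
    and m: "\<And>xs. length xs = k \<Longrightarrow> computes m xs (N xs)"
    using assms by (auto simp: total_computable_def)
  have R: "computes (Prec a s) (j # xs) (rec_nat (A xs) (\<lambda>i y. S i y xs) j)"
    if "length xs = k" for xs j
  proof (induction j)
    case 0
    then show ?case using a that by (auto intro: computes.prec_0)
  next
    case (Suc j)
    let ?y = "rec_nat (A xs) (\<lambda>i y. S i y xs) j"
    show ?case
      using computes.prec_Suc[OF Suc s[of "j # ?y # xs"]] that by simp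
  qed
  have "computes (Comp (Prec a s) (m # map Proj [0..<k])) xs
          (rec_nat (A xs) (\<lambda>i y. S i y xs) (N xs))" if "length xs = k" for xs
  proof (rule computes.comp[where ys = "N xs # xs"])
    show "list_all2 (\<lambda>g y. computes g xs y) (m # map Proj [0..<k]) (N xs # xs)"
      unfolding list_all2_Cons using that m[OF that]
      by (auto simp: list_all2_conv_all_nth intro: computes.proj)
  qed (rule R[OF that])
  then show ?thesis by (auto simp: total_computable_def)
qed

lemma total_computable_least:
  assumes P: "total_computable (Suc k) (\<lambda>zs. P (zs ! 0) (drop 1 zs))"
    and ex: "\<And>xs. length xs = k \<Longrightarrow> \<exists>i. P i xs = 0"
  shows "total_computable k (\<lambda>xs. LEAST i. P i xs = 0)"
proof -
  obtain p where p: "\<And>xs. length xs = Suc k \<Longrightarrow> computes p xs (P (xs ! 0) (drop 1 xs))"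
    using P by (auto simp: total_computable_def)
  have p': "length xs = k \<Longrightarrow> computes p (i # xs) (P i xs)" for i xs
    using p[of "i # xs"] by simp
  have "computes (Mu p) xs (LEAST i. P i xs = 0)" if "length xs = k" for xs
  proof (rule computes.mu)
    have "P (LEAST i. P i xs = 0) xs = 0"
      using ex[OF that] by (rule LeastI_ex)
    then show "computes p ((LEAST i. P i xs = 0) # xs) 0"
      using p'[OF that, of "LEAST i. P i xs = 0"] by simp
    show "\<forall>i<LEAST i. P i xs = 0. \<exists>y>0. computes p (i # xs) y"
      using p'[OF that] not_less_Least[of _ "\<lambda>i. P i xs = 0"] by blast
  qed
  then show ?thesis by (auto simp: total_computable_def)
qed

lemma total_computable_add:
  assumes "total_computable k F" "total_computable k G"
  shows "total_computable k (\<lambda>xs. F xs + G xs)"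
proof -
  have "rec_nat a (\<lambda>i y. Suc y) b = a + b" for a b :: nat by (induction b) auto
  moreover have "total_computable (Suc (Suc k)) (\<lambda>zs. Suc (zs ! 1))"
    by (intro total_computable_Suc total_computable_nth) simp
  ultimately show ?thesis
    using total_computable_rec[OF assms(1), of "\<lambda>i y xs. Suc y", OF _ assms(2)] by simp
qed

lemma total_computable_pred:
  assumes "total_computable k F"
  shows "total_computable k (\<lambda>xs. F xs - 1)"
proof -
  have "rec_nat 0 (\<lambda>i y. i) b = b - 1" for b :: nat by (induction b) auto
  moreover have "total_computable (Suc (Suc k)) (\<lambda>zs. zs ! 0)"
    by (intro total_computable_nth) simp
  ultimately show ?thesis
    using total_computable_rec[OF total_computable_const, of k "\<lambda>i y xs. i", OF _ assms, of 0]
    by simp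
qed

lemma total_computable_diff:
  assumes "total_computable k F" "total_computable k G"
  shows "total_computable k (\<lambda>xs. F xs - G xs)"
proof -
  have "rec_nat a (\<lambda>i y. y - 1) b = a - b" for a b :: nat by (induction b) auto
  moreover have "total_computable (Suc (Suc k)) (\<lambda>zs. zs ! 1 - 1)"
    by (intro total_computable_pred total_computable_nth) simp
  ultimately show ?thesis
    using total_computable_rec[OF assms(1), of "\<lambda>i y xs. y - 1", OF _ assms(2)] by simp
qed

lemma total_computable_drop:
  assumes "total_computable k F"
  shows "total_computable (j + k) (\<lambda>zs. F (drop j zs))"
proof -
  have "total_computable (j + k) (\<lambda>zs. F (map (\<lambda>G. G zs) (map (\<lambda>i zs. zs ! (j + i)) [0..<k])))"
    by (rule total_computable_comp) (use assms in \<open>auto intro: total_computable_nth\<close>)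
  then show ?thesis
    by (rule total_computable_cong)
       (auto intro!: arg_cong[where f = F] nth_equalityI)
qed

lemma total_computable_mult:
  assumes "total_computable k F" "total_computable k G"
  shows "total_computable k (\<lambda>xs. F xs * G xs)"
proof -
  have "rec_nat 0 (\<lambda>i y. y + a) b = a * b" for a b :: nat by (induction b) auto
  moreover have "total_computable (Suc (Suc k)) (\<lambda>zs. zs ! 1 + F (drop 2 zs))"
    using total_computable_drop[OF assms(1), of 2]
    by (intro total_computable_add total_computable_nth) simp_all
  ultimately show ?thesis
    using total_computable_rec[OF total_computable_const, of k "\<lambda>i y xs. y + F xs", OF _ assms(2), of 0]
    by simp
qed

lemma total_computable_triangle:
  assumes "total_computable k F"
  shows "total_computable k (\<lambda>xs. triangle (F xs))"
proof -
  have "rec_nat 0 (\<lambda>i y. y + Suc i) b = triangle b" for b :: nat by (induction b) auto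
  moreover have "total_computable (Suc (Suc k)) (\<lambda>zs. zs ! 1 + Suc (zs ! 0))"
    by (intro total_computable_add total_computable_nth total_computable_Suc) simp_all
  ultimately show ?thesis
    using total_computable_rec[OF total_computable_const, of k "\<lambda>i y xs. y + Suc i", OF _ assms, of 0]
    by simp
qed

lemma total_computable_pair:
  assumes "total_computable k F" "total_computable k G"
  shows "total_computable k (\<lambda>xs. prod_encode (F xs, G xs))"
  unfolding prod_encode_def case_prod_conv
  by (intro total_computable_add total_computable_triangle assms)

text \<open>
  Inverting the pairing function only requires the antidiagonal of a code; it is the least \<open>i\<close> with
  \<open>triangle (i + 1)\<close> beyond the code, hence found by search.
\<close>

lemma total_computable_diagonal:
  assumes "total_computable k F"
  shows "total_computable k (\<lambda>xs. fst (prod_decode (F xs)) + snd (prod_decode (F xs)))"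
proof -
  have mono: "mono triangle"
    by (rule mono_iff_le_Suc[THEN iffD2]) simp
  have eq: "(LEAST i. Suc c - triangle (Suc i) = 0) = fst (prod_decode c) + snd (prod_decode c)" for c
  proof -
    obtain a b where ab: "prod_decode c = (a, b)" by fastforce
    have c: "c = triangle (a + b) + a"
      using prod_decode_inverse[of c, unfolded ab] by (simp add: prod_encode_def)
    have diff_c: "Suc c - triangle (Suc (a + b)) = 0"
      by (simp add: c)
    show ?thesis
    proof (rule Least_equality)
      show "Suc c - triangle (Suc (fst (prod_decode c) + snd (prod_decode c))) = 0"
        using diff_c by (simp only: ab fst_conv snd_conv)
    next
      fix i assume i: "Suc c - triangle (Suc i) = 0"
      show "fst (prod_decode c) + snd (prod_decode c) \<le> i"
      proof (rule ccontr)
        assume "\<not> ?thesis"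
        then have "Suc i \<le> a + b" by (simp add: ab)
        then have "triangle (Suc i) \<le> c"
          using monoD[OF mono, of "Suc i" "a + b"] c by linarith
        with i show False by linarith
      qed
    qed
  qed
  have D: "total_computable (Suc k) (\<lambda>zs. F (drop 1 zs))"
    using total_computable_drop[OF assms, of 1] by simp
  have "total_computable k (\<lambda>xs. LEAST i. Suc (F xs) - triangle (Suc i) = 0)"
  proof (rule total_computable_least)
    show "total_computable (Suc k) (\<lambda>zs. Suc (F (drop 1 zs)) - triangle (Suc (zs ! 0)))"
      by (intro total_computable_diff total_computable_Suc total_computable_triangle
            total_computable_nth D) simp
    show "\<exists>i. Suc (F xs) - triangle (Suc i) = 0" for xs
      by (rule exI[of _ "F xs"]) simp
  qed
  then show ?thesis by (simp only: eq)
qed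

lemma total_computable_fst_snd:
  assumes "total_computable k F"
  shows "total_computable k (\<lambda>xs. fst (prod_decode (F xs)))"
    and "total_computable k (\<lambda>xs. snd (prod_decode (F xs)))"
proof -
  let ?d = "\<lambda>xs. fst (prod_decode (F xs)) + snd (prod_decode (F xs))"
  have *: "fst (prod_decode c) = c - triangle (fst (prod_decode c) + snd (prod_decode c))" for c
  proof -
    obtain a b where ab: "prod_decode c = (a, b)" by fastforce
    then show ?thesis
      using prod_decode_inverse[of c, unfolded ab] by (simp add: prod_encode_def)
  qed
  have "total_computable k (\<lambda>xs. F xs - triangle (?d xs))"
    by (intro total_computable_diff assms total_computable_triangle total_computable_diagonal)
  then show 1: "total_computable k (\<lambda>xs. fst (prod_decode (F xs)))"
    by (rule total_computable_cong) (rule *[symmetric])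
  have "total_computable k (\<lambda>xs. ?d xs - fst (prod_decode (F xs)))"
    by (intro total_computable_diff assms total_computable_diagonal 1)
  then show "total_computable k (\<lambda>xs. snd (prod_decode (F xs)))" by simp
qed

section \<open>Computable functions between encoded types\<close>

text \<open>
  Data built from numbers, truth values, pairs and lists are passed to programs by their codes, so that
  computability of a structured definition follows its syntax.
\<close>

class encodable =
  fixes enc :: "'a \<Rightarrow> nat"
  assumes enc_inject: "enc x = enc y \<Longrightarrow> x = y"

instantiation nat :: encodable
begin
definition enc_nat_def: "enc (n::nat) = n"
instance by standard (simp add: enc_nat_def)
end

instantiation bool :: encodable
begin
definition enc_bool_def: "enc b = (if b then Suc 0 else 0)"
instance by standard (simp add: enc_bool_def split: if_splits)
end

instantiation prod :: (encodable, encodable) encodable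
begin
definition enc_prod_def: "enc p = prod_encode (enc (fst p), enc (snd p))"
instance by standard (auto simp: enc_prod_def prod_eq_iff dest: enc_inject)
end

instantiation list :: (encodable) encodable
begin
definition enc_list_def: "enc xs = list_encode (map enc xs)"
instance
proof
  fix xs ys :: "'a list" assume "enc xs = enc ys"
  then have "map enc xs = map enc ys"
    by (simp add: enc_list_def list_encode_eq)
  then show "xs = ys"
    by (rule map_injective) (auto intro: injI enc_inject)
qed
end

lemma enc_Nil [simp]: "enc [] = 0" and enc_Cons [simp]: "enc (x # xs) = Suc (prod_encode (enc x, enc xs))"
  by (simp_all add: enc_list_def)

text \<open>
  Only the values at codes matter: on numbers that encode nothing, \<open>F\<close> is arbitrary but defined.
\<close>

definition computable :: "('a::encodable \<Rightarrow> 'b::encodable) \<Rightarrow> bool" where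
  "computable f \<longleftrightarrow> (\<exists>F. total_computable 1 (\<lambda>xs. F (xs ! 0)) \<and> (\<forall>x. F (enc x) = enc (f x)))"

lemma computableI:
  "total_computable 1 (\<lambda>xs. F (xs ! 0)) \<Longrightarrow> (\<And>x. F (enc x) = enc (f x)) \<Longrightarrow> computable f"
  unfolding computable_def by blast

lemma computableE:
  assumes "computable f"
  obtains F where "total_computable 1 (\<lambda>xs. F (xs ! 0))" "\<And>x. F (enc x) = enc (f x)"
  using assms unfolding computable_def by metis

named_theorems computable_intros

lemma total_computable_arg: "total_computable 1 (\<lambda>xs. xs ! 0)"
  by (rule total_computable_nth) simp

lemma total_computable_subst:
  assumes "total_computable 1 (\<lambda>xs. H (xs ! 0))" "total_computable k F"
  shows "total_computable k (\<lambda>xs. H (F xs))"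
  using total_computable_comp[of "[F]" "\<lambda>xs. H (xs ! 0)" k] assms by simp

lemma computable_id [computable_intros]: "computable (\<lambda>x. x)"
  unfolding computable_def by (rule exI[of _ "\<lambda>x. x"]) (simp add: total_computable_arg del: One_nat_def)

lemma computable_const [computable_intros]: "computable (\<lambda>x. c)"
  unfolding computable_def by (rule exI[of _ "\<lambda>_. enc c"]) (simp add: total_computable_const)

lemma computable_compose:
  assumes "computable f" "computable g"
  shows "computable (\<lambda>x. f (g x))"
proof -
  obtain F where F: "total_computable 1 (\<lambda>xs. F (xs ! 0))" "\<And>x. F (enc x) = enc (f x)"
    using computableE[OF assms(1)] by blast
  obtain G where G: "total_computable 1 (\<lambda>xs. G (xs ! 0))" "\<And>x. G (enc x) = enc (g x)"
    using computableE[OF assms(2)] by blast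
  show ?thesis
    by (rule computableI[OF total_computable_subst[OF F(1) G(1)]]) (simp add: F G)
qed

lemma computable_from_codes:
  assumes "computable f" "total_computable 1 (\<lambda>xs. H (xs ! 0))"
    and "\<And>x. enc (g x) = H (enc (f x))"
  shows "computable g"
proof -
  obtain F where F: "total_computable 1 (\<lambda>xs. F (xs ! 0))" "\<And>x. F (enc x) = enc (f x)"
    using computableE[OF assms(1)] by blast
  show ?thesis
    by (rule computableI[OF total_computable_subst[OF assms(2) F(1)]]) (simp add: F assms(3))
qed

lemma computable_Pair [computable_intros]:
  assumes "computable f" "computable g"
  shows "computable (\<lambda>x. (f x, g x))"
proof -
  obtain F where F: "total_computable 1 (\<lambda>xs. F (xs ! 0))" "\<And>x. F (enc x) = enc (f x)"
    using computableE[OF assms(1)] by blast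
  obtain G where G: "total_computable 1 (\<lambda>xs. G (xs ! 0))" "\<And>x. G (enc x) = enc (g x)"
    using computableE[OF assms(2)] by blast
  show ?thesis
    by (rule computableI[OF total_computable_pair[OF F(1) G(1)]]) (simp add: F G enc_prod_def)
qed

lemma computable_fst [computable_intros]: "computable f \<Longrightarrow> computable (\<lambda>x. fst (f x))"
  by (erule computable_from_codes[where H = "\<lambda>c. fst (prod_decode c)"])
     (intro total_computable_fst_snd total_computable_arg, simp add: enc_prod_def)

lemma computable_snd [computable_intros]: "computable f \<Longrightarrow> computable (\<lambda>x. snd (f x))"
  by (erule computable_from_codes[where H = "\<lambda>c. snd (prod_decode c)"])
     (intro total_computable_fst_snd total_computable_arg, simp add: enc_prod_def)

lemma computable_Suc [computable_intros]: "computable f \<Longrightarrow> computable (\<lambda>x. Suc (f x))"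
  by (erule computable_from_codes[where H = Suc])
     (intro total_computable_Suc total_computable_arg, simp add: enc_nat_def)

lemma computable_binary:
  assumes "computable (f :: 'a::encodable \<Rightarrow> 'b::encodable)" "computable (g :: 'a \<Rightarrow> 'c::encodable)"
    and "total_computable 1 (\<lambda>xs. H (fst (prod_decode (xs ! 0))) (snd (prod_decode (xs ! 0))))"
    and "\<And>x. enc (h x) = H (enc (f x)) (enc (g x))"
  shows "computable h"
  by (rule computable_from_codes[OF computable_Pair[OF assms(1,2)], OF assms(3)])
     (simp add: assms(4) enc_prod_def)

lemma computable_add [computable_intros]:
  "computable f \<Longrightarrow> computable g \<Longrightarrow> computable (\<lambda>x. f x + g x :: nat)"
  by (erule computable_binary[where H = "(+)"], assumption)
     (intro total_computable_add total_computable_fst_snd total_computable_arg, simp add: enc_nat_def)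

lemma computable_diff [computable_intros]:
  "computable f \<Longrightarrow> computable g \<Longrightarrow> computable (\<lambda>x. f x - g x :: nat)"
  by (erule computable_binary[where H = "(-)"], assumption)
     (intro total_computable_diff total_computable_fst_snd total_computable_arg, simp add: enc_nat_def)

lemma computable_mult [computable_intros]:
  "computable f \<Longrightarrow> computable g \<Longrightarrow> computable (\<lambda>x. f x * g x :: nat)"
  by (erule computable_binary[where H = "(*)"], assumption)
     (intro total_computable_mult total_computable_fst_snd total_computable_arg, simp add: enc_nat_def)

lemma computable_of_bool [computable_intros]:
  "computable b \<Longrightarrow> computable (\<lambda>x. of_bool (b x) :: nat)"
  by (erule computable_from_codes[where H = "\<lambda>c. c"])
     (intro total_computable_arg, simp add: enc_nat_def enc_bool_def)

lemma computable_if [computable_intros]: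
  assumes b: "computable b" and f: "computable f" and g: "computable g"
  shows "computable (\<lambda>x. if b x then f x else g x)"
proof (rule computable_binary[OF b computable_Pair[OF f g],
        where H = "\<lambda>c e. c * fst (prod_decode e) + (1 - c) * snd (prod_decode e)"])
  show "total_computable 1 (\<lambda>xs. fst (prod_decode (xs ! 0)) * fst (prod_decode (snd (prod_decode (xs ! 0)))) +
         (1 - fst (prod_decode (xs ! 0))) * snd (prod_decode (snd (prod_decode (xs ! 0)))))"
    by (intro total_computable_add total_computable_mult total_computable_diff total_computable_const
          total_computable_fst_snd total_computable_arg)
qed (simp add: enc_prod_def enc_bool_def)

lemma computable_eq0:
  assumes "computable f" shows "computable (\<lambda>x. f x = (0::nat))"
proof (rule computable_from_codes[OF assms, where H = "\<lambda>c. 1 - c"])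
  show "total_computable 1 (\<lambda>xs. 1 - xs ! 0)"
    by (intro total_computable_diff total_computable_const total_computable_arg)
qed (simp add: enc_nat_def enc_bool_def)

lemma computable_not [computable_intros]:
  assumes "computable b" shows "computable (\<lambda>x. \<not> b x)"
  using computable_eq0[OF computable_of_bool[OF assms]] by simp

lemma computable_conj [computable_intros]:
  assumes "computable b" "computable c" shows "computable (\<lambda>x. b x \<and> c x)"
proof -
  have "(\<lambda>x. b x \<and> c x) = (\<lambda>x. if b x then c x else False)" by auto
  then show ?thesis
    by (simp only:) (intro computable_if assms computable_const)
qed

lemma computable_disj [computable_intros]:
  assumes "computable b" "computable c" shows "computable (\<lambda>x. b x \<or> c x)"
  using computable_not[OF computable_conj[OF assms[THEN computable_not]]] by simp

lemma computable_imp [computable_intros]: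
  assumes "computable b" "computable c" shows "computable (\<lambda>x. b x \<longrightarrow> c x)"
  unfolding imp_conv_disj by (intro computable_disj computable_not assms)

lemma computable_le [computable_intros]:
  assumes "computable f" "computable g" shows "computable (\<lambda>x. f x \<le> (g x :: nat))"
  using computable_eq0[OF computable_diff[OF assms]] by simp

lemma computable_less [computable_intros]:
  assumes "computable f" "computable g" shows "computable (\<lambda>x. f x < (g x :: nat))"
  unfolding not_le[symmetric] by (intro computable_not computable_le assms)

lemma computable_eq_nat [computable_intros]:
  assumes "computable f" "computable g" shows "computable (\<lambda>x. f x = (g x :: nat))"
  unfolding eq_iff by (intro computable_conj computable_le assms)

lemma computable_enc [computable_intros]: "computable f \<Longrightarrow> computable (\<lambda>x. enc (f x))"
  by (erule computable_from_codes[where H = "\<lambda>c. c"])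
     (intro total_computable_arg, simp add: enc_nat_def)

lemma computable_eq:
  assumes "computable f" "computable g" shows "computable (\<lambda>x. f x = g x)"
proof -
  have "(\<lambda>x. f x = g x) = (\<lambda>x. enc (f x) = enc (g x))"
    by (auto dest: enc_inject)
  then show ?thesis
    by (simp only:) (intro computable_eq_nat computable_enc assms)
qed

text \<open>
  The parameter \<open>x\<close> is carried along as a code.  Stating the step as a function of a nested pair lets
  the closure rules decompose it again.
\<close>

lemma computable_rec_nat [computable_intros]:
  assumes A: "computable A" and S: "computable (\<lambda>p. S (fst p) (fst (snd p)) (snd (snd p)))"
    and N: "computable N"
  shows "computable (\<lambda>x. rec_nat (A x) (\<lambda>i y. S x i y) (N x))"
proof -
  obtain a where a: "total_computable 1 (\<lambda>xs. a (xs ! 0))" "\<forall>x. a (enc x) = enc (A x)"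
    using A by (auto simp: computable_def)
  obtain n where n: "total_computable 1 (\<lambda>xs. n (xs ! 0))" "\<forall>x. n (enc x) = enc (N x)"
    using N by (auto simp: computable_def)
  obtain s where s: "total_computable 1 (\<lambda>xs. s (xs ! 0))"
      "\<forall>p. s (enc p) = enc (S (fst p) (fst (snd p)) (snd (snd p)))"
    using S by (auto simp: computable_def)
  define R where "R c = rec_nat (a c) (\<lambda>i y. s (prod_encode (c, prod_encode (i, y)))) (n c)" for c
  have "total_computable 1 (\<lambda>xs. rec_nat (a (xs ! 0))
          (\<lambda>i y. (\<lambda>i y xs. s (prod_encode (xs ! 0, prod_encode (i, y)))) i y xs) (n (xs ! 0)))"
  proof (rule total_computable_rec[OF a(1) _ n(1)])
    have "total_computable (Suc (Suc 1))
            (\<lambda>zs. s (prod_encode (zs ! 2, prod_encode (zs ! 0, zs ! 1))))"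
      by (intro total_computable_subst[OF s(1)] total_computable_pair total_computable_nth) simp_all
    then show "total_computable (Suc (Suc 1))
            (\<lambda>zs. s (prod_encode (drop 2 zs ! 0, prod_encode (zs ! 0, zs ! 1))))"
      by (rule total_computable_cong) simp
  qed
  then have "total_computable 1 (\<lambda>xs. R (xs ! 0))"
    by (simp add: R_def)
  moreover have "R (enc x) = enc (rec_nat (A x) (\<lambda>i y. S x i y) (N x))" for x
  proof -
    have "rec_nat (a (enc x)) (\<lambda>i y. s (prod_encode (enc x, prod_encode (i, y)))) k
        = enc (rec_nat (A x) (\<lambda>i y. S x i y) k)" for k
    proof (induction k)
      case (Suc k)
      then show ?case
        using s(2)[rule_format, of "(x, k, rec_nat (A x) (\<lambda>i y. S x i y) k)"]
        by (simp add: enc_prod_def enc_nat_def)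
    qed (simp add: a)
    then show ?thesis by (simp add: R_def n(2) enc_nat_def)
  qed
  ultimately show ?thesis
    unfolding computable_def by blast
qed

text \<open>
  Surjectivity of the encoding keeps the search from running forever on a number that encodes nothing.
\<close>

lemma computable_least:
  fixes P :: "'a::encodable \<Rightarrow> nat \<Rightarrow> bool"
  assumes surj: "surj (enc :: 'a \<Rightarrow> nat)"
    and P: "computable (\<lambda>p. P (fst p) (snd p))" and ex: "\<And>x. \<exists>i. P x i"
  shows "computable (\<lambda>x. LEAST i::nat. P x i)"
proof -
  obtain p where p: "total_computable 1 (\<lambda>xs. p (xs ! 0))"
      "\<forall>q. p (enc q) = enc (P (fst q) (snd q))"
    using P by (auto simp: computable_def)
  define Q where "Q i c = (1 - p (prod_encode (c, i)))" for i c
  have Q: "Q i (enc x) = 0 \<longleftrightarrow> P x i" for x i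
    using p(2)[rule_format, of "(x, i)"] by (simp add: Q_def enc_prod_def enc_nat_def enc_bool_def)
  have "total_computable 1 (\<lambda>xs. LEAST i. Q i (xs ! 0) = 0)"
  proof (rule total_computable_least)
    have "total_computable (Suc 1) (\<lambda>zs. Q (zs ! 0) (zs ! 1))"
      unfolding Q_def
      by (intro total_computable_diff total_computable_const total_computable_subst[OF p(1)]
            total_computable_pair total_computable_nth) simp_all
    then show "total_computable (Suc 1) (\<lambda>zs. Q (zs ! 0) (drop 1 zs ! 0))"
      by (rule total_computable_cong) simp
    show "\<exists>i. Q i (xs ! 0) = 0" for xs
      using ex Q surj by (metis surjD)
  qed
  then show ?thesis
    unfolding computable_def
    by (intro exI[of _ "\<lambda>c. LEAST i. Q i c = 0"]) (simp add: Q enc_nat_def del: One_nat_def)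
qed

section \<open>Computable list functions and arithmetic\<close>

lemma surj_enc_nat: "surj (enc :: nat \<Rightarrow> nat)"
  by (auto simp: enc_nat_def)

lemma surj_enc_prod:
  assumes "surj (enc :: 'a::encodable \<Rightarrow> nat)" "surj (enc :: 'b::encodable \<Rightarrow> nat)"
  shows "surj (enc :: 'a \<times> 'b \<Rightarrow> nat)"
proof (rule surjI)
  fix n
  show "enc (inv (enc :: 'a \<Rightarrow> nat) (fst (prod_decode n)), inv (enc :: 'b \<Rightarrow> nat) (snd (prod_decode n))) = n"
    using assms by (simp add: enc_prod_def surj_f_inv_f)
qed

lemma enc_nat_list: "enc (xs :: nat list) = list_encode xs"
proof -
  have "map (enc :: nat \<Rightarrow> nat) xs = xs" by (rule map_idI) (simp add: enc_nat_def)
  then show ?thesis by (simp add: enc_list_def)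
qed

lemma surj_enc_nat_list: "surj (enc :: nat list \<Rightarrow> nat)"
  unfolding enc_nat_list[abs_def] by (rule surj_list_encode)

lemma computable_list_decode [computable_intros]:
  "computable f \<Longrightarrow> computable (\<lambda>x. list_decode (f x))"
  by (erule computable_from_codes[where H = "\<lambda>c. c"])
     (intro total_computable_arg, simp add: enc_nat_list enc_nat_def)

lemma computable_prod_decode [computable_intros]:
  "computable f \<Longrightarrow> computable (\<lambda>x. prod_decode (f x))"
  by (erule computable_from_codes[where H = "\<lambda>c. c"])
     (intro total_computable_arg, simp add: enc_prod_def enc_nat_def)

lemma computable_prod_encode [computable_intros]:
  "computable f \<Longrightarrow> computable (\<lambda>x. prod_encode (f x))"
  by (erule computable_from_codes[where H = "\<lambda>c. c"])
     (intro total_computable_arg, simp add: enc_prod_def enc_nat_def)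

lemma computable_Cons [computable_intros]:
  assumes "computable f" "computable g"
  shows "computable (\<lambda>x. f x # g x)"
  by (rule computable_from_codes[OF computable_Pair[OF assms], where H = Suc])
     (intro total_computable_Suc total_computable_arg, simp add: enc_prod_def)

lemma computable_case_list [computable_intros]:
  assumes L: "computable L" and A: "computable A"
    and B: "computable (\<lambda>p. B (fst p) (fst (snd p)) (snd (snd p)))"
  shows "computable (\<lambda>x. case L x of [] \<Rightarrow> A x | y # ys \<Rightarrow> B x y ys)"
proof -
  obtain l where l: "total_computable 1 (\<lambda>xs. l (xs ! 0))" "\<And>x. l (enc x) = enc (L x)"
    using computableE[OF L] by blast
  obtain a where a: "total_computable 1 (\<lambda>xs. a (xs ! 0))" "\<And>x. a (enc x) = enc (A x)"
    using computableE[OF A] by blast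
  obtain b where b: "total_computable 1 (\<lambda>xs. b (xs ! 0))"
      "\<And>p. b (enc p) = enc (B (fst p) (fst (snd p)) (snd (snd p)))"
    using computableE[OF B] by blast
  show ?thesis
  proof (rule computableI)
    show "total_computable 1 (\<lambda>xs. (1 - l (xs ! 0)) * a (xs ! 0)
            + (1 - (1 - l (xs ! 0))) * b (prod_encode (xs ! 0, l (xs ! 0) - 1)))"
      by (intro total_computable_add total_computable_mult total_computable_diff total_computable_const
           total_computable_pair total_computable_arg total_computable_subst[OF b(1)] l(1) a(1))
    show "(1 - l (enc x)) * a (enc x) + (1 - (1 - l (enc x))) * b (prod_encode (enc x, l (enc x) - 1))
        = enc (case L x of [] \<Rightarrow> A x | y # ys \<Rightarrow> B x y ys)" for x
    proof (cases "L x")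
      case (Cons y ys)
      then show ?thesis
        using b(2)[of "(x, y, ys)"] by (simp add: l(2) enc_prod_def)
    qed (simp add: l(2) a(2))
  qed
qed

lemma length_le_enc: "length xs \<le> enc xs"
proof (induction xs)
  case (Cons x xs)
  have "enc xs \<le> prod_encode (enc x, enc xs)" by (rule le_prod_encode_2)
  with Cons show ?case by simp
qed simp

text \<open>
  A fold iterates a single step on the remaining list and the accumulator.  The code of the list serves
  as the number of iterations: it is at least the length, and superfluous steps do nothing.
\<close>

lemma computable_foldl [computable_intros]:
  assumes F: "computable (\<lambda>p. F (fst p) (fst (snd p)) (snd (snd p)))"
    and A: "computable A" and L: "computable L"
  shows "computable (\<lambda>x. foldl (\<lambda>s y. F x s y) (A x) (L x))"
proof -
  let ?step = "\<lambda>x (i::nat) p. case fst p of [] \<Rightarrow> p | y # ys \<Rightarrow> (ys, F x (snd p) y)"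
  have run: "rec_nat (xs, a) (?step x) k = (drop k xs, foldl (F x) a (take k xs))" for xs a x k
  proof (induction k)
    case (Suc k)
    show ?case
    proof (cases "k < length xs")
      case True
      then show ?thesis
        using Suc by (simp add: Cons_nth_drop_Suc[symmetric] take_Suc_conv_app_nth)
    qed (use Suc in simp)
  qed simp
  have F': "computable (\<lambda>q. F (fst (fst q)) (snd (snd (snd (fst q)))) (fst (snd q)))"
  proof -
    have "computable (\<lambda>q. (fst (fst q), snd (snd (snd (fst q))), fst (snd q)))"
      by (intro computable_intros)
    from computable_compose[OF F this] show ?thesis by simp
  qed
  have "computable (\<lambda>x. snd (rec_nat (L x, A x) (\<lambda>i p. ?step x i p) (enc (L x))))"
    by (intro computable_intros L A F')
  then show ?thesis
    unfolding run by (simp add: length_le_enc)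
qed

lemma computable_rev [computable_intros]:
  assumes "computable f" shows "computable (\<lambda>x. rev (f x))"
proof -
  have "foldl (\<lambda>s y. y # s) acc xs = rev xs @ acc" for acc xs :: "'b list"
    by (induction xs arbitrary: acc) auto
  then have "rev xs = foldl (\<lambda>s y. y # s) [] xs" for xs :: "'b list" by simp
  then show ?thesis
    by (simp only:) (intro computable_intros assms)
qed

lemma computable_foldr [computable_intros]:
  assumes F: "computable (\<lambda>p. F (fst p) (fst (snd p)) (snd (snd p)))"
    and A: "computable A" and L: "computable L"
  shows "computable (\<lambda>x. foldr (\<lambda>y s. F x y s) (L x) (A x))"
proof -
  have F': "computable (\<lambda>p. F (fst p) (snd (snd p)) (fst (snd p)))"
  proof -
    have "computable (\<lambda>p. (fst p, snd (snd p), fst (snd p)))"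
      by (intro computable_intros)
    from computable_compose[OF F this] show ?thesis by simp
  qed
  show ?thesis
    unfolding foldr_conv_foldl by (intro computable_foldl[where F = "\<lambda>x s y. F x y s"] F' A computable_rev L)
qed

lemma computable_append [computable_intros]:
  assumes "computable f" "computable g" shows "computable (\<lambda>x. f x @ g x)"
proof -
  have "xs @ ys = foldr (\<lambda>y s. y # s) xs ys" for xs ys :: "'b list"
    by (induction xs) auto
  then show ?thesis
    by (simp only:) (intro computable_foldr computable_intros assms)
qed

lemma computable_map [computable_intros]:
  fixes F :: "'a::encodable \<Rightarrow> 'b::encodable \<Rightarrow> 'c::encodable"
  assumes "computable (\<lambda>p. F (fst p) (snd p))" "computable L"
  shows "computable (\<lambda>x. map (\<lambda>y. F x y) (L x))"
proof -
  have eq: "map f xs = foldr (\<lambda>y s. f y # s) xs []" for f :: "'b \<Rightarrow> 'c" and xs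
    by (induction xs) auto
  have "computable (\<lambda>p. (fst p, fst (snd p)))"
    by (intro computable_intros)
  from computable_compose[OF assms(1) this] have "computable (\<lambda>p. F (fst p) (fst (snd p)))"
    by simp
  then show ?thesis
    unfolding eq by (intro computable_foldr computable_intros assms)
qed

lemma computable_concat [computable_intros]:
  assumes "computable f" shows "computable (\<lambda>x. concat (f x))"
proof -
  have "concat xss = foldr (\<lambda>y s. y @ s) xss []" for xss :: "'b list list"
    by (induction xss) auto
  then show ?thesis
    by (simp only:) (intro computable_foldr computable_intros assms)
qed

lemma computable_ball [computable_intros]:
  fixes P :: "'a::encodable \<Rightarrow> 'b::encodable \<Rightarrow> bool"
  assumes "computable (\<lambda>p. P (fst p) (snd p))" "computable L"
  shows "computable (\<lambda>x. \<forall>y\<in>set (L x). P x y)"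
proof -
  have eq: "(\<forall>y\<in>set xs. p y) = foldr (\<lambda>y s. p y \<and> s) xs True" for p :: "'b \<Rightarrow> bool" and xs
    by (induction xs) auto
  have "computable (\<lambda>p. (fst p, fst (snd p)))"
    by (intro computable_intros)
  from computable_compose[OF assms(1) this] have "computable (\<lambda>p. P (fst p) (fst (snd p)))"
    by simp
  then show ?thesis
    unfolding eq by (intro computable_foldr computable_intros assms)
qed

lemma computable_bex [computable_intros]:
  fixes P :: "'a::encodable \<Rightarrow> 'b::encodable \<Rightarrow> bool"
  assumes "computable (\<lambda>p. P (fst p) (snd p))" "computable L"
  shows "computable (\<lambda>x. \<exists>y\<in>set (L x). P x y)"
proof -
  have "(\<exists>y\<in>A. p y) = (\<not> (\<forall>y\<in>A. \<not> p y))" for p :: "'b \<Rightarrow> bool" and A by blast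
  then show ?thesis
    by (simp only:) (intro computable_intros assms)
qed

lemma computable_upt [computable_intros]:
  assumes "computable f" "computable g" shows "computable (\<lambda>x. [f x..<g x])"
proof -
  have 0: "[0..<n] = rec_nat [] (\<lambda>i y. y @ [i]) n" for n
    by (induction n) auto
  have "[a..<b] = map (\<lambda>i. i + a) (rec_nat [] (\<lambda>i y. y @ [i]) (b - a))" for a b
    unfolding 0[symmetric] map_add_upt by (cases "a \<le> b") auto
  moreover have "computable (\<lambda>p. f (fst p))"
    by (rule computable_compose[OF assms(1)]) (intro computable_intros)
  ultimately show ?thesis
    by (simp only:) (intro computable_map computable_intros assms)
qed

lemma computable_drop [computable_intros]:
  assumes "computable f" "computable g" shows "computable (\<lambda>x. drop (f x) (g x))"
proof -
  have "drop n xs = rec_nat xs (\<lambda>i ys. case ys of [] \<Rightarrow> [] | z # zs \<Rightarrow> zs) n" for n and xs :: "'b list"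
  proof (induction n)
    case (Suc n)
    have "drop (Suc n) xs = tl (drop n xs)" by (simp add: drop_Suc tl_drop)
    then show ?case by (cases "drop n xs") (simp_all add: Suc[symmetric])
  qed simp
  then show ?thesis
    by (simp only:) (intro computable_intros assms)
qed

lemma computable_distinct [computable_intros]:
  assumes "computable f" shows "computable (\<lambda>x. distinct (f x))"
proof -
  have *: "foldr (\<lambda>y s. (y # fst s, snd s \<and> (\<forall>z\<in>set (fst s). z \<noteq> y))) xs ([], True) = (xs, distinct xs)"
    for xs :: "'b list"
    by (induction xs) auto
  have "distinct xs = snd (foldr (\<lambda>y s. (y # fst s, snd s \<and> (\<forall>z\<in>set (fst s). z \<noteq> y))) xs ([], True))"
    for xs :: "'b list"
    unfolding * by simp
  then show ?thesis
    by (simp only:) (intro computable_intros computable_eq assms)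
qed

lemma computable_div [computable_intros]:
  assumes "computable f" "computable g" shows "computable (\<lambda>x. f x div g x :: nat)"
proof -
  have eq: "(if b = 0 then 0 else LEAST k. b = 0 \<or> a < b * Suc k) = a div b" for a b :: nat
  proof (cases "b = 0")
    case False
    have "(LEAST k. b = 0 \<or> a < b * Suc k) = a div b"
    proof (rule Least_equality)
      show "b = 0 \<or> a < b * Suc (a div b)"
        using False by (metis dividend_less_times_div mult_Suc_right add.commute neq0_conv)
      fix k assume "b = 0 \<or> a < b * Suc k"
      then have "a div b < Suc k" using False by (simp add: less_mult_imp_div_less mult.commute)
      then show "a div b \<le> k" by simp
    qed
    with False show ?thesis by simp
  qed simp
  have "computable (\<lambda>p::nat \<times> nat. LEAST k. snd p = 0 \<or> fst p < snd p * Suc k)"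
  proof (rule computable_least)
    show "surj (enc :: nat \<times> nat \<Rightarrow> nat)" by (intro surj_enc_prod surj_enc_nat)
    show "\<exists>k. snd p = 0 \<or> fst p < snd p * Suc k" for p :: "nat \<times> nat"
      by (rule exI[of _ "fst p"]) (cases "snd p"; simp)
  qed (intro computable_intros)
  from computable_compose[OF this computable_Pair[OF assms]]
  have *: "computable (\<lambda>x. LEAST k. g x = 0 \<or> f x < g x * Suc k)" by simp
  have "computable (\<lambda>x. if g x = 0 then 0 else LEAST k. g x = 0 \<or> f x < g x * Suc k)"
    by (intro computable_if computable_eq_nat assms computable_const *)
  then show ?thesis by (simp only: eq)
qed

lemma computable_even [computable_intros]:
  assumes "computable f" shows "computable (\<lambda>x. even (f x :: nat))"
proof -
  have "even n \<longleftrightarrow> 2 * (n div 2) = n" for n :: nat by presburger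
  then show ?thesis by (simp only:) (intro computable_intros assms)
qed

lemma computable_power2 [computable_intros]:
  assumes "computable f" shows "computable (\<lambda>x. 2 ^ f x :: nat)"
proof -
  have "(2::nat) ^ n = rec_nat 1 (\<lambda>i y. 2 * y) n" for n by (induction n) auto
  then show ?thesis by (simp only:) (intro computable_intros assms)
qed

section \<open>Computable rational-valued functions\<close>

text \<open>
  Rationals occur as real values of functions only; arguments that stand for rationals are given by their
  codes.  In this way the many codes of one rational need not be identified.
\<close>

definition computable_rat :: "('a::encodable \<Rightarrow> real) \<Rightarrow> bool" where
  "computable_rat f \<longleftrightarrow> (\<exists>c. computable c \<and> (\<forall>x. rat_decode (c x) = f x))"

lemma computable_rat_decode [computable_intros]:
  "computable c \<Longrightarrow> computable_rat (\<lambda>x. rat_decode (c x))"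
  by (auto simp: computable_rat_def)

lemma computable_rat_compose:
  assumes "computable_rat f" "computable g"
  shows "computable_rat (\<lambda>x. f (g x))"
proof -
  obtain c where "computable c" "\<And>x. rat_decode (c x) = f x"
    using assms(1) by (auto simp: computable_rat_def)
  then show ?thesis
    unfolding computable_rat_def by (intro exI[of _ "\<lambda>x. c (g x)"]) (simp add: computable_compose assms(2))
qed

lemma computable_rat_fraction:
  assumes "computable p" "computable n" "computable d"
  shows "computable_rat (\<lambda>x. (real (p x) - real (n x)) / real (Suc (d x)))"
proof -
  let ?c = "\<lambda>x. prod_encode (if n x \<le> p x then 2 * (p x - n x) else 2 * (n x - p x) - 1, d x)"
  have "computable ?c" by (intro computable_intros assms)
  moreover have "rat_decode (?c x) = (real (p x) - real (n x)) / real (Suc (d x))" for x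
  proof -
    have "real_of_int (int_decode (if n x \<le> p x then 2 * (p x - n x) else 2 * (n x - p x) - 1))
        = real (p x) - real (n x)"
    proof (cases "n x \<le> p x")
      case False
      then have "odd (2 * (n x - p x) - 1)" "(2 * (n x - p x) - 1) div 2 = n x - p x - 1"
        by presburger+
      with False show ?thesis
        by (auto simp: int_decode_def sum_decode_def)
    qed (auto simp: int_decode_def sum_decode_def)
    then show ?thesis by (simp add: rat_decode_def)
  qed
  ultimately show ?thesis unfolding computable_rat_def by blast
qed

text \<open>
  Splitting the numerator into a difference of natural numbers reduces rational arithmetic and
  comparison to polynomials over the natural numbers.
\<close>

lemma computable_ratE:
  assumes "computable_rat f"
  obtains p n d where "computable p" "computable n" "computable d"
    "\<And>x. f x = (real (p x) - real (n x)) / real (Suc (d x))"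
proof -
  obtain c where c: "computable c" "\<And>x. rat_decode (c x) = f x"
    using assms by (auto simp: computable_rat_def)
  let ?z = "\<lambda>x. fst (prod_decode (c x))"
  show thesis
  proof (rule that)
    show "computable (\<lambda>x. if even (?z x) then ?z x div 2 else 0)"
      "computable (\<lambda>x. if even (?z x) then 0 else Suc (?z x div 2))"
      "computable (\<lambda>x. snd (prod_decode (c x)))"
      by (intro computable_intros c(1))+
    show "f x = (real (if even (?z x) then ?z x div 2 else 0) -
        real (if even (?z x) then 0 else Suc (?z x div 2))) / real (Suc (snd (prod_decode (c x))))" for x
      unfolding c(2)[symmetric] rat_decode_def
      by (simp add: split_beta int_decode_def sum_decode_def)
  qed
qed

lemma computable_rat_add [computable_intros]:
  assumes "computable_rat f" "computable_rat g"
  shows "computable_rat (\<lambda>x. f x + g x)"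
proof -
  obtain p n d where f: "computable p" "computable n" "computable d"
    "\<And>x. f x = (real (p x) - real (n x)) / real (Suc (d x))" using computable_ratE[OF assms(1)] by blast
  obtain p' n' d' where g: "computable p'" "computable n'" "computable d'"
    "\<And>x. g x = (real (p' x) - real (n' x)) / real (Suc (d' x))" using computable_ratE[OF assms(2)] by blast
  have "computable_rat (\<lambda>x. (real (p x * Suc (d' x) + p' x * Suc (d x))
      - real (n x * Suc (d' x) + n' x * Suc (d x))) / real (Suc (d x * Suc (d' x) + d' x)))"
    by (intro computable_rat_fraction computable_intros f g)
  moreover have "(\<lambda>x. f x + g x) = (\<lambda>x. (real (p x * Suc (d' x) + p' x * Suc (d x))
      - real (n x * Suc (d' x) + n' x * Suc (d x))) / real (Suc (d x * Suc (d' x) + d' x)))"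
    unfolding f g by (auto simp: field_simps)
  ultimately show ?thesis by simp
qed

lemma computable_rat_mult [computable_intros]:
  assumes "computable_rat f" "computable_rat g"
  shows "computable_rat (\<lambda>x. f x * g x)"
proof -
  obtain p n d where f: "computable p" "computable n" "computable d"
    "\<And>x. f x = (real (p x) - real (n x)) / real (Suc (d x))" using computable_ratE[OF assms(1)] by blast
  obtain p' n' d' where g: "computable p'" "computable n'" "computable d'"
    "\<And>x. g x = (real (p' x) - real (n' x)) / real (Suc (d' x))" using computable_ratE[OF assms(2)] by blast
  have "computable_rat (\<lambda>x. (real (p x * p' x + n x * n' x)
      - real (n x * p' x + p x * n' x)) / real (Suc (d x * Suc (d' x) + d' x)))"
    by (intro computable_rat_fraction computable_intros f g)
  moreover have "(\<lambda>x. f x * g x) = (\<lambda>x. (real (p x * p' x + n x * n' x)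
      - real (n x * p' x + p x * n' x)) / real (Suc (d x * Suc (d' x) + d' x)))"
    unfolding f g by (auto simp: field_simps)
  ultimately show ?thesis by simp
qed

lemma computable_rat_of_nat [computable_intros]:
  assumes "computable f" shows "computable_rat (\<lambda>x. real (f x))"
  using computable_rat_fraction[OF assms computable_const[of 0] computable_const[of 0]] by simp

lemma computable_rat_uminus [computable_intros]:
  assumes "computable_rat f" shows "computable_rat (\<lambda>x. - f x)"
proof -
  have "computable_rat (\<lambda>x::'a. (real 0 - real 1) / real (Suc 0))"
    by (intro computable_rat_fraction computable_const)
  then have "computable_rat (\<lambda>x. (real 0 - real 1) / real (Suc 0) * f x)"
    by (intro computable_rat_mult assms)
  then show ?thesis by simp
qed

lemma computable_rat_diff [computable_intros]:
  assumes "computable_rat f" "computable_rat g"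
  shows "computable_rat (\<lambda>x. f x - g x)"
  using computable_rat_add[OF assms(1) computable_rat_uminus[OF assms(2)]] by simp

lemma computable_rat_inverse_power2 [computable_intros]:
  assumes "computable f" shows "computable_rat (\<lambda>x. 1 / 2 ^ f x)"
proof -
  have "computable_rat (\<lambda>x. (real 1 - real 0) / real (Suc (2 ^ f x - 1)))"
    by (intro computable_rat_fraction computable_intros assms)
  moreover have "(real 1 - real 0) / real (Suc (2 ^ k - 1)) = 1 / 2 ^ k" for k :: nat
    by simp
  ultimately show ?thesis by simp
qed

lemma computable_rat_less [computable_intros]:
  assumes "computable_rat f" "computable_rat g"
  shows "computable (\<lambda>x. f x < g x)"
proof -
  obtain p n d where f: "computable p" "computable n" "computable d"
    "\<And>x. f x = (real (p x) - real (n x)) / real (Suc (d x))" using computable_ratE[OF assms(1)] by blast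
  obtain p' n' d' where g: "computable p'" "computable n'" "computable d'"
    "\<And>x. g x = (real (p' x) - real (n' x)) / real (Suc (d' x))" using computable_ratE[OF assms(2)] by blast
  have frac: "a / b < c / e \<longleftrightarrow> a * e < c * b" if "b > 0" "e > 0" for a b c e :: real
    using that by (simp add: field_simps)
  have "f x < g x \<longleftrightarrow> p x * Suc (d' x) + n' x * Suc (d x) < p' x * Suc (d x) + n x * Suc (d' x)" for x
  proof -
    have "f x < g x \<longleftrightarrow>
        (real (p x) - real (n x)) * real (Suc (d' x)) < (real (p' x) - real (n' x)) * real (Suc (d x))"
      unfolding f g by (rule frac) simp_all
    also have "\<dots> \<longleftrightarrow> real (p x * Suc (d' x) + n' x * Suc (d x)) < real (p' x * Suc (d x) + n x * Suc (d' x))"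
      by (simp add: algebra_simps)
    finally show ?thesis by (simp only: of_nat_less_iff)
  qed
  then show ?thesis
    by (simp only:) (intro computable_intros f g)
qed

lemma computable_rat_le [computable_intros]:
  assumes "computable_rat f" "computable_rat g" shows "computable (\<lambda>x. f x \<le> g x)"
  unfolding not_less[symmetric] by (intro computable_not computable_rat_less assms)

lemma computable_rat_if [computable_intros]:
  assumes "computable b" "computable_rat f" "computable_rat g"
  shows "computable_rat (\<lambda>x. if b x then f x else g x)"
proof -
  obtain c d where c: "computable c" "\<And>x. rat_decode (c x) = f x" 
    and d: "computable d" "\<And>x. rat_decode (d x) = g x"
    using assms by (auto simp: computable_rat_def)
  have "computable (\<lambda>x. if b x then c x else d x)"
    by (intro computable_if assms c d)
  then show ?thesis
    unfolding computable_rat_def by (rule exI[of _ "\<lambda>x. if b x then c x else d x", OF conjI]) (simp add: c d)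
qed

lemma computable_rat_abs [computable_intros]:
  assumes "computable_rat f" shows "computable_rat (\<lambda>x. \<bar>f x\<bar>)"
proof -
  have "computable_rat (\<lambda>x. real 0)"  by (intro computable_intros)
  then have "computable_rat (\<lambda>x. if f x < real 0 then - f x else f x)"
    by (intro computable_intros assms)
  then show ?thesis by (simp add: abs_if)
qed

lemma computable_rat_min [computable_intros]:
  assumes "computable_rat f" "computable_rat g" shows "computable_rat (\<lambda>x. min (f x) (g x))"
  unfolding min_def by (intro computable_intros assms)

lemma computable_rat_sum_list [computable_intros]:
  fixes F :: "'a::encodable \<Rightarrow> 'b::encodable \<Rightarrow> real"
  assumes F: "computable_rat (\<lambda>p. F (fst p) (snd p))" and L: "computable L"
  shows "computable_rat (\<lambda>x. \<Sum>y\<leftarrow>L x. F x y)"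
proof -
  have "computable_rat (\<lambda>q::nat \<times> nat. rat_decode (fst q) + rat_decode (snd q))"
    by (intro computable_intros)
  then obtain add where add: "computable add"
    "\<And>q. rat_decode (add q) = rat_decode (fst q) + rat_decode (snd q)"
    by (auto simp: computable_rat_def)
  obtain c where c: "computable c" "\<And>p. rat_decode (c p) = F (fst p) (snd p)"
    using F by (auto simp: computable_rat_def)
  have "computable (\<lambda>p::'a \<times> 'b \<times> nat. add (c (fst p, fst (snd p)), snd (snd p)))"
    by (intro computable_compose[OF add(1)] computable_compose[OF c(1)] computable_intros)
  then have "computable (\<lambda>x. foldr (\<lambda>y s. add (c (x, y), s)) (L x) 0)"
    by (intro computable_foldr L computable_const)
  moreover have "rat_decode (foldr (\<lambda>y s. add (c (x, y), s)) ys 0) = (\<Sum>y\<leftarrow>ys. F x y)" for x ys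
    by (induction ys) (simp_all add: add c, simp add: rat_decode_def prod_decode_def prod_decode_aux.simps int_decode_def sum_decode_def)
  ultimately show ?thesis
    unfolding computable_rat_def by blast
qed

lemma rat_decode_surj:
  assumes "x \<in> \<rat>" obtains c where "rat_decode c = x"
proof -
  obtain a b where x: "x = real_of_int a / real_of_int b" "b > 0"
    using assms by (elim Rats_cases') auto
  have "rat_decode (prod_encode (int_encode a, nat b - 1)) = x"
    using x by (simp add: rat_decode_def of_nat_diff)
  then show thesis by (rule that)
qed

lemma rat_decode_in_Rats: "rat_decode c \<in> \<rat>"
  unfolding rat_decode_def split_beta by (intro Rats_divide Rats_of_int Rats_of_nat)

section \<open>Effectively open sets\<close>

text \<open>
  An enumeration of intervals as the projection of a decidable relation.  The first argument of \<open>P\<close> is the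
  witness that the interval with codes \<open>c\<close>, \<open>d\<close> is to be listed in the \<open>i\<close>-th set.  Keeping this witness
  explicit makes it unnecessary to count computation steps of a given program later.
\<close>

definition rat_open :: "(nat \<Rightarrow> nat \<Rightarrow> nat \<Rightarrow> nat \<Rightarrow> bool) \<Rightarrow> nat \<Rightarrow> real set" where
  "rat_open P i = (\<Union>(c, d) \<in> {(c, d). \<exists>k. P k i c d}. {rat_decode c <..< rat_decode d})"

definition computable4 :: "(nat \<Rightarrow> nat \<Rightarrow> nat \<Rightarrow> nat \<Rightarrow> bool) \<Rightarrow> bool" where
  "computable4 P \<longleftrightarrow> computable (\<lambda>p. P (fst p) (fst (snd p)) (fst (snd (snd p))) (snd (snd (snd p))))"

lemma halts_search:
  assumes "total_computable (Suc k) H"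
  obtains f where "\<And>xs. length xs = k \<Longrightarrow> halts f xs \<longleftrightarrow> (\<exists>i. H (i # xs) = 0)"
proof -
  obtain h where h: "\<And>xs. length xs = Suc k \<Longrightarrow> computes h xs (H xs)"
    using assms by (auto simp: total_computable_def)
  have "halts (Mu h) xs \<longleftrightarrow> (\<exists>i. H (i # xs) = 0)" if xs: "length xs = k" for xs
  proof
    assume "halts (Mu h) xs"
    then obtain i where "computes h (i # xs) 0"
      by (auto simp: halts_def elim: computes_MuE)
    moreover have "computes h (i # xs) (H (i # xs))"
      by (rule h) (simp add: xs)
    ultimately show "\<exists>i. H (i # xs) = 0"
      using computes_functional by metis
  next
    assume ex: "\<exists>i. H (i # xs) = 0"
    have "computes (Mu h) xs (LEAST i. H (i # xs) = 0)"
    proof (rule computes.mu)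
      show "computes h ((LEAST i. H (i # xs) = 0) # xs) 0"
        using h[of "(LEAST i. H (i # xs) = 0) # xs"] xs LeastI_ex[OF ex] by simp
      show "\<forall>i<LEAST i. H (i # xs) = 0. \<exists>y>0. computes h (i # xs) y"
        using h xs not_less_Least[of _ "\<lambda>i. H (i # xs) = 0"]
        by (metis length_Cons neq0_conv)
    qed
    then show "halts (Mu h) xs" by (auto simp: halts_def)
  qed
  then show thesis by (rule that)
qed

lemma unif_effectively_open_rat_open:
  assumes "computable4 P"
  shows "unif_effectively_open (rat_open P)"
proof -
  obtain F where F: "total_computable 1 (\<lambda>xs. F (xs ! 0))"
    "\<And>p. F (enc p) = enc (P (fst p) (fst (snd p)) (fst (snd (snd p))) (snd (snd (snd p))))"
    using assms unfolding computable4_def by (elim computableE) blast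
  define H where "H xs = 1 - F (prod_encode (xs ! 0, prod_encode (xs ! 1,
      prod_encode (xs ! 2, xs ! 3))))" for xs
  have "total_computable (Suc 3) H"
    unfolding H_def[abs_def]
    by (intro total_computable_diff total_computable_const total_computable_subst[OF F(1)]
          total_computable_pair total_computable_nth) simp_all
  then obtain f where f: "\<And>xs. length xs = 3 \<Longrightarrow> halts f xs \<longleftrightarrow> (\<exists>i. H (i # xs) = 0)"
    using halts_search by blast
  have "H [k, i, c, d] = 0 \<longleftrightarrow> P k i c d" for k i c d
    using F(2)[of "(k, i, c, d)"] by (simp add: H_def enc_prod_def enc_nat_def enc_bool_def)
  then have "rat_open P i = coded_open f [i]" for i
    by (simp add: rat_open_def coded_open_def f)
  then show ?thesis
    unfolding unif_effectively_open_def by blast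
qed

lemma unif_effectively_open2_rat_open:
  assumes "computable4 P"
  shows "unif_effectively_open2 (\<lambda>i j. rat_open P (prod_encode (i, j)))"
proof -
  obtain F where F: "total_computable 1 (\<lambda>xs. F (xs ! 0))"
    "\<And>p. F (enc p) = enc (P (fst p) (fst (snd p)) (fst (snd (snd p))) (snd (snd (snd p))))"
    using assms unfolding computable4_def by (elim computableE) blast
  define H where "H xs = 1 - F (prod_encode (xs ! 0, prod_encode (prod_encode (xs ! 1, xs ! 2),
      prod_encode (xs ! 3, xs ! 4))))" for xs
  have "total_computable (Suc 4) H"
    unfolding H_def[abs_def]
    by (intro total_computable_diff total_computable_const total_computable_subst[OF F(1)]
          total_computable_pair total_computable_nth) simp_all
  then obtain f where f: "\<And>xs. length xs = 4 \<Longrightarrow> halts f xs \<longleftrightarrow> (\<exists>i. H (i # xs) = 0)"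
    using halts_search by blast
  have "H [k, i, j, c, d] = 0 \<longleftrightarrow> P k (prod_encode (i, j)) c d" for k i j c d
    using F(2)[of "(k, prod_encode (i, j), c, d)"]
    by (simp add: H_def enc_prod_def enc_nat_def enc_bool_def)
  then have "rat_open P (prod_encode (i, j)) = coded_open f [i, j]" for i j
    by (simp add: rat_open_def coded_open_def f)
  then show ?thesis
    unfolding unif_effectively_open2_def by blast
qed

definition Sigma2_search :: "real set \<Rightarrow> bool" where
  "Sigma2_search S \<longleftrightarrow> (\<exists>P. computable4 P \<and> S = (\<Union>i. - rat_open P i))"

lemma Sigma2_search_imp_lightface: "Sigma2_search S \<Longrightarrow> lightface_Sigma2 S"
  unfolding Sigma2_search_def lightface_Sigma2_def
  using unif_effectively_open_rat_open by blast

lemma computable4I [intro?]: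
  "computable (\<lambda>p. P (fst p) (fst (snd p)) (fst (snd (snd p))) (snd (snd (snd p)))) \<Longrightarrow> computable4 P"
  by (simp add: computable4_def)

lemma computable4_subst:
  assumes "computable4 P" "computable a" "computable b" "computable c" "computable d"
  shows "computable (\<lambda>x. P (a x) (b x) (c x) (d x))"
proof -
  have "computable (\<lambda>x. (a x, b x, c x, d x))" by (intro computable_intros assms)
  from computable_compose[OF assms(1)[unfolded computable4_def] this] show ?thesis by simp
qed

lemma rat_decode_between:
  assumes "x < (y::real)" obtains c where "x < rat_decode c" "rat_decode c < y"
  using assms Rats_dense_in_real rat_decode_surj by metis

text \<open>
  For \<open>v < u\<close>, which happens when too much is cut off from a short interval, these intervals still cover the
  whole line, as they should.
\<close>

definition outside :: "real \<Rightarrow> real \<Rightarrow> nat \<Rightarrow> nat \<Rightarrow> bool" where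
  "outside u v c d \<longleftrightarrow> rat_decode d \<le> u \<or> v \<le> rat_decode c"

lemma outside_intervals:
  "(\<Union>(c, d) \<in> {(c, d). outside u v c d}. {rat_decode c <..< rat_decode d}) = - {u..v}"
proof (intro equalityI subsetI)
  fix x assume "x \<in> (\<Union>(c, d) \<in> {(c, d). outside u v c d}. {rat_decode c <..< rat_decode d})"
  then show "x \<in> - {u..v}" by (auto simp: outside_def)
next
  fix x assume "x \<in> - {u..v}"
  then consider "x < u" | "v < x" by force
  then show "x \<in> (\<Union>(c, d) \<in> {(c, d). outside u v c d}. {rat_decode c <..< rat_decode d})"
  proof cases
    case 1
    obtain c where "x - 1 < rat_decode c" "rat_decode c < x" by (rule rat_decode_between[of "x - 1" x]) simp_all
    moreover obtain d where "x < rat_decode d" "rat_decode d < u" by (rule rat_decode_between[OF 1])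
    ultimately show ?thesis by (force simp: outside_def)
  next
    case 2
    obtain d where "x < rat_decode d" by (rule rat_decode_between[of x "x + 1"]) simp_all
    moreover obtain c where "v < rat_decode c" "rat_decode c < x" by (rule rat_decode_between[OF 2])
    ultimately show ?thesis by (force simp: outside_def)
  qed
qed

text \<open>
  The number \<open>w\<close> codes a witness \<open>k\<close>, endpoint codes \<open>u\<close>, \<open>v\<close> and an exponent \<open>e\<close>.  A point is outside
  a union of open intervals iff it is outside all the closed intervals obtained by shrinking them by
  \<open>1 / 2 ^ e\<close>; each of these conditions is open, which presents an effectively closed set as an effective
  \<open>G\<^sub>\<delta>\<close> set.
\<close>

definition off_subinterval :: "(nat \<Rightarrow> nat \<Rightarrow> nat \<Rightarrow> nat \<Rightarrow> bool) \<Rightarrow> nat \<Rightarrow> nat \<Rightarrow> nat \<Rightarrow> nat \<Rightarrow> bool" where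
  "off_subinterval P i w c d \<longleftrightarrow>
     (let k = fst (prod_decode w); u = fst (prod_decode (snd (prod_decode w)));
          v = fst (prod_decode (snd (prod_decode (snd (prod_decode w)))));
          e = snd (prod_decode (snd (prod_decode (snd (prod_decode w)))))
      in P k i u v \<longrightarrow> outside (rat_decode u + 1 / 2 ^ e) (rat_decode v - 1 / 2 ^ e) c d)"

lemma computable_off_subinterval [computable_intros]:
  assumes P: "computable4 P" and "computable i" "computable w" "computable c" "computable d"
  shows "computable (\<lambda>x. off_subinterval P (i x) (w x) (c x) (d x))"
  unfolding off_subinterval_def outside_def Let_def
  by (intro computable_intros computable4_subst[OF P] assms)

lemma Inter_off_subinterval:
  "(\<Inter>w. \<Union>(c, d) \<in> {(c, d). off_subinterval P i w c d}. {rat_decode c <..< rat_decode d})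
     = - rat_open P i" (is "(\<Inter>w. ?W w) = _")
proof -
  have W: "?W (prod_encode (k, prod_encode (u, prod_encode (v, e))))
      = (if P k i u v then - {rat_decode u + 1 / 2 ^ e .. rat_decode v - 1 / 2 ^ e} else UNIV)"
    for k u v e
  proof (cases "P k i u v")
    case True
    then show ?thesis
      unfolding outside_intervals[symmetric] by (simp add: off_subinterval_def)
  next
    case False
    have "x \<in> (\<Union>(c, d) \<in> UNIV. {rat_decode c <..< rat_decode d})" for x
    proof -
      obtain c where "rat_decode c < x" by (rule rat_decode_between[of "x - 1" x]) simp_all
      moreover obtain d where "x < rat_decode d" by (rule rat_decode_between[of x "x + 1"]) simp_all
      ultimately show ?thesis by force
    qed
    with False show ?thesis
      by (auto simp: off_subinterval_def)
  qed
  show ?thesis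
  proof (intro equalityI subsetI)
    fix x assume x: "x \<in> (\<Inter>w. ?W w)"
    show "x \<in> - rat_open P i"
    proof
      assume "x \<in> rat_open P i"
      then obtain k u v where k: "P k i u v" "rat_decode u < x" "x < rat_decode v"
        by (auto simp: rat_open_def)
      obtain e1 :: nat where "(1/2) ^ e1 < min (x - rat_decode u) (rat_decode v - x)"
        using real_arch_pow_inv[of "min (x - rat_decode u) (rat_decode v - x)" "1/2"] k by auto
      then have "x \<in> {rat_decode u + 1 / 2 ^ e1 .. rat_decode v - 1 / 2 ^ e1}"
        by (auto simp: power_one_over)
      moreover have "x \<in> ?W (prod_encode (k, prod_encode (u, prod_encode (v, e1))))"
        using x by blast
      ultimately show False using k(1) unfolding W by simp
    qed
  next
    fix x assume x: "x \<in> - rat_open P i"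
    show "x \<in> (\<Inter>w. ?W w)"
    proof
      fix w
      obtain k u v e where w: "w = prod_encode (k, prod_encode (u, prod_encode (v, e)))"
        by (metis prod_decode_inverse surj_pair)
      have "P k i u v \<Longrightarrow> x \<notin> {rat_decode u + 1 / 2 ^ e .. rat_decode v - 1 / 2 ^ e}"
      proof
        assume P: "P k i u v" and x': "x \<in> {rat_decode u + 1 / 2 ^ e .. rat_decode v - 1 / 2 ^ e}"
        have "(0::real) < 1 / 2 ^ e" by simp
        with x' have "rat_decode u < x" "x < rat_decode v"
          unfolding atLeastAtMost_iff by linarith+
        with P x show False by (auto simp: rat_open_def)
      qed
      then show "x \<in> ?W w" unfolding w W by simp
    qed
  qed
qed

lemma rat_open_no_search: "rat_open (\<lambda>k. P) i = (\<Union>(c, d) \<in> {(c, d). P i c d}. {rat_decode c <..< rat_decode d})"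
  by (simp add: rat_open_def)

lemma UN_nat_split: "(\<Union>i. Y i) = Y 0 \<union> (\<Union>i. Y (Suc i))"
  by (subst UNIV_nat_eq) (simp add: image_image)

text \<open>
  The difference is \<open>\<Union>i. - U i \<inter> (\<Inter>w. V w)\<close> and its complement is \<open>(\<Inter>w. U w) \<union> (\<Union>i. - V i)\<close>, with \<open>U\<close> and
  \<open>V\<close> uniformly effectively open.  Writing \<open>- U i\<close> and \<open>- V i\<close> as effective \<open>G\<^sub>\<delta>\<close> sets turns both into
  countable unions of effective \<open>G\<^sub>\<delta>\<close> sets.
\<close>

lemma Sigma2_search_diff_Delta3:
  assumes "Sigma2_search S" "Sigma2_search R"
  shows "lightface_Delta3 (S - R)"
proof -
  obtain P where P: "computable4 P" "S = (\<Union>i. - rat_open P i)"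
    using assms(1) by (auto simp: Sigma2_search_def)
  obtain Q where Q: "computable4 Q" "R = (\<Union>i. - rat_open Q i)"
    using assms(2) by (auto simp: Sigma2_search_def)
  \<comment> \<open>even and odd second indices interleave the two intersections; row 0 of \<open>B\<close> lists the sets \<open>rat_open P w\<close>\<close>
  define A where "A k w c d \<longleftrightarrow>
    (if even (snd (prod_decode w))
     then off_subinterval P (fst (prod_decode w)) (snd (prod_decode w) div 2) c d
     else Q k (snd (prod_decode w) div 2) c d)" for k w c d
  define B where "B k w c d \<longleftrightarrow>
    (if fst (prod_decode w) = 0 then P k (snd (prod_decode w)) c d
     else off_subinterval Q (fst (prod_decode w) - 1) (snd (prod_decode w)) c d)" for k w c d
  have "computable4 A"
    unfolding A_def[abs_def]
    by (rule computable4I) (intro computable_intros computable4_subst[OF Q(1)] P(1))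
  then have UA: "unif_effectively_open2 (\<lambda>i j. rat_open A (prod_encode (i, j)))"
    by (rule unif_effectively_open2_rat_open)
  have "computable4 B"
    unfolding B_def[abs_def]
    by (rule computable4I) (intro computable_intros computable4_subst[OF P(1)] Q(1))
  then have UB: "unif_effectively_open2 (\<lambda>i j. rat_open B (prod_encode (i, j)))"
    by (rule unif_effectively_open2_rat_open)
  have even_A: "rat_open A (prod_encode (i, 2 * w)) = rat_open (\<lambda>k i c d. off_subinterval P i w c d) i" for i w
    by (simp add: rat_open_def A_def)
  have odd_A: "rat_open A (prod_encode (i, Suc (2 * w))) = rat_open Q w" for i w
    by (simp add: rat_open_def A_def)
  have zero_B: "rat_open B (prod_encode (0, w)) = rat_open P w" for w
    by (simp add: rat_open_def B_def)
  have Suc_B: "rat_open B (prod_encode (Suc i, w)) = rat_open (\<lambda>k i c d. off_subinterval Q i w c d) i" for i w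
    by (simp add: rat_open_def B_def)
  have split: "(\<Inter>j. X j) = (\<Inter>w. X (2 * w)) \<inter> (\<Inter>w. X (Suc (2 * w)))" for X :: "nat \<Rightarrow> real set"
  proof (intro equalityI subsetI)
    fix x assume x: "x \<in> (\<Inter>w. X (2 * w)) \<inter> (\<Inter>w. X (Suc (2 * w)))"
    have "x \<in> X j" for j
      by (cases "even j") (use x in \<open>auto elim!: evenE oddE\<close>)
    then show "x \<in> (\<Inter>j. X j)" by blast
  qed blast
  have "(\<Inter>j. rat_open A (prod_encode (i, j))) = - rat_open P i \<inter> (\<Inter>w. rat_open Q w)" for i
    by (subst split) (simp only: even_A odd_A rat_open_no_search Inter_off_subinterval)
  then have SR: "S - R = (\<Union>i. \<Inter>j. rat_open A (prod_encode (i, j)))"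
    by (auto simp: P(2) Q(2))
  have "(\<Inter>w. rat_open B (prod_encode (Suc i, w))) = - rat_open Q i" for i
    by (simp only: Suc_B rat_open_no_search Inter_off_subinterval)
  moreover have "(\<Inter>w. rat_open B (prod_encode (0, w))) = - S"
    by (simp add: zero_B P(2))
  ultimately have "(\<Union>i. \<Inter>j. rat_open B (prod_encode (i, j))) = - S \<union> (\<Union>i. - rat_open Q i)"
    by (subst UN_nat_split) simp
  then have "- (S - R) = (\<Union>i. \<Inter>j. rat_open B (prod_encode (i, j)))"
    by (auto simp: Q(2))
  with SR UA UB show ?thesis
    unfolding lightface_Delta3_def lightface_Pi3_def lightface_Sigma3_def by blast
qed

lemma Sigma2_search_insert_0:
  assumes "Sigma2_search S"
  shows "Sigma2_search (S \<union> {0})"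
proof -
  obtain P where P: "computable4 P" "S = (\<Union>i. - rat_open P i)"
    using assms by (auto simp: Sigma2_search_def)
  define A where "A k i c d \<longleftrightarrow>
    (if i = 0 then outside (rat_decode 0) (rat_decode 0) c d else P k (i - 1) c d)" for k i c d
  have "computable4 A"
    unfolding A_def[abs_def] outside_def
    by (rule computable4I) (intro computable_intros computable4_subst[OF P(1)])
  moreover have "S \<union> {0} = (\<Union>i. - rat_open A i)"
  proof -
    have [simp]: "rat_decode 0 = 0"
      by (simp add: rat_decode_def prod_decode_def prod_decode_aux.simps int_decode_def sum_decode_def)
    have "rat_open A 0 = - {0..0}"
      unfolding outside_intervals[symmetric] by (simp add: rat_open_def A_def)
    moreover have "rat_open A (Suc i) = rat_open P i" for i
      by (simp add: rat_open_def A_def)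
    ultimately have "(\<Union>i. - rat_open A i) = - (- {0..0}) \<union> (\<Union>i. - rat_open P i)"
      by (subst UN_nat_split) simp
    then show ?thesis
      unfolding P(2) by auto
  qed
  ultimately show ?thesis by (auto simp: Sigma2_search_def)
qed

section \<open>Binary strings as natural numbers\<close>

text \<open>
  A string of length \<open>n\<close> is determined by the number it denotes in binary.  Restriction to an initial
  segment becomes division by a power of two, so that all computations can be done with numbers.
\<close>

definition str_nat :: "str \<Rightarrow> nat" where
  "str_nat \<sigma> = foldl (\<lambda>v b. 2 * v + of_bool b) 0 \<sigma>"

primrec nat_str :: "nat \<Rightarrow> nat \<Rightarrow> str" where
  "nat_str 0 v = []"
| "nat_str (Suc k) v = nat_str k (v div 2) @ [odd v]"

lemma str_nat_Nil [simp]: "str_nat [] = 0"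
  and str_nat_snoc [simp]: "str_nat (\<sigma> @ [b]) = 2 * str_nat \<sigma> + of_bool b"
  by (simp_all add: str_nat_def)

lemma str_nat_less: "str_nat \<sigma> < 2 ^ length \<sigma>"
  by (induction \<sigma> rule: rev_induct) auto

lemma length_nat_str [simp]: "length (nat_str k v) = k"
  by (induction k arbitrary: v) auto

lemma str_nat_nat_str: "v < 2 ^ k \<Longrightarrow> str_nat (nat_str k v) = v"
proof (induction k arbitrary: v)
  case (Suc k)
  then have "v div 2 < 2 ^ k" by simp
  with Suc.IH have "str_nat (nat_str (Suc k) v) = 2 * (v div 2) + of_bool (odd v)" by simp
  then show ?case by (cases "even v") auto
qed simp

lemma nat_str_str_nat: "nat_str (length \<sigma>) (str_nat \<sigma>) = \<sigma>"
proof (induction \<sigma> rule: rev_induct)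
  case (snoc b \<sigma>)
  have "(2 * str_nat \<sigma> + of_bool b) div 2 = str_nat \<sigma>" by (cases b) auto
  with snoc show ?case by (cases b) auto
qed simp

lemma str_nat_inject: "length \<sigma> = length \<tau> \<Longrightarrow> str_nat \<sigma> = str_nat \<tau> \<Longrightarrow> \<sigma> = \<tau>"
  by (metis nat_str_str_nat)

lemma take_nat_str: "take k (nat_str (k + d) v) = nat_str k (v div 2 ^ d)"
proof (induction d arbitrary: v)
  case (Suc d)
  then show ?case by (simp add: div_mult2_eq)
qed simp

lemma str_nat_take: "k \<le> length \<sigma> \<Longrightarrow> str_nat (take k \<sigma>) = str_nat \<sigma> div 2 ^ (length \<sigma> - k)"
proof -
  assume k: "k \<le> length \<sigma>"
  have "take k \<sigma> = nat_str k (str_nat \<sigma> div 2 ^ (length \<sigma> - k))"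
    using take_nat_str[of k "length \<sigma> - k" "str_nat \<sigma>"] k by (simp add: nat_str_str_nat)
  moreover have "str_nat \<sigma> div 2 ^ (length \<sigma> - k) < 2 ^ k"
    using str_nat_less[of \<sigma>] k by (simp add: less_mult_imp_div_less flip: power_add)
  ultimately show ?thesis by (simp add: str_nat_nat_str)
qed

lemma str_real_str_nat: "str_real \<sigma> = real (str_nat \<sigma>) / 2 ^ length \<sigma>"
proof (induction \<sigma> rule: rev_induct)
  case (snoc b \<sigma>)
  have "str_real (\<sigma> @ [b]) = str_real \<sigma> + of_bool b / 2 ^ (length \<sigma> + 1)"
    by (simp add: str_real_def nth_append)
  with snoc show ?case by (simp add: field_simps)
qed (simp add: str_real_def)

text \<open>The index, among the dyadic intervals of length \<open>1 / 2 ^ n\<close>, of one that contains \<open>\<beta>\<close>.\<close>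

definition cell :: "seq \<Rightarrow> nat \<Rightarrow> nat" where
  "cell \<beta> n = str_nat (initial \<beta> n)"

lemma length_initial [simp]: "length (initial \<beta> n) = n"
  by (simp add: initial_def)

lemma initial_Suc: "initial \<beta> (Suc n) = initial \<beta> n @ [\<beta> n]"
  by (simp add: initial_def)

lemma cell_0 [simp]: "cell \<beta> 0 = 0"
  by (simp add: cell_def initial_def)

lemma cell_Suc: "cell \<beta> (Suc n) = 2 * cell \<beta> n + of_bool (\<beta> n)"
  by (simp add: cell_def initial_Suc)

lemma cell_less: "cell \<beta> n < 2 ^ n"
  using str_nat_less[of "initial \<beta> n"] by (simp add: cell_def)

lemma take_initial: "k \<le> n \<Longrightarrow> take k (initial \<beta> n) = initial \<beta> k"
  by (simp add: initial_def take_map)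

lemma cell_div: "k \<le> n \<Longrightarrow> cell \<beta> n div 2 ^ (n - k) = cell \<beta> k"
  using str_nat_take[of k "initial \<beta> n"] by (simp add: cell_def take_initial)

lemma cylinder_cell: "\<beta> \<in> cylinder \<sigma> \<longleftrightarrow> cell \<beta> (length \<sigma>) = str_nat \<sigma>"
  by (auto simp: cylinder_def cell_def dest: str_nat_inject[rotated])

lemma cell_eq_mono: "cell \<beta> n = cell \<beta>' n \<Longrightarrow> k \<le> n \<Longrightarrow> cell \<beta> k = cell \<beta>' k"
  by (metis cell_div)

lemma cell_eq_nth: "cell \<beta> n = cell \<beta>' n \<Longrightarrow> k < n \<Longrightarrow> \<beta> k = \<beta>' k"
  by (metis length_initial str_nat_inject cell_def nth_map add_0 diff_zero initial_def length_upt nth_upt)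

lemma cell_cong: "(\<And>k. k < n \<Longrightarrow> \<beta> k = \<beta>' k) \<Longrightarrow> cell \<beta> n = cell \<beta>' n"
proof -
  assume "\<And>k. k < n \<Longrightarrow> \<beta> k = \<beta>' k"
  then have "initial \<beta> n = initial \<beta>' n" by (simp add: initial_def)
  then show ?thesis by (simp add: cell_def)
qed

lemma cell_surj:
  assumes "s < 2 ^ n" obtains \<beta> where "cell \<beta> n = s" "\<And>k. k \<ge> n \<Longrightarrow> \<not> \<beta> k"
proof
  let ?\<beta> = "\<lambda>i. if i < n then nat_str n s ! i else False"
  have "initial ?\<beta> n = nat_str n s"
    by (rule nth_equalityI) (auto simp: initial_def)
  then show "cell ?\<beta> n = s" by (simp add: cell_def str_nat_nat_str assms)
qed simp

lemma summable_seq_real: "summable (\<lambda>i. of_bool (\<beta> i) / 2 ^ (i + 1) :: real)"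
proof (rule summable_comparison_test')
  show "summable (\<lambda>i. (1/2) ^ i :: real)" by (rule summable_geometric) simp
  show "norm (of_bool (\<beta> i) / 2 ^ (i + 1) :: real) \<le> (1/2) ^ i" for i
    by (simp add: field_simps)
qed

lemma seq_real_bounds:
  "real (cell \<beta> n) / 2 ^ n \<le> seq_real \<beta>" "seq_real \<beta> \<le> (real (cell \<beta> n) + 1) / 2 ^ n"
proof -
  let ?f = "\<lambda>i. of_bool (\<beta> i) / 2 ^ (i + 1) :: real"
  have start: "(\<Sum>i<n. ?f i) = real (cell \<beta> n) / 2 ^ n"
    using str_real_str_nat[of "initial \<beta> n"] by (simp add: str_real_def initial_def cell_def)
  have split: "seq_real \<beta> = (\<Sum>i. ?f (i + n)) + (\<Sum>i<n. ?f i)"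
    unfolding seq_real_def by (rule suminf_split_initial_segment[OF summable_seq_real])
  have tail: "summable (\<lambda>i. ?f (i + n))"
    by (rule summable_ignore_initial_segment[OF summable_seq_real])
  have geo: "(\<lambda>i. (1 / 2 ^ n) * (1/2) ^ Suc i :: real) sums (1 / 2 ^ n)"
    using sums_mult[OF power_half_series, of "1 / 2 ^ n"] by simp
  have "(\<Sum>i. ?f (i + n)) \<le> (\<Sum>i. (1 / 2 ^ n) * (1/2) ^ Suc i :: real)"
    by (rule suminf_le[OF _ tail sums_summable[OF geo]]) (simp add: power_add field_simps)
  then have "(\<Sum>i. ?f (i + n)) \<le> 1 / 2 ^ n"
    using sums_unique[OF geo] by simp
  then show "seq_real \<beta> \<le> (real (cell \<beta> n) + 1) / 2 ^ n"
    unfolding split start by (simp add: add_divide_distrib)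
  have "0 \<le> (\<Sum>i. ?f (i + n))" by (rule suminf_nonneg[OF tail]) simp
  then show "real (cell \<beta> n) / 2 ^ n \<le> seq_real \<beta>"
    unfolding split start by simp
qed

lemma seq_real_unique:
  assumes "\<And>n. \<bar>x - real (cell \<beta> n) / 2 ^ n\<bar> \<le> 1 / 2 ^ n"
  shows "seq_real \<beta> = x"
proof (rule ccontr)
  assume "seq_real \<beta> \<noteq> x"
  then obtain n where "(1/2) ^ n < \<bar>seq_real \<beta> - x\<bar> / 2"
    using real_arch_pow_inv[of "\<bar>seq_real \<beta> - x\<bar> / 2" "1/2"] by auto
  moreover have "\<bar>seq_real \<beta> - x\<bar> \<le> 2 * (1 / 2 ^ n)"
    using assms[of n] seq_real_bounds[of \<beta> n] by (simp add: add_divide_distrib)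
  ultimately show False by (simp add: power_one_over)
qed

lemma seq_real_surj:
  assumes "0 \<le> x" "x < 1" obtains \<beta> where "seq_real \<beta> = x"
proof -
  define \<beta> where "\<beta> i = odd (nat \<lfloor>x * 2 ^ Suc i\<rfloor>)" for i
  have "cell \<beta> n = nat \<lfloor>x * 2 ^ n\<rfloor>" for n
  proof (induction n)
    case 0
    have "\<lfloor>x\<rfloor> = 0" using assms by linarith
    then show ?case by simp
  next
    case (Suc n)
    have "\<lfloor>x * 2 ^ n\<rfloor> = \<lfloor>x * 2 ^ Suc n\<rfloor> div 2"
      using floor_divide_real_eq_div[of 2 "x * 2 ^ Suc n"] by simp
    then have "nat \<lfloor>x * 2 ^ n\<rfloor> = nat \<lfloor>x * 2 ^ Suc n\<rfloor> div 2"
      by (simp add: nat_div_distrib assms)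
    with Suc show ?case unfolding cell_Suc \<beta>_def
      by (cases "even (nat \<lfloor>x * 2 ^ Suc n\<rfloor>)") auto
  qed
  then have "real (cell \<beta> n) = of_int \<lfloor>x * 2 ^ n\<rfloor>" for n
    using assms by simp
  then have *: "\<bar>x * 2 ^ n - real (cell \<beta> n)\<bar> \<le> 1" for n
    by (simp only:) linarith
  have "\<bar>x - real (cell \<beta> n) / 2 ^ n\<bar> \<le> 1 / 2 ^ n" for n
  proof -
    have "x - real (cell \<beta> n) / 2 ^ n = (x * 2 ^ n - real (cell \<beta> n)) / 2 ^ n"
      by (simp add: field_simps)
    then show ?thesis using divide_right_mono[OF *[of n], of "2 ^ n"] by (simp add: abs_divide)
  qed
  then show thesis using seq_real_unique that by blast
qed

text \<open>
  The depths \<open>N l\<close> are unbounded, so every digit of \<open>\<delta>\<close> is fixed by some cell, and nestedness makes the cells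
  agree on it.
\<close>

lemma seq_of_nested_cells:
  assumes N: "\<And>l. N l < N (Suc l)" and v: "\<And>l. v l < 2 ^ N l"
    and nest: "\<And>l. v (Suc l) div 2 ^ (N (Suc l) - N l) = v l"
  shows "\<exists>!\<delta>. \<forall>l. cell \<delta> (N l) = v l"
proof -
  have ge: "l \<le> N l" for l
    by (induction l) (use N in \<open>auto intro: le_less_trans Suc_leI\<close>)
  have mono: "N l \<le> N (l + d)" for l d
    by (induction d) (use N in \<open>auto intro: le_trans less_imp_le\<close>)
  have nest': "v (l + d) div 2 ^ (N (l + d) - N l) = v l" for l d
  proof (induction d)
    case (Suc d)
    have "N (l + Suc d) - N l = (N (Suc (l + d)) - N (l + d)) + (N (l + d) - N l)"
      using mono[of l d] N[of "l + d"] by simp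
    then have "v (l + Suc d) div 2 ^ (N (l + Suc d) - N l)
        = v (Suc (l + d)) div 2 ^ (N (Suc (l + d)) - N (l + d)) div 2 ^ (N (l + d) - N l)"
      by (simp add: power_add div_mult2_eq)
    then show ?case using nest Suc by simp
  qed simp
  \<comment> \<open>the cell at depth \<open>k\<close> can be read off from \<open>v k\<close>, because \<open>N k\<close> is at least \<open>k\<close>\<close>
  define w where "w k = v k div 2 ^ (N k - k)" for k
  have w: "w (Suc k) div 2 = w k" for k
  proof -
    have "Suc (N (Suc k) - Suc k) = (N (Suc k) - N k) + (N k - k)"
      using ge[of "Suc k"] ge[of k] N[of k] by simp
    then have "2 ^ (N (Suc k) - Suc k) * 2 = (2 ^ (N (Suc k) - N k) * 2 ^ (N k - k) :: nat)"
      by (metis mult.commute power_Suc power_add)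
    then show ?thesis
      unfolding w_def div_mult2_eq[symmetric] using nest[of k] by (simp add: div_mult2_eq)
  qed
  define \<delta> where "\<delta> k = odd (w (Suc k))" for k
  have cell: "cell \<delta> k = w k" for k
  proof (induction k)
    case 0
    show ?case using v[of 0] by (simp add: w_def)
  next
    case (Suc k)
    have "\<delta> k = odd (w (Suc k))" by (simp only: \<delta>_def)
    with Suc have "cell \<delta> (Suc k) = 2 * (w (Suc k) div 2) + of_bool (odd (w (Suc k)))"
      by (simp only: cell_Suc w)
    then show ?case by (cases "even (w (Suc k))") auto
  qed
  have \<delta>: "cell \<delta> (N l) = v l" for l
    using nest'[of l "N l - l"] ge[of l] by (simp add: cell w_def)
  show ?thesis
  proof (rule ex1I[of _ \<delta>])
    fix \<delta>' assume \<delta>': "\<forall>l. cell \<delta>' (N l) = v l"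
    show "\<delta>' = \<delta>"
    proof
      fix k
      have "k < N (Suc k)" using ge[of "Suc k"] by simp
      then show "\<delta>' k = \<delta> k"
        by (rule cell_eq_nth[rotated]) (simp add: \<delta> \<delta>')
    qed
  qed (simp add: \<delta>)
qed

section \<open>Approximating finite sums of generators\<close>

text \<open>
  A summand of an admissible sum, known up to finite precision: an entry \<open>(s, t, a, b)\<close> says that \<open>\<gamma>\<close> and
  \<open>\<beta>\<close> lie in the dyadic cells with indices \<open>s\<close> and \<open>t\<close> of some level, and that the coefficients are the
  rationals with codes \<open>a\<close> and \<open>b\<close>.
\<close>

type_synonym entry = "nat \<times> nat \<times> nat \<times> nat"

abbreviation entry_cell :: "entry \<Rightarrow> nat \<times> nat" where
  "entry_cell e \<equiv> (fst e, fst (snd e))"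

definition coef_a :: "entry \<Rightarrow> real" where
  "coef_a e = rat_decode (fst (snd (snd e)))"

definition coef_b :: "entry \<Rightarrow> real" where
  "coef_b e = rat_decode (snd (snd (snd e)))"

text \<open>
  The summand \<open>(a - b * \<xi>) * u + b * \<beta>\<close> at the left endpoints of the cells of \<open>\<xi>\<close>, \<open>\<beta>\<close> and \<open>u\<close>.  At level
  \<open>N\<close> the table entry has two more binary digits than the cell indices, so that \<open>m j = n j + 2\<close>.
\<close>

definition term_center :: "nat \<Rightarrow> (nat \<Rightarrow> nat \<Rightarrow> nat) \<Rightarrow> entry \<Rightarrow> real" where
  "term_center N T e =
     (coef_a e - coef_b e * (1 + real (fst e) * (1 / 2 ^ N))) * (real (T (fst e) (fst (snd e))) * (1 / 2 ^ (N + 2)))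
       + coef_b e * (real (fst (snd e)) * (1 / 2 ^ N))"

definition center :: "nat \<Rightarrow> (nat \<Rightarrow> nat \<Rightarrow> nat) \<Rightarrow> entry list \<Rightarrow> real" where
  "center N T C = (\<Sum>e\<leftarrow>C. term_center N T e)"

text \<open>
  At level \<open>N\<close> the distance of a summand from its centre is at most \<open>term_weight e / 2 ^ N\<close>.  The factor 4 is
  generous; it makes the enclosures of successive levels nested.
\<close>

definition term_weight :: "entry \<Rightarrow> real" where
  "term_weight e = \<bar>coef_a e\<bar> + 4 * \<bar>coef_b e\<bar>"

definition weight :: "entry list \<Rightarrow> real" where
  "weight C = (\<Sum>e\<leftarrow>C. term_weight e)"

definition refines_entry :: "nat \<Rightarrow> entry \<Rightarrow> entry \<Rightarrow> bool" where
  "refines_entry k e' e \<longleftrightarrow> fst e' div 2 ^ k = fst e \<and> fst (snd e') div 2 ^ k = fst (snd e) \<and> snd (snd e') = snd (snd e)"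

definition refines :: "nat \<Rightarrow> entry list \<Rightarrow> entry list \<Rightarrow> bool" where
  "refines k = list_all2 (refines_entry k)"

lemma refines_Nil [simp]: "refines k [] []"
  and refines_Cons [simp]: "refines k (e' # C') (e # C) \<longleftrightarrow> refines_entry k e' e \<and> refines k C' C"
  by (simp_all add: refines_def)

lemma refines_length: "refines k C' C \<Longrightarrow> length C' = length C"
  by (simp add: refines_def list_all2_lengthD)

lemma refines_induct [consumes 1, case_names Nil Cons]:
  assumes "refines k C' C" "P [] []"
    "\<And>e' C' e C. refines_entry k e' e \<Longrightarrow> refines k C' C \<Longrightarrow> P C' C \<Longrightarrow> P (e' # C') (e # C)"
  shows "P C' C"
  using assms(1) unfolding refines_def
  by (induction rule: list_all2_induct) (use assms(2,3) in \<open>auto simp: refines_def\<close>)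

lemma refines_entry_coef:
  assumes "refines_entry k e' e"
  shows "coef_a e' = coef_a e" "coef_b e' = coef_b e" "term_weight e' = term_weight e"
  using assms by (auto simp: refines_entry_def coef_a_def coef_b_def term_weight_def)

lemma weight_Nil [simp]: "weight [] = 0" and weight_Cons [simp]: "weight (e # C) = term_weight e + weight C"
  and center_Nil [simp]: "center N T [] = 0"
  and center_Cons [simp]: "center N T (e # C) = term_center N T e + center N T C"
  by (simp_all add: weight_def center_def)

lemma term_weight_nonneg: "0 \<le> term_weight e"
  by (simp add: term_weight_def)

lemma weight_nonneg: "0 \<le> weight C"
  by (induction C) (simp_all add: term_weight_nonneg)

lemma weight_refines: "refines k C' C \<Longrightarrow> weight C' = weight C"
  by (induction rule: refines_induct) (simp_all add: refines_entry_coef)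

definition cells_below :: "nat \<Rightarrow> entry list \<Rightarrow> bool" where
  "cells_below N C \<longleftrightarrow> (\<forall>e\<in>set C. fst e < 2 ^ N \<and> fst (snd e) < 2 ^ N)"

lemma less_power2_of_div: "x div 2 ^ k < 2 ^ n \<Longrightarrow> (x::nat) < 2 ^ (k + n)"
  by (simp add: power_add div_less_iff_less_mult mult.commute)

lemma refines_cells_below:
  "refines k C' C \<Longrightarrow> cells_below n C \<Longrightarrow> cells_below (k + n) C'"
  by (induction rule: refines_induct) (auto simp: cells_below_def refines_entry_def intro: less_power2_of_div)

lemma refines_split:
  assumes "refines (k + l) C'' C"
  obtains C' where "refines k C'' C'" "refines l C' C"
proof
  let ?c = "\<lambda>e. (fst e div 2 ^ k, fst (snd e) div 2 ^ k, snd (snd e))"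
  show "refines k C'' (map ?c C'')"
    unfolding refines_def by (auto simp: list_all2_conv_all_nth refines_entry_def)
  show "refines l (map ?c C'') C"
    using assms unfolding refines_def
    by (auto simp: list_all2_conv_all_nth refines_entry_def power_add div_mult2_eq)
qed

text \<open>
  Applied with \<open>d = 1 / 2 ^ N\<close> this bounds the distance of an actual summand from its centre; applied
  with \<open>d = 1 / 2 ^ N - 1 / 2 ^ N'\<close> it bounds the distance between the centres at two levels.
\<close>

lemma bilinear_error:
  fixes a b x y u :: real
  assumes "x0 \<le> x" "x \<le> x0 + d" "y0 \<le> y" "y \<le> y0 + d" "u0 \<le> u" "u \<le> u0 + d / 4"
    and "0 \<le> x" "x \<le> 1" "0 \<le> u0" "u0 \<le> 1"
  shows "\<bar>((a - b * (1 + x)) * u + b * y) - ((a - b * (1 + x0)) * u0 + b * y0)\<bar> \<le> (\<bar>a\<bar> + 4 * \<bar>b\<bar>) * d"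
proof -
  have d: "0 \<le> d" using assms by linarith
  define w where "w = (1 + x) * (u - u0) + (x - x0) * u0"
  have w0: "0 \<le> w" unfolding w_def using assms by (intro add_nonneg_nonneg mult_nonneg_nonneg) auto
  have "(1 + x) * (u - u0) \<le> 2 * (d / 4)" using assms by (intro mult_mono) auto
  moreover have "(x - x0) * u0 \<le> d * 1" using assms by (intro mult_mono) auto
  ultimately have w1: "w \<le> 2 * d" unfolding w_def using d by simp
  have "((a - b * (1 + x)) * u + b * y) - ((a - b * (1 + x0)) * u0 + b * y0)
      = a * (u - u0) + b * ((y - y0) - w)"
    unfolding w_def by (simp add: algebra_simps)
  also have "\<bar>\<dots>\<bar> \<le> \<bar>a\<bar> * \<bar>u - u0\<bar> + \<bar>b\<bar> * \<bar>(y - y0) - w\<bar>"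
    by (rule order_trans[OF abs_triangle_ineq]) (simp add: abs_mult)
  also have "\<dots> \<le> \<bar>a\<bar> * d + \<bar>b\<bar> * (4 * d)"
  proof (intro add_mono mult_left_mono)
    show "\<bar>u - u0\<bar> \<le> d" using assms d by linarith
    show "\<bar>y - y0 - w\<bar> \<le> 4 * d" using assms d w0 w1 by linarith
  qed simp_all
  finally show ?thesis by (simp add: algebra_simps)
qed

definition extends :: "nat \<Rightarrow> (nat \<Rightarrow> nat \<Rightarrow> nat) \<Rightarrow> nat \<Rightarrow> (nat \<Rightarrow> nat \<Rightarrow> nat) \<Rightarrow> bool" where
  "extends N T N' T' \<longleftrightarrow> N \<le> N' \<and>
     (\<forall>s<2 ^ N'. \<forall>t<2 ^ N'. T' s t div 2 ^ (N' - N) = T (s div 2 ^ (N' - N)) (t div 2 ^ (N' - N)))"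

definition bounded_table :: "nat \<Rightarrow> (nat \<Rightarrow> nat \<Rightarrow> nat) \<Rightarrow> bool" where
  "bounded_table N T \<longleftrightarrow> (\<forall>s<2 ^ N. \<forall>t<2 ^ N. T s t < 2 ^ (N + 2))"

lemma div_power2_less: "s < 2 ^ N' \<Longrightarrow> N \<le> N' \<Longrightarrow> (s::nat) div 2 ^ (N' - N) < 2 ^ N"
  by (simp add: less_mult_imp_div_less flip: power_add)

lemma extends_bounded:
  assumes "extends N T N' T'" "bounded_table N T" shows "bounded_table N' T'"
  unfolding bounded_table_def
proof (intro allI impI)
  fix s t :: nat assume st: "s < 2 ^ N'" "t < 2 ^ N'"
  have N: "N \<le> N'" using assms by (simp add: extends_def)
  have "T' s t div 2 ^ (N' - N) < 2 ^ (N + 2)"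
    using assms st N div_power2_less by (simp add: extends_def bounded_table_def)
  then have "T' s t < 2 ^ (N' - N + (N + 2))" by (rule less_power2_of_div)
  then show "T' s t < 2 ^ (N' + 2)" using N by simp
qed

lemma extends_trans:
  assumes "extends N T N' T'" "extends N' T' N'' T''" shows "extends N T N'' T''"
proof -
  have N: "N \<le> N'" "N' \<le> N''" and e: "N'' - N = (N'' - N') + (N' - N)"
    using assms by (auto simp: extends_def)
  show ?thesis
    unfolding extends_def e power_add div_mult2_eq
    using assms N div_power2_less by (simp add: extends_def)
qed

lemma scaled_le_1: "x \<le> 2 ^ k \<Longrightarrow> real x * (1 / 2 ^ k) \<le> 1"
proof -
  assume "x \<le> 2 ^ k"
  then have "real x \<le> real (2 ^ k)" by (simp only: of_nat_le_iff)
  then show ?thesis by simp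
qed

lemma div_power2_real_bounds:
  fixes x :: nat
  assumes "k \<le> n"
  shows "real (x div 2 ^ (n - k)) * (1 / 2 ^ k) \<le> real x * (1 / 2 ^ n)"
    and "real x * (1 / 2 ^ n) \<le> real (x div 2 ^ (n - k)) * (1 / 2 ^ k) + (1 / 2 ^ k - 1 / 2 ^ n)"
proof -
  define d where "d = n - k"
  have n: "n = k + d" using assms by (simp add: d_def)
  have "x = (x div 2 ^ d) * 2 ^ d + x mod 2 ^ d"
    by (rule div_mult_mod_eq[symmetric])
  then have x: "real x = real (x div 2 ^ d) * 2 ^ d + real (x mod 2 ^ d)"
    by (metis of_nat_add of_nat_mult of_nat_power of_nat_numeral)
  have "x mod 2 ^ d < 2 ^ d" by simp
  then have "Suc (x mod 2 ^ d) \<le> 2 ^ d" by (rule Suc_leI)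
  then have "real (Suc (x mod 2 ^ d)) \<le> real (2 ^ d)" by (simp only: of_nat_le_iff)
  then have m: "real (x mod 2 ^ d) + 1 \<le> 2 ^ d" by simp
  have eq: "real x * (1 / 2 ^ n) = real (x div 2 ^ d) * (1 / 2 ^ k) + real (x mod 2 ^ d) / 2 ^ n"
    unfolding x by (simp add: n power_add field_simps)
  show "real (x div 2 ^ (n - k)) * (1 / 2 ^ k) \<le> real x * (1 / 2 ^ n)"
    unfolding eq d_def[symmetric] by simp
  have "real (x mod 2 ^ d) / 2 ^ n \<le> (2 ^ d - 1) / 2 ^ n"
    using m by (intro divide_right_mono) auto
  also have "\<dots> = 1 / 2 ^ k - 1 / 2 ^ n" by (simp add: n power_add field_simps)
  finally show "real x * (1 / 2 ^ n) \<le> real (x div 2 ^ (n - k)) * (1 / 2 ^ k) + (1 / 2 ^ k - 1 / 2 ^ n)"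
    unfolding eq d_def[symmetric] by simp
qed

lemma term_center_nested:
  assumes ext: "extends N T N' T'" and T: "bounded_table N T" and e: "refines_entry (N' - N) e' e"
    and below: "fst e' < 2 ^ N'" "fst (snd e') < 2 ^ N'"
  shows "\<bar>term_center N' T' e' - term_center N T e\<bar> \<le> term_weight e * (1 / 2 ^ N - 1 / 2 ^ N')"
proof -
  have N: "N \<le> N'" using ext by (simp add: extends_def)
  have s: "fst e = fst e' div 2 ^ (N' - N)" "fst (snd e) = fst (snd e') div 2 ^ (N' - N)"
    using e by (auto simp: refines_entry_def)
  have U: "T (fst e) (fst (snd e)) = T' (fst e') (fst (snd e')) div 2 ^ (N' + 2 - (N + 2))"
    using ext below by (simp add: extends_def s)
  have Ub: "T (fst e) (fst (snd e)) < 2 ^ (N + 2)"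
    using T below N div_power2_less by (simp add: bounded_table_def s)
  show ?thesis
    unfolding term_center_def term_weight_def refines_entry_coef[OF e]
  proof (rule bilinear_error)
    show "real (fst e) * (1 / 2 ^ N) \<le> real (fst e') * (1 / 2 ^ N')"
      "real (fst e') * (1 / 2 ^ N') \<le> real (fst e) * (1 / 2 ^ N) + (1 / 2 ^ N - 1 / 2 ^ N')"
      "real (fst (snd e)) * (1 / 2 ^ N) \<le> real (fst (snd e')) * (1 / 2 ^ N')"
      "real (fst (snd e')) * (1 / 2 ^ N') \<le> real (fst (snd e)) * (1 / 2 ^ N) + (1 / 2 ^ N - 1 / 2 ^ N')"
      unfolding s by (rule div_power2_real_bounds[OF N])+
    show "real (T (fst e) (fst (snd e))) * (1 / 2 ^ (N + 2)) \<le> real (T' (fst e') (fst (snd e'))) * (1 / 2 ^ (N' + 2))"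
      unfolding U by (rule div_power2_real_bounds) (simp add: N)
    have "real (T' (fst e') (fst (snd e'))) * (1 / 2 ^ (N' + 2))
      \<le> real (T (fst e) (fst (snd e))) * (1 / 2 ^ (N + 2)) + (1 / 2 ^ (N + 2) - 1 / 2 ^ (N' + 2))"
      unfolding U by (rule div_power2_real_bounds) (simp add: N)
    then show "real (T' (fst e') (fst (snd e'))) * (1 / 2 ^ (N' + 2))
      \<le> real (T (fst e) (fst (snd e))) * (1 / 2 ^ (N + 2)) + (1 / 2 ^ N - 1 / 2 ^ N') / 4"
      by (simp add: power_add diff_divide_distrib)
    show "real (fst e') * (1 / 2 ^ N') \<le> 1"
      by (rule scaled_le_1) (use below(1) in simp)
    show "real (T (fst e) (fst (snd e))) * (1 / 2 ^ (N + 2)) \<le> 1"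
      by (rule scaled_le_1) (use Ub in simp)
  qed simp_all
qed

text \<open>
  The bound is the difference of the two error radii: the enclosing interval of a refinement is
  contained in the one it refines.
\<close>

lemma center_nested:
  assumes "extends N T N' T'" "bounded_table N T" "refines (N' - N) C' C" "cells_below N' C'"
  shows "\<bar>center N' T' C' - center N T C\<bar> \<le> weight C / 2 ^ N - weight C / 2 ^ N'"
  using assms(3,4)
proof (induction rule: refines_induct)
  case (Cons e' C' e C)
  then have "\<bar>term_center N' T' e' - term_center N T e\<bar> \<le> term_weight e * (1 / 2 ^ N - 1 / 2 ^ N')"
    by (intro term_center_nested assms(1,2)) (auto simp: cells_below_def)
  moreover have "\<bar>center N' T' C' - center N T C\<bar> \<le> weight C / 2 ^ N - weight C / 2 ^ N'"
    using Cons by (simp add: cells_below_def)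
  ultimately show ?case
    by (simp add: right_diff_distrib add_divide_distrib)
qed simp

lemma term_center_approx:
  assumes "bounded_table N T" "fst e < 2 ^ N" "fst (snd e) < 2 ^ N"
    and x: "real (fst e) / 2 ^ N \<le> x" "x \<le> (real (fst e) + 1) / 2 ^ N"
    and y: "real (fst (snd e)) / 2 ^ N \<le> y" "y \<le> (real (fst (snd e)) + 1) / 2 ^ N"
    and u: "real (T (fst e) (fst (snd e))) / 2 ^ (N + 2) \<le> u" "u \<le> (real (T (fst e) (fst (snd e))) + 1) / 2 ^ (N + 2)"
  shows "\<bar>((coef_a e - coef_b e * (1 + x)) * u + coef_b e * y) - term_center N T e\<bar> \<le> term_weight e / 2 ^ N"
proof -
  have T: "T (fst e) (fst (snd e)) < 2 ^ (N + 2)"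
    using assms by (simp add: bounded_table_def)
  have "Suc (fst e) \<le> 2 ^ N" using assms(2) by simp
  then have "real (Suc (fst e)) \<le> real (2 ^ N)" by (simp only: of_nat_le_iff)
  then have "(real (fst e) + 1) / 2 ^ N \<le> 1" by simp
  then have x1: "x \<le> 1" using x by linarith
  have x0: "0 \<le> x" using x(1) by (rule order_trans[rotated]) simp
  have T1: "real (T (fst e) (fst (snd e))) * (1 / 2 ^ (N + 2)) \<le> 1"
    by (rule scaled_le_1) (use T in simp)
  have "\<bar>((coef_a e - coef_b e * (1 + x)) * u + coef_b e * y) - term_center N T e\<bar>
      \<le> (\<bar>coef_a e\<bar> + 4 * \<bar>coef_b e\<bar>) * (1 / 2 ^ N)"
    unfolding term_center_def
  proof (rule bilinear_error)
    show "x \<le> real (fst e) * (1 / 2 ^ N) + 1 / 2 ^ N" "y \<le> real (fst (snd e)) * (1 / 2 ^ N) + 1 / 2 ^ N"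
      using x y by (simp_all add: add_divide_distrib)
    show "u \<le> real (T (fst e) (fst (snd e))) * (1 / 2 ^ (N + 2)) + 1 / 2 ^ N / 4"
      using u by (simp add: add_divide_distrib)
  qed (use x y u x0 x1 T1 in simp_all)
  then show ?thesis by (simp add: term_weight_def)
qed

section \<open>One stage of the construction\<close>

text \<open>
  A linear function has no zero on an interval iff its values at the endpoints have the same strict sign.
  This is the decidable form of the requirement that \<open>a - b * \<xi>\<close> be bounded away from zero.
\<close>

definition nonvanishing :: "nat \<Rightarrow> entry \<Rightarrow> bool" where
  "nonvanishing n e \<longleftrightarrow>
     0 < (coef_a e - coef_b e * (1 + real (fst e) * (1 / 2 ^ n))) *
         (coef_a e - coef_b e * (1 + real (Suc (fst e)) * (1 / 2 ^ n)))"

definition admissible_entries :: "nat \<Rightarrow> entry list \<Rightarrow> bool" where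
  "admissible_entries n C \<longleftrightarrow> C \<noteq> [] \<and> distinct (map entry_cell C) \<and>
     (\<forall>e\<in>set C. fst e < 2 ^ n \<and> fst (snd e) < 2 ^ n \<and> nonvanishing n e)"

text \<open>
  Finitely many strict rational inequalities; they place the whole enclosing interval of \<open>C\<close> inside an
  interval of each of the first \<open>J\<close> open sets.
\<close>

definition certified :: "(nat \<Rightarrow> real) \<Rightarrow> nat \<Rightarrow> nat \<Rightarrow> (nat \<Rightarrow> nat \<Rightarrow> nat) \<Rightarrow> nat \<Rightarrow> entry list \<Rightarrow> bool" where
  "certified q J N T L C \<longleftrightarrow>
     (\<forall>k\<in>set [1..<Suc J]. \<exists>l\<in>set [1..<Suc L]. \<bar>center N T C - q l\<bar> + weight C * (1 / 2 ^ N) < radius q k l)"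

lemma linear_away_from_0:
  fixes a b x0 x1 :: real
  assumes "0 < (a - b * (1 + x0)) * (a - b * (1 + x1))"
  shows "\<exists>\<delta>>0. \<forall>x. x0 \<le> x \<longrightarrow> x \<le> x1 \<longrightarrow> \<delta> \<le> \<bar>a - b * (1 + x)\<bar>"
proof (intro exI conjI allI impI)
  show "0 < min \<bar>a - b * (1 + x0)\<bar> \<bar>a - b * (1 + x1)\<bar>"
    using assms by (auto simp: zero_less_mult_iff)
  fix x assume x: "x0 \<le> x" "x \<le> x1"
  have "b * (1 + x0) \<le> b * (1 + x) \<and> b * (1 + x) \<le> b * (1 + x1) \<or>
        b * (1 + x1) \<le> b * (1 + x) \<and> b * (1 + x) \<le> b * (1 + x0)"
    using x by (cases "0 \<le> b") (auto intro: mult_left_mono mult_left_mono_neg)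
  with assms show "min \<bar>a - b * (1 + x0)\<bar> \<bar>a - b * (1 + x1)\<bar> \<le> \<bar>a - b * (1 + x)\<bar>"
    by (auto simp: zero_less_mult_iff)
qed

lemma nonvanishing_uniform:
  assumes "\<forall>e\<in>set C. nonvanishing n e"
  shows "\<exists>\<delta>>0. \<forall>e\<in>set C. \<forall>x. real (fst e) * (1 / 2 ^ n) \<le> x \<longrightarrow> x \<le> real (Suc (fst e)) * (1 / 2 ^ n) \<longrightarrow>
            \<delta> \<le> \<bar>coef_a e - coef_b e * (1 + x)\<bar>"
  using assms
proof (induction C)
  case Nil
  show ?case by (intro exI[of _ 1]) simp
next
  case (Cons e C)
  then obtain d1 where d1: "d1 > 0" "\<forall>e\<in>set C. \<forall>x. real (fst e) * (1 / 2 ^ n) \<le> x \<longrightarrow>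
      x \<le> real (Suc (fst e)) * (1 / 2 ^ n) \<longrightarrow> d1 \<le> \<bar>coef_a e - coef_b e * (1 + x)\<bar>"
    by auto
  have "nonvanishing n e" using Cons.prems by simp
  then obtain d2 where d2: "d2 > 0" "\<forall>x. real (fst e) * (1 / 2 ^ n) \<le> x \<longrightarrow>
      x \<le> real (Suc (fst e)) * (1 / 2 ^ n) \<longrightarrow> d2 \<le> \<bar>coef_a e - coef_b e * (1 + x)\<bar>"
    unfolding nonvanishing_def using linear_away_from_0 by blast
  show ?case
  proof (intro exI[of _ "min d1 d2"] conjI ballI allI impI)
    fix e' x assume "e' \<in> set (e # C)" "real (fst e') * (1 / 2 ^ n) \<le> x" "x \<le> real (Suc (fst e')) * (1 / 2 ^ n)"
    then have "d1 \<le> \<bar>coef_a e' - coef_b e' * (1 + x)\<bar> \<or> d2 \<le> \<bar>coef_a e' - coef_b e' * (1 + x)\<bar>"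
      using d1(2) d2(2) by auto
    then show "min d1 d2 \<le> \<bar>coef_a e' - coef_b e' * (1 + x)\<bar>" by auto
  qed (use d1(1) d2(1) in simp)
qed

lemma grid_point_between:
  fixes \<eta> :: real
  assumes "\<eta> > 0" "lo + \<eta> \<le> hi"
  shows "\<exists>z::int. lo \<le> \<eta> * (of_int z + c) \<and> \<eta> * (of_int z + c) \<le> hi"
proof (intro exI conjI)
  let ?z = "\<lceil>lo / \<eta> - c\<rceil>"
  have "lo / \<eta> - c \<le> of_int ?z" "of_int ?z \<le> lo / \<eta> - c + 1" by linarith+
  then have *: "lo / \<eta> \<le> of_int ?z + c" "of_int ?z + c \<le> lo / \<eta> + 1" by linarith+
  show "lo \<le> \<eta> * (of_int ?z + c)"
    using mult_left_mono[OF *(1), of \<eta>] assms(1) by simp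
  have "\<eta> * (of_int ?z + c) \<le> \<eta> * (lo / \<eta> + 1)"
    using mult_left_mono[OF *(2), of \<eta>] assms(1) by simp
  also have "\<dots> = lo + \<eta>" using assms(1) by (simp add: algebra_simps)
  finally show "\<eta> * (of_int ?z + c) \<le> hi" using assms(2) by simp
qed

text \<open>
  Moving \<open>u\<close> within half of its dyadic interval moves \<open>\<kappa> * u + y\<close> across a whole mesh
  of the grid, so some choice of further digits brings it next to a grid point.
\<close>

lemma digits_near_grid:
  fixes \<kappa> y \<eta> c :: real and V :: nat
  assumes \<eta>: "0 < \<eta>" "\<eta> \<le> \<delta> * (1 / 2 ^ (N + 3))" and \<kappa>: "0 < \<delta>" "\<delta> \<le> \<bar>\<kappa>\<bar>" and N: "N \<le> N'"
  shows "\<exists>U. U div 2 ^ (N' - N) = V \<and>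
     (\<exists>z::int. \<bar>(\<kappa> * (real U * (1 / 2 ^ (N' + 2))) + y) - \<eta> * (of_int z + c)\<bar> \<le> \<bar>\<kappa>\<bar> * (1 / 2 ^ (N' + 2)))"
proof -
  define u0 where "u0 = real V * (1 / 2 ^ (N + 2))"
  define h :: real where "h = 1 / 2 ^ (N + 3)"
  have h: "h > 0" by (simp add: h_def)
  have \<kappa>0: "\<kappa> \<noteq> 0" using \<kappa> by auto
  have \<eta>h: "\<eta> \<le> \<bar>\<kappa>\<bar> * h"
    using \<eta>(2) mult_right_mono[OF \<kappa>(2), of h] h by (simp add: h_def)
  obtain z :: int and u where z: "\<kappa> * u + y = \<eta> * (of_int z + c)" and u: "u0 \<le> u" "u \<le> u0 + h"
  proof (cases "\<kappa> > 0")
    case True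
    have "\<kappa> * u0 + y + \<eta> \<le> \<kappa> * (u0 + h) + y" using \<eta>h True by (simp add: algebra_simps)
    from grid_point_between[OF \<eta>(1) this, of c] obtain z :: int
      where z: "\<kappa> * u0 + y \<le> \<eta> * (of_int z + c)" "\<eta> * (of_int z + c) \<le> \<kappa> * (u0 + h) + y" by blast
    show ?thesis
    proof (rule that[of "(\<eta> * (of_int z + c) - y) / \<kappa>" z])
      show "u0 \<le> (\<eta> * (of_int z + c) - y) / \<kappa>" "(\<eta> * (of_int z + c) - y) / \<kappa> \<le> u0 + h"
        using z True by (simp_all add: pos_le_divide_eq pos_divide_le_eq algebra_simps)
    qed (use \<kappa>0 in simp)
  next
    case False
    then have neg: "\<kappa> < 0" using \<kappa>0 by simp
    have "\<kappa> * (u0 + h) + y + \<eta> \<le> \<kappa> * u0 + y" using \<eta>h neg by (simp add: algebra_simps)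
    from grid_point_between[OF \<eta>(1) this, of c] obtain z :: int
      where z: "\<kappa> * (u0 + h) + y \<le> \<eta> * (of_int z + c)" "\<eta> * (of_int z + c) \<le> \<kappa> * u0 + y" by blast
    show ?thesis
    proof (rule that[of "(\<eta> * (of_int z + c) - y) / \<kappa>" z])
      show "u0 \<le> (\<eta> * (of_int z + c) - y) / \<kappa>" "(\<eta> * (of_int z + c) - y) / \<kappa> \<le> u0 + h"
        using z neg by (simp_all add: neg_le_divide_eq neg_divide_le_eq algebra_simps)
    qed (use \<kappa>0 in simp)
  qed
  define U where "U = nat \<lfloor>u * 2 ^ (N' + 2)\<rfloor>"
  have u0': "0 \<le> u" using u by (rule_tac order_trans[of _ u0]) (simp_all add: u0_def)
  have UR: "real U = of_int \<lfloor>u * 2 ^ (N' + 2)\<rfloor>" using u0' by (simp add: U_def)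
  have U1: "\<bar>real U * (1 / 2 ^ (N' + 2)) - u\<bar> \<le> 1 / 2 ^ (N' + 2)"
  proof -
    have "\<bar>real U - u * 2 ^ (N' + 2)\<bar> \<le> 1" unfolding UR by linarith
    then have "\<bar>real U - u * 2 ^ (N' + 2)\<bar> / 2 ^ (N' + 2) \<le> 1 / 2 ^ (N' + 2)"
      by (rule divide_right_mono) simp
    moreover have "real U * (1 / 2 ^ (N' + 2)) - u = (real U - u * 2 ^ (N' + 2)) / 2 ^ (N' + 2)"
      by (simp add: field_simps)
    ultimately show ?thesis by (simp add: abs_divide)
  qed
  have "U div 2 ^ (N' - N) = V"
  proof -
    have "\<lfloor>u * 2 ^ (N + 2)\<rfloor> = int V"
    proof (rule floor_unique)
      have "u0 * 2 ^ (N + 2) \<le> u * 2 ^ (N + 2)" "u * 2 ^ (N + 2) \<le> (u0 + h) * 2 ^ (N + 2)"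
        by (rule mult_right_mono; use u in simp)+
      moreover have "u0 * 2 ^ (N + 2) = real V" by (simp add: u0_def)
      moreover have "h * 2 ^ (N + 2) = 1 / 2" by (simp add: h_def power_add)
      ultimately show "of_int (int V) \<le> u * 2 ^ (N + 2)" "u * 2 ^ (N + 2) < of_int (int V) + 1"
        unfolding distrib_right of_int_of_nat_eq by linarith+
    qed
    moreover have "\<lfloor>u * 2 ^ (N + 2)\<rfloor> = \<lfloor>u * 2 ^ (N' + 2)\<rfloor> div 2 ^ (N' - N)"
    proof -
      have "u * 2 ^ (N + 2) = u * 2 ^ (N' + 2) / of_int (2 ^ (N' - N))"
      proof -
        have "(2::real) ^ (N' + 2) = 2 ^ (N + 2) * 2 ^ (N' - N)"
          using N by (simp flip: power_add)
        then show ?thesis by simp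
      qed
      then show ?thesis using floor_divide_real_eq_div[of "2 ^ (N' - N)" "u * 2 ^ (N' + 2)"] by simp
    qed
    ultimately have "int V = \<lfloor>u * 2 ^ (N' + 2)\<rfloor> div 2 ^ (N' - N)" by simp
    moreover have "int U = \<lfloor>u * 2 ^ (N' + 2)\<rfloor>" using u0' by (simp add: U_def)
    ultimately have "int (U div 2 ^ (N' - N)) = int V" by (simp add: zdiv_int)
    then show ?thesis by simp
  qed
  moreover have "\<bar>(\<kappa> * (real U * (1 / 2 ^ (N' + 2))) + y) - \<eta> * (of_int z + c)\<bar> \<le> \<bar>\<kappa>\<bar> * (1 / 2 ^ (N' + 2))"
  proof -
    have "(\<kappa> * (real U * (1 / 2 ^ (N' + 2))) + y) - \<eta> * (of_int z + c) = \<kappa> * (real U * (1 / 2 ^ (N' + 2)) - u)"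
      unfolding z[symmetric] by (simp add: algebra_simps)
    then show ?thesis using mult_left_mono[OF U1, of "\<bar>\<kappa>\<bar>"] by (simp add: abs_mult)
  qed
  ultimately show ?thesis by blast
qed

text \<open>
  Every nonzero rational is the centre of an interval of every \<open>O_set q k\<close>; a common positive radius exists
  because only finitely many rationals and finitely many \<open>k\<close> are considered.
\<close>

lemma uniform_radius:
  assumes q: "q ` {1..} = \<rat> - {0}" and V: "finite V" "V \<subseteq> \<rat> - {0}"
  shows "\<exists>L. \<exists>\<rho>>0. \<forall>v\<in>V. \<exists>l\<in>{1..L}. q l = v \<and> (\<forall>k\<in>{1..J}. \<rho> \<le> radius q k l)"
  using V
proof (induction V rule: finite_induct)
  case empty
  show ?case by (intro exI[of _ 0] exI[of _ 1]) simp
next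
  case (insert v V)
  then obtain L \<rho> where IH: "\<rho> > 0" "\<forall>v\<in>V. \<exists>l\<in>{1..L}. q l = v \<and> (\<forall>k\<in>{1..J}. \<rho> \<le> radius q k l)"
    by auto
  from insert.prems q have "v \<in> q ` {1..}" by simp
  then obtain l where l: "l \<ge> 1" "q l = v" by auto
  have pos: "0 < radius q k l" for k
    using l insert.prems by (simp add: radius_def)
  define \<rho>' where "\<rho>' = Min (insert \<rho> ((\<lambda>k. radius q k l) ` {1..J}))"
  have "\<rho>' > 0" unfolding \<rho>'_def using IH(1) pos by (subst Min_gr_iff) auto
  moreover have "\<rho>' \<le> \<rho>" unfolding \<rho>'_def by (rule Min_le) auto
  moreover have "\<rho>' \<le> radius q k l" if "k \<in> {1..J}" for k
    unfolding \<rho>'_def using that by (intro Min_le) auto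
  ultimately show ?case
  proof (intro exI[of _ "max L l"] exI[of _ \<rho>'] conjI ballI)
    fix w assume w: "w \<in> insert v V" and \<rho>: "\<rho>' \<le> \<rho>" and rl: "\<And>k. k \<in> {1..J} \<Longrightarrow> \<rho>' \<le> radius q k l"
    show "\<exists>l'\<in>{1..max L l}. q l' = w \<and> (\<forall>k\<in>{1..J}. \<rho>' \<le> radius q k l')"
    proof (cases "w = v")
      case True
      then show ?thesis using l rl by (intro bexI[of _ l]) auto
    next
      case False
      then obtain l' where "l' \<in> {1..L}" "q l' = w" "\<forall>k\<in>{1..J}. \<rho> \<le> radius q k l'"
        using w IH(2) by blast
      then show ?thesis using \<rho> by (intro bexI[of _ l']) (auto intro: order_trans)
    qed
  qed
qed

lemma finite_half_integer_grid:
  fixes \<eta> B :: real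
  assumes "\<eta> > 0"
  shows "finite {v. \<exists>z::int. v = \<eta> * (of_int z + 1/2) \<and> \<bar>v\<bar> \<le> B}"
proof (rule finite_subset)
  show "{v. \<exists>z::int. v = \<eta> * (of_int z + 1/2) \<and> \<bar>v\<bar> \<le> B}
      \<subseteq> (\<lambda>z::int. \<eta> * (of_int z + 1/2)) ` {\<lfloor>- (B / \<eta>) - 1\<rfloor>..\<lceil>B / \<eta>\<rceil>}"
  proof clarify
    fix z :: int assume z: "\<bar>\<eta> * (of_int z + 1/2)\<bar> \<le> B"
    have "\<eta> * \<bar>of_int z + 1/2\<bar> \<le> B" using z assms by (simp add: abs_mult)
    then have "\<bar>of_int z + 1/2\<bar> \<le> B / \<eta>" using assms by (simp add: field_simps)
    then have "of_int z \<le> B / \<eta>" "- (B / \<eta>) - 1 \<le> of_int z" by linarith+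
    then have "z \<le> \<lceil>B / \<eta>\<rceil>" "\<lfloor>- (B / \<eta>) - 1\<rfloor> \<le> z"
      by linarith+
    then show "\<eta> * (of_int z + 1/2) \<in> (\<lambda>z::int. \<eta> * (of_int z + 1/2)) ` {\<lfloor>- (B / \<eta>) - 1\<rfloor>..\<lceil>B / \<eta>\<rceil>}"
      by (intro image_eqI[of _ _ z]) auto
  qed
qed simp

lemma term_center_le_weight:
  assumes "bounded_table N T" "fst e < 2 ^ N" "fst (snd e) < 2 ^ N"
  shows "\<bar>term_center N T e\<bar> \<le> term_weight e"
proof -
  define x y u where "x = real (fst e) * (1 / 2 ^ N)" "y = real (fst (snd e)) * (1 / 2 ^ N)"
    "u = real (T (fst e) (fst (snd e))) * (1 / 2 ^ (N + 2))"
  have "x \<le> 1" "y \<le> 1" unfolding x_y_u_def by (rule scaled_le_1, use assms in simp)+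
  moreover have "u \<le> 1" unfolding x_y_u_def by (rule scaled_le_1) (use assms in \<open>simp add: bounded_table_def less_imp_le\<close>)
  moreover have "0 \<le> x" "0 \<le> y" "0 \<le> u" by (simp_all add: x_y_u_def)
  moreover from calculation have "(1 + x) * u \<le> 2 * 1"
    by (intro mult_mono) auto
  ultimately have bnds: "\<bar>u\<bar> \<le> 1" "\<bar>y\<bar> \<le> 1" "(1 + x) * u \<le> 2" "0 \<le> (1 + x) * u"
    by simp_all
  then have "\<bar>y - (1 + x) * u\<bar> \<le> 4" by linarith
  have "term_center N T e = coef_a e * u + coef_b e * (y - (1 + x) * u)"
    unfolding term_center_def x_y_u_def[symmetric] by (simp add: algebra_simps)
  also have "\<bar>\<dots>\<bar> \<le> \<bar>coef_a e\<bar> * \<bar>u\<bar> + \<bar>coef_b e\<bar> * \<bar>y - (1 + x) * u\<bar>"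
    by (rule order_trans[OF abs_triangle_ineq]) (simp add: abs_mult)
  also have "\<dots> \<le> \<bar>coef_a e\<bar> * 1 + \<bar>coef_b e\<bar> * 4"
    by (intro add_mono mult_left_mono) (use bnds \<open>\<bar>y - (1 + x) * u\<bar> \<le> 4\<close> in simp_all)
  finally show ?thesis by (simp add: term_weight_def)
qed

lemma center_le_weight:
  assumes "bounded_table N T" "cells_below N C"
  shows "\<bar>center N T C\<bar> \<le> weight C"
  using assms(2)
proof (induction C)
  case (Cons e C)
  then have "\<bar>term_center N T e\<bar> \<le> term_weight e"
    by (intro term_center_le_weight assms(1)) (auto simp: cells_below_def)
  moreover have "\<bar>center N T C\<bar> \<le> weight C"
    using Cons by (simp add: cells_below_def)
  ultimately show ?case by simp
qed simp

lemma certified_mono: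
  assumes cert: "certified q J N T L C"
    and ext: "extends N T N' T'" and T: "bounded_table N T" and ref: "refines (N' - N) C' C"
    and below: "cells_below N' C'" and L: "L \<le> L'"
  shows "certified q J N' T' L' C'"
  unfolding certified_def
proof
  fix k assume "k \<in> set [1..<Suc J]"
  then obtain l where l: "l \<in> set [1..<Suc L]" "\<bar>center N T C - q l\<bar> + weight C * (1 / 2 ^ N) < radius q k l"
    using cert unfolding certified_def by blast
  have "\<bar>center N' T' C' - center N T C\<bar> \<le> weight C / 2 ^ N - weight C / 2 ^ N'"
    by (rule center_nested[OF ext T ref below])
  then have "\<bar>center N' T' C' - q l\<bar> + weight C' * (1 / 2 ^ N') < radius q k l"
    using l(2) weight_refines[OF ref] by simp
  moreover have "l \<in> set [1..<Suc L']" using l(1) L by (auto simp del: upt_Suc)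
  ultimately show "\<exists>l\<in>set [1..<Suc L']. \<bar>center N' T' C' - q l\<bar> + weight C' * (1 / 2 ^ N') < radius q k l"
    by blast
qed

text \<open>
  Every cell is assigned further digits that bring its summand next to a grid point.  The mesh \<open>\<eta>\<close> is
  chosen first, small against the room left by the old table; it leaves only finitely many values
  \<open>V\<close> for a sum of grid points, whatever the new level is.  The new level \<open>N'\<close> is chosen last, so fine that
  the error is small against the radii of the intervals around the members of \<open>V\<close>.  Shifting the grid by \<open>1 / (2 * k)\<close>, where \<open>k\<close> is the number of summands, makes every sum of
  \<open>k\<close> grid points an odd multiple of half the mesh, in particular a nonzero rational.
\<close>

lemma certify_one:
  assumes q: "q ` {1..} = \<rat> - {0}" and adm: "admissible_entries n0 C"
    and n0: "n0 \<le> N" and T: "bounded_table N T"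
  shows "\<exists>N' T' L. N < N' \<and> extends N T N' T' \<and>
           (\<forall>C'. refines (N' - n0) C' C \<longrightarrow> certified q J N' T' L C')"
proof -
  have dist: "distinct (map entry_cell C)" and C0: "C \<noteq> []"
    and C: "\<And>e. e \<in> set C \<Longrightarrow> fst e < 2 ^ n0 \<and> fst (snd e) < 2 ^ n0 \<and> nonvanishing n0 e"
    using adm by (auto simp: admissible_entries_def)
  obtain \<delta> where \<delta>: "\<delta> > 0" and \<kappa>: "\<And>e x. e \<in> set C \<Longrightarrow> real (fst e) * (1 / 2 ^ n0) \<le> x \<Longrightarrow>
      x \<le> real (Suc (fst e)) * (1 / 2 ^ n0) \<Longrightarrow> \<delta> \<le> \<bar>coef_a e - coef_b e * (1 + x)\<bar>"
    using nonvanishing_uniform[of C n0] C by blast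
  obtain w :: nat where w: "(1/2) ^ w < \<delta> * (1 / 2 ^ (N + 3))"
    using real_arch_pow_inv[of "\<delta> * (1 / 2 ^ (N + 3))" "1/2"] \<delta> by auto
  define \<eta> :: real where "\<eta> = (1/2) ^ w"
  have \<eta>: "0 < \<eta>" "\<eta> \<le> \<delta> * (1 / 2 ^ (N + 3))" "\<eta> \<in> \<rat>"
    using w by (auto simp: \<eta>_def)
  define V where "V = {v. \<exists>z::int. v = \<eta> * (of_int z + 1/2) \<and> \<bar>v\<bar> \<le> 2 * weight C}"
  have "finite V" unfolding V_def by (rule finite_half_integer_grid[OF \<eta>(1)])
  moreover have "V \<subseteq> \<rat> - {0}"
  proof
    fix v assume "v \<in> V"
    then obtain z :: int where v: "v = \<eta> * (of_int z + 1/2)" by (auto simp: V_def)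
    have "of_int z + 1/2 \<noteq> (0::real)"
    proof
      assume "of_int z + 1/2 = (0::real)"
      then have "of_int (2 * z + 1) = (0::real)" by simp
      then have "2 * z + 1 = 0" by (simp only: of_int_eq_0_iff)
      then show False by presburger
    qed
    then show "v \<in> \<rat> - {0}" using v \<eta> by (auto intro: Rats_mult)
  qed
  ultimately obtain L \<rho> where \<rho>: "\<rho> > 0"
    and L: "\<And>v. v \<in> V \<Longrightarrow> \<exists>l\<in>{1..L}. q l = v \<and> (\<forall>k\<in>{1..J}. \<rho> \<le> radius q k l)"
    using uniform_radius[OF q, of V J] by blast
  obtain M :: nat where M: "(1/2) ^ M < \<rho> / (2 * weight C + 1)"
    using real_arch_pow_inv[of "\<rho> / (2 * weight C + 1)" "1/2"] \<rho> weight_nonneg[of C] by (auto simp: divide_pos_pos)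
  define N' where "N' = max M (Suc N)"
  have N': "N < N'" "N \<le> N'" "n0 \<le> N'" "M \<le> N'" using n0 by (auto simp: N'_def)
  have small: "2 * (weight C * (1 / 2 ^ N')) < \<rho>"
  proof -
    have "(1 / 2 ^ N' :: real) \<le> (1/2) ^ M"
      using power_decreasing[OF N'(4), of "1/2 :: real"] by (simp add: power_one_over)
    then have "1 / 2 ^ N' * (2 * weight C + 1) < \<rho>"
    proof -
      have "1 / 2 ^ N' * (2 * weight C + 1) \<le> (1/2) ^ M * (2 * weight C + 1)"
        using \<open>(1 / 2 ^ N' :: real) \<le> (1/2) ^ M\<close> weight_nonneg[of C] by (intro mult_right_mono) auto
      also have "\<dots> < \<rho>"
        using M weight_nonneg[of C] by (simp add: pos_less_divide_eq)
      finally show ?thesis .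
    qed
    moreover have "1 / 2 ^ N' * (2 * weight C + 1) = 2 * (weight C * (1 / 2 ^ N')) + 1 / 2 ^ N'"
      by (simp add: algebra_simps)
    moreover have "0 < (1 / 2 ^ N' :: real)" by (rule divide_pos_pos) simp_all
    ultimately show ?thesis by linarith
  qed
  define c :: real where "c = 1 / (2 * real (length C))"
  let ?match = "\<lambda>s t e. e \<in> set C \<and> s div 2 ^ (N' - n0) = fst e \<and> t div 2 ^ (N' - n0) = fst (snd e)"
  let ?\<kappa> = "\<lambda>s e. coef_a e - coef_b e * (1 + real s * (1 / 2 ^ N'))"
  have "\<exists>U. U div 2 ^ (N' - N) = T (s div 2 ^ (N' - N)) (t div 2 ^ (N' - N)) \<and>
     (\<forall>e. ?match s t e \<longrightarrow> (\<exists>z::int. \<bar>(?\<kappa> s e * (real U * (1 / 2 ^ (N' + 2)))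
          + coef_b e * (real t * (1 / 2 ^ N'))) - \<eta> * (of_int z + c)\<bar> \<le> \<bar>?\<kappa> s e\<bar> * (1 / 2 ^ (N' + 2))))"
    for s t
  proof (cases "\<exists>e. ?match s t e")
    case True
    then obtain e where e: "?match s t e" by blast
    have uniq: "e' = e" if "?match s t e'" for e'
    proof -
      have "entry_cell e' = entry_cell e" "e' \<in> set C" "e \<in> set C" using that e by auto
      then show ?thesis using dist by (meson distinct_map inj_onD)
    qed
    have \<kappa>': "\<delta> \<le> \<bar>?\<kappa> s e\<bar>"
    proof (rule \<kappa>)
      show "e \<in> set C" using e by simp
      show "real (fst e) * (1 / 2 ^ n0) \<le> real s * (1 / 2 ^ N')"
        using div_power2_real_bounds(1)[OF N'(3), of s] e by simp
      have "real s * (1 / 2 ^ N') \<le> real (fst e) * (1 / 2 ^ n0) + (1 / 2 ^ n0 - 1 / 2 ^ N')"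
        using div_power2_real_bounds(2)[OF N'(3), of s] e by simp
      also have "\<dots> \<le> real (Suc (fst e)) * (1 / 2 ^ n0)" by (simp add: add_divide_distrib)
      finally show "real s * (1 / 2 ^ N') \<le> real (Suc (fst e)) * (1 / 2 ^ n0)" .
    qed
    from digits_near_grid[OF \<eta>(1,2) \<delta> \<kappa>' N'(2), of "T (s div 2 ^ (N' - N)) (t div 2 ^ (N' - N))"
        "coef_b e * (real t * (1 / 2 ^ N'))" c]
    show ?thesis using uniq by metis
  next
    case False
    then show ?thesis
      by (intro exI[of _ "T (s div 2 ^ (N' - N)) (t div 2 ^ (N' - N)) * 2 ^ (N' - N)"]) auto
  qed
  then obtain T' where T': "\<And>s t. T' s t div 2 ^ (N' - N) = T (s div 2 ^ (N' - N)) (t div 2 ^ (N' - N))"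
    and near: "\<And>s t e. ?match s t e \<Longrightarrow> \<exists>z::int. \<bar>(?\<kappa> s e * (real (T' s t) * (1 / 2 ^ (N' + 2)))
          + coef_b e * (real t * (1 / 2 ^ N'))) - \<eta> * (of_int z + c)\<bar> \<le> \<bar>?\<kappa> s e\<bar> * (1 / 2 ^ (N' + 2))"
    by metis
  have ext: "extends N T N' T'" using T' N' by (simp add: extends_def)
  have T'b: "bounded_table N' T'" by (rule extends_bounded[OF ext T])
  \<comment> \<open>stated for sublists of \<open>C\<close> to allow induction; the shifts add up to \<open>length D * c\<close>\<close>
  have sum_near: "\<exists>z::int. \<bar>center N' T' D' - \<eta> * (of_int z + real (length D) * c)\<bar> \<le> weight D * (1 / 2 ^ N')"
    if "refines (N' - n0) D' D" "set D \<subseteq> set C" for D' D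
    using that
  proof (induction rule: refines_induct)
    case Nil
    show ?case by (intro exI[of _ 0]) simp
  next
    case (Cons e' D' e D)
    then obtain z :: int where z: "\<bar>center N' T' D' - \<eta> * (of_int z + real (length D) * c)\<bar> \<le> weight D * (1 / 2 ^ N')"
      by auto
    have m: "?match (fst e') (fst (snd e')) e" using Cons by (auto simp: refines_entry_def)
    obtain y :: int where y: "\<bar>term_center N' T' e' - \<eta> * (of_int y + c)\<bar> \<le> \<bar>?\<kappa> (fst e') e\<bar> * (1 / 2 ^ (N' + 2))"
      using near[OF m] unfolding term_center_def refines_entry_coef[OF Cons(1)] by blast
    have "fst e' < 2 ^ (N' - n0 + n0)"
      by (rule less_power2_of_div) (use m C in auto)
    then have "real (fst e') * (1 / 2 ^ N') \<le> 1" by (intro scaled_le_1) (use N' in simp)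
    then have "\<bar>coef_b e * (1 + real (fst e') * (1 / 2 ^ N'))\<bar> \<le> \<bar>coef_b e\<bar> * 2"
      unfolding abs_mult by (intro mult_left_mono) auto
    then have "\<bar>?\<kappa> (fst e') e\<bar> \<le> term_weight e" unfolding term_weight_def by linarith
    then have "\<bar>?\<kappa> (fst e') e\<bar> * (1 / 2 ^ (N' + 2)) \<le> term_weight e * (1 / 2 ^ N')"
      using term_weight_nonneg[of e] by (intro mult_mono) (auto simp: power_add field_simps)
    then have "\<bar>(term_center N' T' e' - \<eta> * (of_int y + c)) + (center N' T' D' - \<eta> * (of_int z + real (length D) * c))\<bar>
        \<le> term_weight e * (1 / 2 ^ N') + weight D * (1 / 2 ^ N')"
      using y z by linarith
    then show ?case
      by (intro exI[of _ "y + z"]) (simp add: algebra_simps add_divide_distrib)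
  qed
  have "certified q J N' T' L C'" if ref: "refines (N' - n0) C' C" for C'
  proof -
    obtain z :: int where "\<bar>center N' T' C' - \<eta> * (of_int z + real (length C) * c)\<bar> \<le> weight C * (1 / 2 ^ N')"
      using sum_near[OF ref] by blast
    moreover have "real (length C) * c = 1/2" using C0 by (simp add: c_def)
    ultimately have z: "\<bar>center N' T' C' - \<eta> * (of_int z + 1/2)\<bar> \<le> weight C * (1 / 2 ^ N')"
      by simp
    define v where "v = \<eta> * (of_int z + 1/2)"
    have "cells_below (N' - n0 + n0) C'"
      by (rule refines_cells_below[OF ref]) (use C in \<open>auto simp: cells_below_def\<close>)
    then have "cells_below N' C'" using N' by simp
    from center_le_weight[OF T'b this] have "\<bar>center N' T' C'\<bar> \<le> weight C"
      by (simp add: weight_refines[OF ref])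
    moreover have "weight C * (1 / 2 ^ N') \<le> weight C * 1"
      using weight_nonneg[of C] by (intro mult_left_mono) auto
    ultimately have "v \<in> V" using z unfolding V_def v_def by (intro CollectI exI[of _ z] conjI refl) linarith
    then obtain l where l: "l \<in> {1..L}" "q l = v" "\<forall>k\<in>{1..J}. \<rho> \<le> radius q k l"
      using L by blast
    show ?thesis
      unfolding certified_def
    proof
      fix k assume "k \<in> set [1..<Suc J]"
      then have "\<rho> \<le> radius q k l" using l(3) by auto
      then have "\<bar>center N' T' C' - q l\<bar> + weight C' * (1 / 2 ^ N') < radius q k l"
        using z small unfolding l(2) v_def weight_refines[OF ref] by linarith
      then show "\<exists>l\<in>set [1..<Suc L]. \<bar>center N' T' C' - q l\<bar> + weight C' * (1 / 2 ^ N') < radius q k l"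
        using l(1) by (intro bexI[of _ l]) auto
    qed
  qed
  with ext N'(1) show ?thesis by blast
qed

text \<open>
  Constraints are treated one after the other, because certificates survive further extensions of the
  table (\<open>certified_mono\<close>).
\<close>

lemma certify_all:
  assumes q: "q ` {1..} = \<rat> - {0}" and T: "bounded_table n0 T"
    and adm: "\<forall>C\<in>set Cs. admissible_entries n0 C"
  shows "\<exists>N' T' L. n0 < N' \<and> extends n0 T N' T' \<and>
           (\<forall>C\<in>set Cs. \<forall>C'. refines (N' - n0) C' C \<longrightarrow> certified q J N' T' L C')"
  using adm
proof (induction Cs)
  case Nil
  show ?case
    by (intro exI[of _ "Suc n0"] exI[of _ "\<lambda>s t. T (s div 2) (t div 2) * 2"]) (simp add: extends_def)
next
  case (Cons C Cs)
  then obtain N1 T1 L1 where 1: "n0 < N1" "extends n0 T N1 T1"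
    "\<forall>C\<in>set Cs. \<forall>C'. refines (N1 - n0) C' C \<longrightarrow> certified q J N1 T1 L1 C'"
    by auto
  have T1: "bounded_table N1 T1" by (rule extends_bounded[OF 1(2) T])
  have "admissible_entries n0 C" using Cons.prems by simp
  from certify_one[OF q this less_imp_le[OF 1(1)] T1, of J]
  obtain N2 T2 L2 where 2: "N1 < N2" "extends N1 T1 N2 T2"
    "\<forall>C'. refines (N2 - n0) C' C \<longrightarrow> certified q J N2 T2 L2 C'" by blast
  have T2: "bounded_table N2 T2" by (rule extends_bounded[OF 2(2) T1])
  have "n0 < N2" using 1 2 by simp
  moreover have "extends n0 T N2 T2" by (rule extends_trans[OF 1(2) 2(2)])
  moreover have "\<forall>D\<in>set (C # Cs). \<forall>D'. refines (N2 - n0) D' D \<longrightarrow> certified q J N2 T2 (max L1 L2) D'"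
  proof (intro ballI allI impI)
    fix D D' assume D: "D \<in> set (C # Cs)" and ref: "refines (N2 - n0) D' D"
    have adm: "admissible_entries n0 D" using D Cons.prems by auto
    then have "cells_below n0 D" by (auto simp: admissible_entries_def cells_below_def)
    from refines_cells_below[OF ref this] have below: "cells_below N2 D'"
      using 1(1) 2(1) by simp
    show "certified q J N2 T2 (max L1 L2) D'"
    proof (cases "D = C")
      case True
      then have "certified q J N2 T2 L2 D'" using 2(3) ref by blast
      then show ?thesis
        by (rule certified_mono[where N' = N2 and T' = T2])
           (use below T2 in \<open>auto simp: extends_def refines_def refines_entry_def list_all2_same\<close>)
    next
      case False
      have "N2 - n0 = (N2 - N1) + (N1 - n0)" using 1(1) 2(1) by simp
      with ref obtain D1 where D1: "refines (N2 - N1) D' D1" "refines (N1 - n0) D1 D"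
        by (metis refines_split)
      then have "certified q J N1 T1 L1 D1" using 1(3) D False by auto
      then show ?thesis
        by (rule certified_mono[OF _ 2(2) T1 D1(1) below]) simp
    qed
  qed
  ultimately show ?case by blast
qed

section \<open>The construction as a computable search\<close>

text \<open>
  At least one code for every member of \<open>Q_set j\<close>: every integer of absolute value at most \<open>j\<close> has a code
  below \<open>2 * j + 2\<close>, and \<open>d\<close> codes the denominator \<open>d + 1\<close>.
\<close>

definition coef_codes :: "nat \<Rightarrow> nat list" where
  "coef_codes j = concat (map (\<lambda>z. map (\<lambda>d. prod_encode (z, d)) [0..<j]) [0..<2 * j + 2])"

definition all_entries :: "nat \<Rightarrow> nat \<Rightarrow> entry list" where
  "all_entries j n =
     concat (map (\<lambda>s. concat (map (\<lambda>t. concat (map (\<lambda>a. map (\<lambda>b. (s, t, a, b)) (coef_codes j)) (coef_codes j)))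
       [0..<2 ^ n])) [0..<2 ^ n])"

lemma set_all_entries:
  "set (all_entries j n) = {(s, t, a, b). s < 2 ^ n \<and> t < 2 ^ n \<and> a \<in> set (coef_codes j) \<and> b \<in> set (coef_codes j)}"
  by (auto simp: all_entries_def image_iff)

definition lists_upto :: "'a list \<Rightarrow> nat \<Rightarrow> 'a list list" where
  "lists_upto E k = rec_nat [[]] (\<lambda>i Ls. [] # concat (map (\<lambda>xs. map (\<lambda>e. e # xs) E) Ls)) k"

lemma lists_uptoI: "length xs \<le> k \<Longrightarrow> set xs \<subseteq> set E \<Longrightarrow> xs \<in> set (lists_upto E k)"
proof (induction k arbitrary: xs)
  case (Suc k)
  show ?case
  proof (cases xs)
    case (Cons y ys)
    with Suc.prems have "ys \<in> set (lists_upto E k)" by (intro Suc.IH) auto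
    with Cons Suc.prems show ?thesis by (auto simp: lists_upto_def)
  qed (simp add: lists_upto_def)
qed (simp add: lists_upto_def)

definition refinements :: "nat \<Rightarrow> entry list \<Rightarrow> entry list list" where
  "refinements d C =
     foldr (\<lambda>e Ls. concat (map (\<lambda>s. concat (map (\<lambda>t. map (\<lambda>D. (s, t, snd (snd e)) # D) Ls)
        [fst (snd e) * 2 ^ d..<Suc (fst (snd e)) * 2 ^ d])) [fst e * 2 ^ d..<Suc (fst e) * 2 ^ d])) C [[]]"

lemma div_power2_eq_iff: "(x::nat) div 2 ^ d = s \<longleftrightarrow> s * 2 ^ d \<le> x \<and> x < Suc s * 2 ^ d"
proof -
  have "x div 2 ^ d = s \<longleftrightarrow> s \<le> x div 2 ^ d \<and> x div 2 ^ d < Suc s" by auto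
  then show ?thesis by (simp add: less_eq_div_iff_mult_less_eq div_less_iff_less_mult)
qed

lemma set_refinements: "set (refinements d C) = {D. refines d D C}"
proof (induction C)
  case Nil
  show ?case by (auto simp: refinements_def refines_def)
next
  case (Cons e C)
  have "D \<in> set (refinements d (e # C)) \<longleftrightarrow> (\<exists>s t D'. D = (s, t, snd (snd e)) # D' \<and>
      s div 2 ^ d = fst e \<and> t div 2 ^ d = fst (snd e) \<and> D' \<in> set (refinements d C))" for D
    by (auto simp: refinements_def div_power2_eq_iff image_iff)
  then show ?case
    unfolding Cons.IH
    by (auto simp: refines_def list_all2_Cons2 refines_entry_def) (metis surj_pair)
qed

definition lookup :: "nat \<Rightarrow> nat list \<Rightarrow> nat \<Rightarrow> nat \<Rightarrow> nat" where
  "lookup N xs s t = (case drop (s * 2 ^ N + t) xs of [] \<Rightarrow> 0 | y # ys \<Rightarrow> y)"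

lemma lookup_surj:
  obtains xs where "\<And>s t. s < 2 ^ N \<Longrightarrow> t < 2 ^ N \<Longrightarrow> lookup N xs s t = T s t"
proof
  fix s t :: nat assume st: "s < 2 ^ N" "t < 2 ^ N"
  have "Suc s * 2 ^ N \<le> 2 ^ N * 2 ^ N" using st(1) by (intro mult_right_mono) auto
  then have "s * 2 ^ N + t < 2 ^ N * 2 ^ N" using st(2) by simp
  then have "drop (s * 2 ^ N + t) (map (\<lambda>i. T (i div 2 ^ N) (i mod 2 ^ N)) [0..<2 ^ N * 2 ^ N])
     = T s t # drop (Suc (s * 2 ^ N + t)) (map (\<lambda>i. T (i div 2 ^ N) (i mod 2 ^ N)) [0..<2 ^ N * 2 ^ N])"
    using st(2) by (subst Cons_nth_drop_Suc[symmetric]) (simp_all del: upt_Suc)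
  then show "lookup N (map (\<lambda>i. T (i div 2 ^ N) (i mod 2 ^ N)) [0..<2 ^ N * 2 ^ N]) s t = T s t"
    by (simp add: lookup_def)
qed

lemma center_cong:
  assumes "\<And>s t. s < 2 ^ N \<Longrightarrow> t < 2 ^ N \<Longrightarrow> T s t = T' s t" "cells_below N C"
  shows "center N T C = center N T' C"
  using assms unfolding center_def
  by (intro arg_cong[where f = sum_list] map_cong) (auto simp: term_center_def cells_below_def)

type_synonym state = "nat \<times> nat list"

text \<open>
  A candidate \<open>(N, L, xs)\<close> consists of a new level, a bound for the indices of the intervals used, and the new
  table.  The guard on the old table makes a candidate exist for every pair \<open>st\<close>, as the search
  for the next stage has to terminate on all inputs.
\<close>

definition stage_ok :: "(nat \<Rightarrow> real) \<Rightarrow> nat \<Rightarrow> state \<Rightarrow> nat \<times> nat \<times> nat list \<Rightarrow> bool" where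
  "stage_ok q J st c \<longleftrightarrow>
     (bounded_table (fst st) (lookup (fst st) (snd st)) \<longrightarrow>
      fst st < fst c \<and> extends (fst st) (lookup (fst st) (snd st)) (fst c) (lookup (fst c) (snd (snd c))) \<and>
      (\<forall>C\<in>set (lists_upto (all_entries J (fst st)) (2 ^ fst st * 2 ^ fst st)).
         admissible_entries (fst st) C \<longrightarrow>
         (\<forall>D\<in>set (refinements (fst c - fst st) C).
            certified q J (fst c) (lookup (fst c) (snd (snd c))) (fst (snd c)) D)))"

definition candidate :: "nat \<Rightarrow> nat \<times> nat \<times> nat list" where
  "candidate e = (fst (prod_decode e), fst (prod_decode (snd (prod_decode e))),
     list_decode (snd (prod_decode (snd (prod_decode e)))))"

lemma candidate_surj: "\<exists>e. candidate e = c"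
  by (intro exI[of _ "prod_encode (fst c, prod_encode (fst (snd c), list_encode (snd (snd c))))"])
     (simp add: candidate_def)

lemma stage_ok_exists:
  assumes q: "q ` {1..} = \<rat> - {0}"
  shows "\<exists>e. stage_ok q J st (candidate e)"
proof (cases "bounded_table (fst st) (lookup (fst st) (snd st))")
  case False
  then show ?thesis by (simp add: stage_ok_def)
next
  case True
  let ?n = "fst st" and ?T = "lookup (fst st) (snd st)"
  let ?Cs = "filter (admissible_entries ?n) (lists_upto (all_entries J ?n) (2 ^ ?n * 2 ^ ?n))"
  obtain N T L where N: "?n < N" and ext: "extends ?n ?T N T"
    and cert: "\<forall>C\<in>set ?Cs. \<forall>D. refines (N - ?n) D C \<longrightarrow> certified q J N T L D"
    using certify_all[OF q True, of ?Cs J] by auto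
  obtain xs where xs: "\<And>s t. s < 2 ^ N \<Longrightarrow> t < 2 ^ N \<Longrightarrow> lookup N xs s t = T s t"
    using lookup_surj by blast
  obtain e where e: "candidate e = (N, L, xs)" using candidate_surj by blast
  have "certified q J N (lookup N xs) L D"
    if "C \<in> set ?Cs" "refines (N - ?n) D C" for C D
  proof -
    have "cells_below ?n C" using that by (auto simp: admissible_entries_def cells_below_def)
    from refines_cells_below[OF that(2) this] have "cells_below N D" using N by simp
    then have eq: "center N (lookup N xs) D = center N T D"
      by (intro center_cong xs)
    have "certified q J N T L D" using cert that by blast
    then show ?thesis unfolding certified_def eq .
  qed
  moreover have "extends ?n ?T N (lookup N xs)" using ext xs by (simp add: extends_def)
  ultimately have "stage_ok q J st (candidate e)"
    using N by (simp add: stage_ok_def e set_refinements)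
  then show ?thesis by blast
qed

definition next_state :: "(nat \<Rightarrow> real) \<Rightarrow> nat \<Rightarrow> state \<Rightarrow> state" where
  "next_state q J st = (let c = candidate (LEAST e. stage_ok q J st (candidate e)) in (fst c, snd (snd c)))"

text \<open>
  The initial table consists of the single value 1 with two digits, that is \<open>\<theta>\<close> at stage 0 is \<open>01\<close>.
\<close>

definition state :: "(nat \<Rightarrow> real) \<Rightarrow> nat \<Rightarrow> state" where
  "state q j = rec_nat (0, [1]) (\<lambda>i st. next_state q (Suc i) st) j"

definition level :: "(nat \<Rightarrow> real) \<Rightarrow> nat \<Rightarrow> nat" where
  "level q j = fst (state q j)"

definition table :: "(nat \<Rightarrow> real) \<Rightarrow> nat \<Rightarrow> nat \<Rightarrow> nat \<Rightarrow> nat" where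
  "table q j = lookup (level q j) (snd (state q j))"

lemma level_0: "level q 0 = 0" and table_0: "table q 0 0 0 = 1"
  by (simp_all add: level_def table_def state_def lookup_def)

lemma state_step:
  assumes q: "q ` {1..} = \<rat> - {0}"
  shows "bounded_table (level q j) (table q j) \<and>
    level q j < level q (Suc j) \<and> extends (level q j) (table q j) (level q (Suc j)) (table q (Suc j)) \<and>
    (\<exists>L. \<forall>C\<in>set (lists_upto (all_entries (Suc j) (level q j)) (2 ^ level q j * 2 ^ level q j)).
         admissible_entries (level q j) C \<longrightarrow>
         (\<forall>D. refines (level q (Suc j) - level q j) D C \<longrightarrow>
            certified q (Suc j) (level q (Suc j)) (table q (Suc j)) L D))"
proof -
  have step: "bounded_table (level q j) (table q j) \<Longrightarrow>
    level q j < level q (Suc j) \<and> extends (level q j) (table q j) (level q (Suc j)) (table q (Suc j)) \<and>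
    (\<exists>L. \<forall>C\<in>set (lists_upto (all_entries (Suc j) (level q j)) (2 ^ level q j * 2 ^ level q j)).
         admissible_entries (level q j) C \<longrightarrow>
         (\<forall>D. refines (level q (Suc j) - level q j) D C \<longrightarrow>
            certified q (Suc j) (level q (Suc j)) (table q (Suc j)) L D))" for j
  proof -
    assume b: "bounded_table (level q j) (table q j)"
    define c where "c = candidate (LEAST e. stage_ok q (Suc j) (state q j) (candidate e))"
    have ok: "stage_ok q (Suc j) (state q j) c"
      unfolding c_def by (rule LeastI_ex[OF stage_ok_exists[OF q]])
    have c: "state q (Suc j) = (fst c, snd (snd c))"
      by (simp add: state_def next_state_def c_def Let_def)
    show ?thesis
      using ok b by (auto simp: stage_ok_def level_def table_def c set_refinements)
  qed
  have "bounded_table (level q j) (table q j)"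
  proof (induction j)
    case 0
    show ?case using table_0 by (simp add: bounded_table_def level_0)
  next
    case (Suc j)
    with step show ?case using extends_bounded by blast
  qed
  with step show ?thesis by blast
qed

subsection \<open>Computability\<close>

lemma computable_rat_const:
  assumes "r \<in> \<rat>" shows "computable_rat (\<lambda>x. r)"
proof -
  obtain c where "rat_decode c = r" using rat_decode_surj[OF assms] .
  then show ?thesis unfolding computable_rat_def using computable_const by blast
qed

lemmas rat_const_intros = computable_rat_const Rats_1 Rats_number_of Rats_0

lemma computable_coef [computable_intros]:
  assumes "computable e"
  shows "computable_rat (\<lambda>x. coef_a (e x))" "computable_rat (\<lambda>x. coef_b (e x))"
  unfolding coef_a_def coef_b_def by (intro computable_intros assms)+

lemma computable_lookup [computable_intros]:
  assumes "computable N" "computable xs" "computable s" "computable t"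
  shows "computable (\<lambda>x. lookup (N x) (xs x) (s x) (t x))"
  unfolding lookup_def by (intro computable_intros assms)

text \<open>
  The closure rules apply to functions of one variable given by projections, so the claim is proved for
  the tuple of all arguments and then composed.
\<close>

lemma computable_center [computable_intros]:
  assumes "computable N" "computable M" "computable xs" "computable C"
  shows "computable_rat (\<lambda>x. center (N x) (lookup (M x) (xs x)) (C x))"
proof -
  have "computable_rat (\<lambda>p::nat \<times> nat \<times> nat list \<times> entry list.
      center (fst p) (lookup (fst (snd p)) (fst (snd (snd p)))) (snd (snd (snd p))))"
    unfolding center_def term_center_def by (intro computable_intros rat_const_intros)
  moreover have "computable (\<lambda>x. (N x, M x, xs x, C x))" by (intro computable_intros assms)
  ultimately show ?thesis by (drule_tac computable_rat_compose) auto
qed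

lemma computable_weight [computable_intros]:
  assumes "computable C" shows "computable_rat (\<lambda>x. weight (C x))"
  unfolding weight_def term_weight_def
  by (intro computable_intros assms rat_const_intros)

lemma computable_radius [computable_intros]:
  assumes q: "computable_rat q" and "computable k" "computable l"
  shows "computable_rat (\<lambda>x. radius q (k x) (l x))"
proof -
  have "radius q k l = min (\<bar>q l\<bar> * (1 / 2 ^ Suc 0)) (1 / 2 ^ (k * (k + l) + 2))" for k l
    by (simp add: radius_def)
  then show ?thesis
    by (simp only:) (intro computable_intros computable_rat_compose[OF q] assms)
qed

lemma computable_certified:
  assumes q: "computable_rat q"
  shows "computable (\<lambda>p::nat \<times> nat \<times> nat list \<times> nat \<times> entry list.
     certified q (fst p) (fst (snd p)) (lookup (fst (snd p)) (fst (snd (snd p)))) (fst (snd (snd (snd p)))) (snd (snd (snd (snd p)))))"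
  unfolding certified_def
  by (intro computable_intros computable_rat_compose[OF q] q)

lemma computable_admissible:
  "computable (\<lambda>p. admissible_entries (fst p) (snd p))"
  unfolding admissible_entries_def nonvanishing_def
  by (intro computable_intros rat_const_intros computable_eq)

lemma computable_refinements:
  "computable (\<lambda>p. refinements (fst p) (snd p))"
  unfolding refinements_def by (intro computable_intros)

lemma computable_lists_upto:
  "computable (\<lambda>p. lists_upto (fst p) (snd p))"
  unfolding lists_upto_def by (intro computable_intros)

lemma computable_all_entries:
  "computable (\<lambda>p. all_entries (fst p) (snd p))"
  unfolding all_entries_def coef_codes_def by (intro computable_intros)

lemma all_less_set_upt: "(\<forall>i<m. P i) \<longleftrightarrow> (\<forall>i\<in>set [0..<m]. P i)"
  by auto

lemma computable_stage_ok:
  assumes q: "computable_rat q"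
  shows "computable (\<lambda>p::(nat \<times> state) \<times> nat. stage_ok q (fst (fst p)) (snd (fst p)) (candidate (snd p)))"
proof -
  have cert: "computable f1 \<Longrightarrow> computable f2 \<Longrightarrow> computable f3 \<Longrightarrow> computable f4 \<Longrightarrow> computable f5 \<Longrightarrow>
     computable (\<lambda>x. certified q (f1 x) (f2 x) (lookup (f2 x) (f3 x)) (f4 x) (f5 x))"
    for f1 f2 f4 :: "'a::encodable \<Rightarrow> nat" and f3 f5
    using computable_compose[OF computable_certified[OF q], of "\<lambda>x. (f1 x, f2 x, f3 x, f4 x, f5 x)"]
    by (simp add: computable_Pair)
  note pair_compose = computable_compose[of "\<lambda>p. F (fst p) (snd p)" "\<lambda>x. (f x, g x)" for F f g, simplified]
  show ?thesis
    unfolding stage_ok_def bounded_table_def extends_def all_less_set_upt candidate_def fst_conv snd_conv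
    by (intro computable_intros cert pair_compose[OF computable_admissible] pair_compose[OF computable_lists_upto]
          pair_compose[OF computable_refinements] pair_compose[OF computable_all_entries])
qed

lemma computable_next_state:
  assumes q: "computable_rat q" "q ` {1..} = \<rat> - {0}"
  shows "computable (\<lambda>p. next_state q (fst p) (snd p))"
proof -
  have "computable (\<lambda>p::nat \<times> state. LEAST e. stage_ok q (fst p) (snd p) (candidate e))"
    by (rule computable_least)
       (intro surj_enc_prod surj_enc_nat surj_enc_nat_list, rule computable_stage_ok[OF q(1)],
        rule stage_ok_exists[OF q(2)])
  then show ?thesis
    unfolding next_state_def Let_def candidate_def fst_conv snd_conv
    by (intro computable_intros)
qed

lemma computable_state:
  assumes q: "computable_rat q" "q ` {1..} = \<rat> - {0}" and "computable j"
  shows "computable (\<lambda>x. state q (j x))"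
proof -
  have "computable (\<lambda>p::nat \<times> nat \<times> state. next_state q (Suc (fst (snd p))) (snd (snd p)))"
    using computable_compose[OF computable_next_state[OF q], of "\<lambda>p. (Suc (fst (snd p)), snd (snd p))"]
    by (simp add: computable_Pair computable_Suc computable_fst computable_snd computable_id)
  then have "computable (state q)"
    unfolding state_def[abs_def] by (intro computable_intros)
  from computable_compose[OF this assms(3)] show ?thesis .
qed

lemma computable_level:
  assumes "computable_rat q" "q ` {1..} = \<rat> - {0}" "computable j"
  shows "computable (\<lambda>x. level q (j x))"
  unfolding level_def by (intro computable_intros computable_state assms)

section \<open>The generators defined by nested tables\<close>

text \<open>
  Koenig's lemma: a sequence of 0-1-valued functions on a countable set has a pointwise cluster point.
\<close>

lemma koenig:
  fixes f :: "nat \<Rightarrow> 'a::countable \<Rightarrow> bool"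
  obtains g where "\<And>A. finite A \<Longrightarrow> infinite {l. \<forall>a\<in>A. f l a = g a}"
proof -
  define good where "good k h \<longleftrightarrow> infinite {l. \<forall>i<k. f l (from_nat i) = h i}" for k and h :: "nat \<Rightarrow> bool"
  have "\<exists>h. \<forall>k. good k (h k) \<and> (\<forall>i<k. h (Suc k) i = h k i)"
  proof (rule dependent_nat_choice)
    show "\<exists>h. good 0 h" by (auto simp: good_def)
    fix h k assume h: "good k h"
    let ?S = "{l. \<forall>i<k. f l (from_nat i) = h i}"
    obtain b where b: "infinite {l\<in>?S. f l (from_nat k) = b}"
    proof (rule ccontr)
      assume "\<not> thesis"
      then have "finite {l\<in>?S. f l (from_nat k) = True}" "finite {l\<in>?S. f l (from_nat k) = False}"
        using that by blast+
      then have "finite ({l\<in>?S. f l (from_nat k) = True} \<union> {l\<in>?S. f l (from_nat k) = False})"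
        by (rule finite_UnI)
      then have "finite ?S" by (rule rev_finite_subset) blast
      with h show False by (simp add: good_def)
    qed
    have eq: "{l\<in>?S. f l (from_nat k) = b} = {l. \<forall>i<Suc k. f l (from_nat i) = (h(k := b)) i}"
      by (auto simp: less_Suc_eq)
    have "good (Suc k) (h(k := b))" unfolding good_def using b unfolding eq .
    then show "\<exists>h'. good (Suc k) h' \<and> (\<forall>i<k. h' i = h i)" by (intro exI[of _ "h(k := b)"]) simp
  qed
  then obtain h where h: "\<And>k. good k (h k)" "\<And>k i. i < k \<Longrightarrow> h (Suc k) i = h k i" by blast
  have stable: "h (i + Suc d) i = h (Suc i) i" for i d
    by (induction d) (simp_all add: h(2))
  show thesis
  proof (rule that[of "\<lambda>a. h (Suc (to_nat a)) (to_nat a)"])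
    fix A :: "'a set" assume "finite A"
    then obtain k where k: "\<And>a. a \<in> A \<Longrightarrow> to_nat a < k"
      using finite_nat_set_iff_bounded[of "to_nat ` A"] by auto
    have "h k (to_nat a) = h (Suc (to_nat a)) (to_nat a)" if "a \<in> A" for a
      using stable[of "to_nat a" "k - Suc (to_nat a)"] k[OF that] by simp
    then have "{l. \<forall>i<k. f l (from_nat i) = h k i} \<subseteq> {l. \<forall>a\<in>A. f l a = h (Suc (to_nat a)) (to_nat a)}"
      using k by fastforce
    then show "infinite {l. \<forall>a\<in>A. f l a = h (Suc (to_nat a)) (to_nat a)}"
      by (rule infinite_super) (rule h(1)[of k, unfolded good_def])
  qed
qed

locale nested_tables =
  fixes N :: "nat \<Rightarrow> nat" and T :: "nat \<Rightarrow> nat \<Rightarrow> nat \<Rightarrow> nat"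
  assumes N_0: "N 0 = 0" and N_less: "\<And>j. N j < N (Suc j)" and T_0: "T 0 0 0 = 1"
    and T_extends: "\<And>j. extends (N j) (T j) (N (Suc j)) (T (Suc j))"
begin

lemma T_bounded: "bounded_table (N j) (T j)"
proof (induction j)
  case 0
  show ?case by (simp add: bounded_table_def N_0 T_0)
next
  case (Suc j)
  then show ?case using T_extends extends_bounded by blast
qed

lemma N_strict_mono: "strict_mono N"
  by (rule strict_monoI_Suc) (rule N_less)

lemma N_ge: "j \<le> N j"
  by (rule strict_mono_imp_increasing[OF N_strict_mono])

lemma N_mono: "i \<le> j \<Longrightarrow> N i \<le> N j"
  using N_strict_mono by (simp add: strict_mono_less_eq)

lemma T_extends_le: "extends (N i) (T i) (N (i + d)) (T (i + d))"
proof (induction d)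
  case 0
  show ?case by (simp add: extends_def)
next
  case (Suc d)
  with T_extends[of "i + d"] show ?case by (auto intro: extends_trans)
qed

definition theta :: "nat \<Rightarrow> str \<Rightarrow> str \<Rightarrow> str" where
  "theta j \<sigma> \<tau> = nat_str (N j + 2) (T j (str_nat \<sigma>) (str_nat \<tau>))"

abbreviation gg :: "seq \<times> seq \<Rightarrow> real" where "gg \<equiv> gen_g N theta"
abbreviation hh :: "seq \<times> seq \<Rightarrow> real" where "hh \<equiv> gen_h N theta"

definition gen_bits :: "seq \<times> seq \<Rightarrow> seq" where
  "gen_bits p = (THE \<delta>. \<forall>l. \<delta> \<in> cylinder (theta l (initial (fst p) (N l)) (initial (snd p) (N l))))"

lemma gg_gen_bits: "gg p = seq_real (gen_bits p)"
  by (simp add: gen_g_def gen_bits_def)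

lemma T_cell_less: "T l (cell \<gamma> (N l)) (cell \<beta> (N l)) < 2 ^ (N l + 2)"
  using T_bounded cell_less by (simp add: bounded_table_def)

lemma gen_bits_cell: "cell (gen_bits p) (N l + 2) = T l (cell (fst p) (N l)) (cell (snd p) (N l))"
proof -
  let ?v = "\<lambda>l. T l (cell (fst p) (N l)) (cell (snd p) (N l))"
  have cyl: "(\<forall>l. \<delta> \<in> cylinder (theta l (initial (fst p) (N l)) (initial (snd p) (N l)))) \<longleftrightarrow>
      (\<forall>l. cell \<delta> (N l + 2) = ?v l)" for \<delta>
    unfolding cylinder_cell theta_def length_nat_str cell_def[symmetric]
    by (simp only: str_nat_nat_str[OF T_cell_less])
  have "\<exists>!\<delta>. \<forall>l. cell \<delta> (N l + 2) = ?v l"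
  proof (rule seq_of_nested_cells)
    show "?v (Suc l) div 2 ^ (N (Suc l) + 2 - (N l + 2)) = ?v l" for l
      using T_extends[of l] cell_less N_less[of l]
      by (simp add: extends_def cell_div)
  qed (use N_less T_cell_less in simp_all)
  from theI'[OF this] show ?thesis
    unfolding gen_bits_def cyl by blast
qed

lemma gg_bounds:
  "real (T l (cell (fst p) (N l)) (cell (snd p) (N l))) / 2 ^ (N l + 2) \<le> gg p"
  "gg p \<le> (real (T l (cell (fst p) (N l)) (cell (snd p) (N l))) + 1) / 2 ^ (N l + 2)"
  unfolding gg_gen_bits gen_bits_cell[symmetric] by (rule seq_real_bounds)+

definition in_cells :: "nat \<Rightarrow> entry \<Rightarrow> seq \<times> seq \<Rightarrow> bool" where
  "in_cells n e p \<longleftrightarrow> fst e = cell (fst p) n \<and> fst (snd e) = cell (snd p) n"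

definition term_value :: "entry \<Rightarrow> seq \<times> seq \<Rightarrow> real" where
  "term_value e p = coef_a e * gg p + coef_b e * hh p"

definition sum_value :: "entry list \<Rightarrow> (seq \<times> seq) list \<Rightarrow> real" where
  "sum_value C ps = (\<Sum>(e, p)\<leftarrow>zip C ps. term_value e p)"

lemma sum_value_Nil [simp]: "sum_value [] [] = 0"
  and sum_value_Cons [simp]: "sum_value (e # C) (p # ps) = term_value e p + sum_value C ps"
  by (simp_all add: sum_value_def)

lemma term_value_approx:
  assumes "in_cells (N l) e p"
  shows "\<bar>term_value e p - term_center (N l) (T l) e\<bar> \<le> term_weight e / 2 ^ N l"
proof -
  have "\<bar>((coef_a e - coef_b e * (1 + seq_real (fst p))) * gg p + coef_b e * seq_real (snd p))
      - term_center (N l) (T l) e\<bar> \<le> term_weight e / 2 ^ N l"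
    by (rule term_center_approx[OF T_bounded])
       (use assms gg_bounds[where l = l and p = p] in \<open>auto simp: in_cells_def cell_less intro: seq_real_bounds\<close>)
  then show ?thesis
    by (simp add: term_value_def gen_h_def xi_def algebra_simps)
qed

lemma sum_value_approx:
  assumes "list_all2 (in_cells (N l)) C ps"
  shows "\<bar>sum_value C ps - center (N l) (T l) C\<bar> \<le> weight C / 2 ^ N l"
  using assms
proof (induction rule: list_all2_induct)
  case (Cons e C p ps)
  have "\<bar>term_value e p - term_center (N l) (T l) e\<bar> \<le> term_weight e / 2 ^ N l"
    by (rule term_value_approx) (rule Cons(1))
  with Cons show ?case by (simp add: add_divide_distrib)
qed simp

definition at_level :: "nat \<Rightarrow> entry list \<Rightarrow> (seq \<times> seq) list \<Rightarrow> entry list" where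
  "at_level l C ps = map2 (\<lambda>e p. (cell (fst p) (N l), cell (snd p) (N l), snd (snd e))) C ps"

lemma at_level_props:
  assumes "list_all2 (in_cells (N j)) C ps" "j \<le> l"
  shows "list_all2 (in_cells (N l)) (at_level l C ps) ps"
    "refines (N l - N j) (at_level l C ps) C"
    "sum_value (at_level l C ps) ps = sum_value C ps"
    "cells_below (N l) (at_level l C ps)"
  using assms(1) N_mono[OF assms(2)]
  by (induction rule: list_all2_induct)
     (auto simp: at_level_def in_cells_def refines_entry_def cell_div term_value_def coef_a_def coef_b_def
        cells_below_def cell_less)

text \<open>
  With \<open>None\<close> the sets \<open>cell_sums\<close> below make up all admissible sums, with \<open>Some (i, r)\<close> for rational \<open>r\<close> those with
  a rational multiplier; both are treated by the same compactness argument.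
\<close>

definition constraint :: "(nat \<times> real) option \<Rightarrow> (seq \<times> seq) list \<Rightarrow> bool" where
  "constraint c ps = (case c of None \<Rightarrow> True | Some (i, r) \<Rightarrow> i < length ps \<and> xi (ps ! i) = r)"

definition near_constraint :: "nat \<Rightarrow> (nat \<times> real) option \<Rightarrow> entry list \<Rightarrow> bool" where
  "near_constraint l c C = (case c of None \<Rightarrow> True
     | Some (i, r) \<Rightarrow> i < length C \<and> \<bar>1 + real (fst (C ! i)) * (1 / 2 ^ N l) - r\<bar> \<le> 1 / 2 ^ N l)"

definition cell_sums :: "nat \<Rightarrow> entry list \<Rightarrow> (nat \<times> real) option \<Rightarrow> real set" where
  "cell_sums j C c = {sum_value C ps | ps. list_all2 (in_cells (N j)) C ps \<and> constraint c ps}"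

definition near_sum :: "nat \<Rightarrow> entry list \<Rightarrow> (nat \<times> real) option \<Rightarrow> nat \<Rightarrow> real \<Rightarrow> bool" where
  "near_sum j C c l x \<longleftrightarrow> (\<exists>D. refines (N l - N j) D C \<and> near_constraint l c D \<and>
     \<bar>x - center (N l) (T l) D\<bar> \<le> weight D * (1 / 2 ^ N l))"

lemma cell_close: "\<bar>seq_real \<beta> - real (cell \<beta> n) * (1 / 2 ^ n)\<bar> \<le> 1 / 2 ^ n"
  using seq_real_bounds[of \<beta> n] by (simp add: add_divide_distrib)

lemma sums_near:
  assumes "x \<in> cell_sums j C c" "j \<le> l"
  shows "near_sum j C c l x"
proof -
  obtain ps where ps: "list_all2 (in_cells (N j)) C ps" "constraint c ps" "x = sum_value C ps"
    using assms(1) by (auto simp: cell_sums_def)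
  note D = at_level_props[OF ps(1) assms(2)]
  have "near_constraint l c (at_level l C ps)"
  proof (cases c)
    case (Some ir)
    obtain i r where ir: "ir = (i, r)" by fastforce
    have len: "length (at_level l C ps) = length ps" using D(1) by (rule list_all2_lengthD)
    have i: "i < length ps" "xi (ps ! i) = r" using ps(2) by (auto simp: constraint_def Some ir)
    have "fst (at_level l C ps ! i) = cell (fst (ps ! i)) (N l)"
      using list_all2_nthD2[OF D(1) i(1)] by (simp add: in_cells_def)
    then show ?thesis
      using cell_close[of "fst (ps ! i)" "N l"] i len
      by (simp add: near_constraint_def Some ir xi_def abs_minus_commute flip: i(2))
  qed (simp add: near_constraint_def)
  moreover have "\<bar>x - center (N l) (T l) (at_level l C ps)\<bar> \<le> weight (at_level l C ps) * (1 / 2 ^ N l)"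
    using sum_value_approx[OF D(1)] by (simp add: ps(3) D(3))
  ultimately show ?thesis unfolding near_sum_def using D(2) by blast
qed

lemma zero_of_small_at_levels:
  fixes x c :: real
  assumes "\<And>M. M \<ge> j \<Longrightarrow> \<bar>x\<bar> \<le> c * (1 / 2 ^ N M)"
  shows "x = 0"
proof (rule ccontr)
  assume x: "x \<noteq> 0"
  have "c > 0"
  proof (rule ccontr)
    assume "\<not> c > 0"
    then have "c * (1 / 2 ^ N j) \<le> 0" by (simp add: divide_le_0_iff)
    with assms[of j] x show False by simp
  qed
  obtain M where "(1/2) ^ M < \<bar>x\<bar> / c"
    using real_arch_pow_inv[of "\<bar>x\<bar> / c" "1/2"] x \<open>c > 0\<close> by auto
  then have M: "c * (1/2) ^ M < \<bar>x\<bar>" using \<open>c > 0\<close> by (simp add: field_simps)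
  have "(1/2 :: real) ^ N (max M j) \<le> (1/2) ^ M"
    using N_ge[of "max M j"] by (intro power_decreasing) auto
  then have "c * (1/2) ^ N (max M j) \<le> c * (1/2) ^ M" using \<open>c > 0\<close> by simp
  with M assms[of "max M j"] show False by (simp add: power_one_over)
qed

text \<open>
  At every level some refinement of the cells encloses \<open>x\<close>; picking parameters in these cells gives a
  sequence in a product of Cantor spaces.  A cluster point of this sequence has sum \<open>x\<close>, since the
  enclosures shrink, and inherits the constraint.
\<close>

lemma near_imp_sums:
  assumes below: "cells_below (N j) C" and near: "\<And>l. j \<le> l \<Longrightarrow> near_sum j C c l x"
  shows "x \<in> cell_sums j C c"
proof -
  obtain D where D: "\<And>l. j \<le> l \<Longrightarrow> refines (N l - N j) (D l) C \<and> near_constraint l c (D l) \<and>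
     \<bar>x - center (N l) (T l) (D l)\<bar> \<le> weight (D l) * (1 / 2 ^ N l)"
    using near unfolding near_sum_def by metis
  have D_below: "cells_below (N l) (D l)" if "j \<le> l" for l
    using refines_cells_below[of "N l - N j" "D l" C "N j"] D[OF that] below N_mono[OF that] by simp
  have len: "length (D l) = length C" if "j \<le> l" for l
    using D[OF that] refines_length by blast
  have "\<exists>p. in_cells (N l) (D l ! i) p" if "j \<le> l" "i < length C" for l i
  proof -
    have "fst (D l ! i) < 2 ^ N l" "fst (snd (D l ! i)) < 2 ^ N l"
      using D_below[OF that(1)] len[OF that(1)] that(2) by (auto simp: cells_below_def)
    then obtain \<gamma> \<beta> where "cell \<gamma> (N l) = fst (D l ! i)" "cell \<beta> (N l) = fst (snd (D l ! i))"
      using cell_surj by metis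
    then show ?thesis by (intro exI[of _ "(\<gamma>, \<beta>)"]) (simp add: in_cells_def)
  qed
  then obtain P where P: "\<And>l i. j \<le> l \<Longrightarrow> i < length C \<Longrightarrow> in_cells (N l) (D l ! i) (P l i)"
    by metis
  obtain g where g: "\<And>A. finite A \<Longrightarrow>
      infinite {l. \<forall>a\<in>A. (case a of (i, b, k) \<Rightarrow> if b then fst (P l i) k else snd (P l i) k) = g a}"
    using koenig[of "\<lambda>l (i, b, k). if b then fst (P l i) k else snd (P l i) k"] by blast
  define ps where "ps = map (\<lambda>i. (\<lambda>k. g (i, True, k), \<lambda>k. g (i, False, k))) [0..<length C]"
  \<comment> \<open>depth \<open>N M\<close> of the limit is attained at some later level \<open>l\<close>\<close>
  have agree: "\<exists>l\<ge>M. \<forall>i<length C. cell (fst (P l i)) (N M) = cell (fst (ps ! i)) (N M) \<and>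
       cell (snd (P l i)) (N M) = cell (snd (ps ! i)) (N M)" for M
  proof -
    let ?A = "{..<length C} \<times> (UNIV :: bool set) \<times> {..<N M}"
    have "infinite {l. \<forall>a\<in>?A. (case a of (i, b, k) \<Rightarrow> if b then fst (P l i) k else snd (P l i) k) = g a}"
      by (rule g) simp
    then obtain l where l: "l \<ge> M"
      "\<forall>a\<in>?A. (case a of (i, b, k) \<Rightarrow> if b then fst (P l i) k else snd (P l i) k) = g a"
      unfolding infinite_nat_iff_unbounded_le by blast
    have "fst (P l i) k = fst (ps ! i) k \<and> snd (P l i) k = snd (ps ! i) k" if "i < length C" "k < N M" for i k
      using l(2)[rule_format, of "(i, True, k)"] l(2)[rule_format, of "(i, False, k)"] that
      by (simp add: ps_def)
    with l(1) show ?thesis by (intro exI[of _ l]) (auto intro!: cell_cong)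
  qed
  have len_ps: "length ps = length C" by (simp add: ps_def)
  have level: "\<exists>l\<ge>M. refines (N l - N M) (D l) (at_level M C ps)" if "j \<le> M" for M
  proof -
    obtain l where l: "l \<ge> M" and ag: "\<forall>i<length C. cell (fst (P l i)) (N M) = cell (fst (ps ! i)) (N M) \<and>
       cell (snd (P l i)) (N M) = cell (snd (ps ! i)) (N M)"
      using agree by blast
    have jl: "j \<le> l" using l that by simp
    have "refines_entry (N l - N M) (D l ! i) (at_level M C ps ! i)" if i: "i < length C" for i
    proof -
      have "in_cells (N l) (D l ! i) (P l i)" by (rule P[OF jl i])
      moreover have "refines_entry (N l - N j) (D l ! i) (C ! i)"
        using D[OF jl] i len[OF jl] by (auto simp: refines_def list_all2_conv_all_nth)
      ultimately show ?thesis
        using ag i N_mono[OF l] by (simp add: refines_entry_def in_cells_def at_level_def len_ps cell_div)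
    qed
    then show ?thesis
      using l len[OF jl] by (intro exI[of _ l]) (simp add: refines_def list_all2_conv_all_nth at_level_def len_ps)
  qed
  have cells: "list_all2 (in_cells (N j)) C ps"
  proof -
    obtain l where l: "l \<ge> j" and r: "refines (N l - N j) (D l) (at_level j C ps)" using level by blast
    have "refines (N l - N j) (D l) C" using D[OF l] by blast
    with r have "fst (C ! i) = fst (at_level j C ps ! i)" "fst (snd (C ! i)) = fst (snd (at_level j C ps ! i))"
      if "i < length C" for i
      using that len[OF l] unfolding refines_def by (auto simp: list_all2_conv_all_nth refines_entry_def)
    then show ?thesis
      by (simp add: list_all2_conv_all_nth len_ps in_cells_def at_level_def)
  qed
  have "sum_value C ps - x = 0"
  proof (rule zero_of_small_at_levels[of j])
    fix M assume M: "M \<ge> j"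
    note L = at_level_props[OF cells M]
    obtain l where l: "l \<ge> M" and r: "refines (N l - N M) (D l) (at_level M C ps)" using level[OF M] by blast
    have jl: "j \<le> l" using l M by simp
    have ext: "extends (N M) (T M) (N l) (T l)" using T_extends_le[of M "l - M"] l by simp
    have "\<bar>center (N l) (T l) (D l) - center (N M) (T M) (at_level M C ps)\<bar>
        \<le> weight (at_level M C ps) / 2 ^ N M - weight (at_level M C ps) / 2 ^ N l"
      by (rule center_nested[OF ext T_bounded r D_below[OF jl]])
    moreover have "\<bar>x - center (N l) (T l) (D l)\<bar> \<le> weight (at_level M C ps) / 2 ^ N l"
      using D[OF jl] weight_refines[OF r] by simp
    moreover have "\<bar>sum_value C ps - center (N M) (T M) (at_level M C ps)\<bar> \<le> weight (at_level M C ps) / 2 ^ N M"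
      using sum_value_approx[OF L(1)] L(3) by simp
    ultimately have "\<bar>sum_value C ps - x\<bar> \<le> 2 * (weight (at_level M C ps) / 2 ^ N M)" by linarith
    then show "\<bar>sum_value C ps - x\<bar> \<le> (2 * weight C) * (1 / 2 ^ N M)"
      by (simp add: weight_refines[OF L(2)])
  qed
  moreover have "constraint c ps"
  proof (cases c)
    case (Some ir)
    obtain i r where ir: "ir = (i, r)" by fastforce
    have near_c: "i < length C \<and> \<bar>1 + real (fst (D l ! i)) * (1 / 2 ^ N l) - r\<bar> \<le> 1 / 2 ^ N l" if "j \<le> l" for l
      using D[OF that] len[OF that] by (simp add: near_constraint_def Some ir)
    then have i: "i < length C" by blast
    have "xi (ps ! i) - r = 0"
    proof (rule zero_of_small_at_levels[of j])
      fix M assume M: "M \<ge> j"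
      obtain l where l: "l \<ge> M" and rf: "refines (N l - N M) (D l) (at_level M C ps)" using level[OF M] by blast
      have jl: "j \<le> l" using l M by simp
      have "refines_entry (N l - N M) (D l ! i) (at_level M C ps ! i)"
        using rf i len[OF jl] by (auto simp: refines_def list_all2_conv_all_nth)
      then have "fst (D l ! i) div 2 ^ (N l - N M) = cell (fst (ps ! i)) (N M)"
        using i by (simp add: refines_entry_def at_level_def len_ps)
      with div_power2_real_bounds[OF N_mono[OF l], of "fst (D l ! i)"]
      have "\<bar>real (fst (D l ! i)) * (1 / 2 ^ N l) - real (cell (fst (ps ! i)) (N M)) * (1 / 2 ^ N M)\<bar>
          \<le> 1 / 2 ^ N M - 1 / 2 ^ N l" by simp
      moreover note near_c[OF jl] cell_close[of "fst (ps ! i)" "N M"]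
      ultimately have "\<bar>xi (ps ! i) - r\<bar> \<le> 2 * (1 / 2 ^ N M)"
        unfolding xi_def by linarith
      then show "\<bar>xi (ps ! i) - r\<bar> \<le> 2 * (1 / 2 ^ N M)" .
    qed
    then show ?thesis using i by (simp add: constraint_def Some ir len_ps)
  qed (simp add: constraint_def)
  ultimately show ?thesis using cells by (auto simp: cell_sums_def)
qed

end

section \<open>The group and its admissible representations\<close>

declare split_paired_All [simp del] split_paired_Ex [simp del]

definition gsum :: "(nat \<Rightarrow> nat) \<Rightarrow> (nat \<Rightarrow> str \<Rightarrow> str \<Rightarrow> str) \<Rightarrow> (seq \<times> seq) set \<Rightarrow>
    (seq \<times> seq \<Rightarrow> real) \<Rightarrow> (seq \<times> seq \<Rightarrow> real) \<Rightarrow> real" where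
  "gsum n \<theta> P a b = (\<Sum>p\<in>P. a p * gen_g n \<theta> p + b p * gen_h n \<theta> p)"

definition good_coefs :: "(seq \<times> seq) set \<Rightarrow> (seq \<times> seq \<Rightarrow> real) \<Rightarrow> (seq \<times> seq \<Rightarrow> real) \<Rightarrow> bool" where
  "good_coefs P a b \<longleftrightarrow> finite P \<and> P \<noteq> {} \<and> (\<forall>p\<in>P. a p \<in> \<rat> \<and> b p \<in> \<rat> \<and> a p - b p * xi p \<noteq> 0)"

text \<open>
  Indexing the summands by the set of parameters itself makes sums of representations easy to form.
\<close>

lemma admissible_rep_iff:
  "(\<exists>r a b p. admissible_rep n \<theta> r a b p x \<and> R (p ` {1..r})) \<longleftrightarrow>
   (\<exists>P a b. good_coefs P a b \<and> x = gsum n \<theta> P a b \<and> R P)"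
proof
  assume "\<exists>r a b p. admissible_rep n \<theta> r a b p x \<and> R (p ` {1..r})"
  then obtain r a b p where rep: "admissible_rep n \<theta> r a b p x" and R: "R (p ` {1..r})" by blast
  then have inj: "inj_on p {1..r}" by (simp add: admissible_rep_def)
  let ?i = "inv_into {1..r} p"
  have i: "\<And>k. k \<in> {1..r} \<Longrightarrow> ?i (p k) = k" using inj by simp
  have "good_coefs (p ` {1..r}) (\<lambda>q. a (?i q)) (\<lambda>q. b (?i q))"
    using rep i by (auto simp: good_coefs_def admissible_rep_def)
  moreover have "x = gsum n \<theta> (p ` {1..r}) (\<lambda>q. a (?i q)) (\<lambda>q. b (?i q))"
    unfolding gsum_def sum.reindex[OF inj] o_def using rep i by (simp add: admissible_rep_def)
  ultimately show "\<exists>P a b. good_coefs P a b \<and> x = gsum n \<theta> P a b \<and> R P" using R by blast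
next
  assume "\<exists>P a b. good_coefs P a b \<and> x = gsum n \<theta> P a b \<and> R P"
  then obtain P a b where good: "good_coefs P a b" and x: "x = gsum n \<theta> P a b" and R: "R P" by blast
  obtain p where p: "bij_betw p {1..card P} P"
    using ex_bij_betw_nat_finite_1[of P] good by (auto simp: good_coefs_def)
  then have P: "P = p ` {1..card P}" and inj: "inj_on p {1..card P}" by (auto simp: bij_betw_def)
  have "admissible_rep n \<theta> (card P) (\<lambda>i. a (p i)) (\<lambda>i. b (p i)) p x"
    unfolding admissible_rep_def
  proof (intro conjI)
    show "1 \<le> card P" using good by (simp add: good_coefs_def Suc_le_eq card_gt_0_iff)
    have mem: "p i \<in> P" if "i \<in> {1..card P}" for i using P that by blast
    show "\<forall>i\<in>{1..card P}. a (p i) \<in> \<rat> \<and> b (p i) \<in> \<rat>"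
      "\<forall>i\<in>{1..card P}. a (p i) - b (p i) * xi (p i) \<noteq> 0"
      using good mem unfolding good_coefs_def by blast+
    show "x = (\<Sum>i = 1..card P. a (p i) * gen_g n \<theta> (p i) + b (p i) * gen_h n \<theta> (p i))"
      unfolding x gsum_def by (rule sum.reindex_bij_betw[OF p, symmetric])
  qed (rule inj)
  with R P show "\<exists>r a b p. admissible_rep n \<theta> r a b p x \<and> R (p ` {1..r})" by metis
qed

lemma F_set_iff: "x \<in> F_set n \<theta> \<longleftrightarrow> (\<exists>P a b. good_coefs P a b \<and> x = gsum n \<theta> P a b)"
  using admissible_rep_iff[of n \<theta> x "\<lambda>_. True"] by (simp add: F_set_def)

lemma F_rat_iff:
  "x \<in> F_rat n \<theta> \<longleftrightarrow> (\<exists>P a b. good_coefs P a b \<and> x = gsum n \<theta> P a b \<and> (\<exists>p\<in>P. xi p \<in> \<rat>))"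
  using admissible_rep_iff[of n \<theta> x "\<lambda>P. \<exists>p\<in>P. xi p \<in> \<rat>"] by (simp add: F_rat_def)

text \<open>
  Extending coefficients by zero allows two sums to be compared over the union of their index sets.
\<close>

abbreviation mask :: "'a set \<Rightarrow> ('a \<Rightarrow> real) \<Rightarrow> 'a \<Rightarrow> real" where
  "mask P a \<equiv> \<lambda>p. if p \<in> P then a p else 0"

lemma gsum_mask:
  assumes "finite Q" "P \<subseteq> Q" shows "gsum n \<theta> Q (mask P a) (mask P b) = gsum n \<theta> P a b"
  unfolding gsum_def by (rule sum.mono_neutral_cong_right[OF assms]) auto

lemma gsum_add: "gsum n \<theta> P (\<lambda>p. a p + a' p) (\<lambda>p. b p + b' p) = gsum n \<theta> P a b + gsum n \<theta> P a' b'"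
  by (simp add: gsum_def algebra_simps sum.distrib)

lemma gsum_scale: "gsum n \<theta> P (\<lambda>p. c * a p) (\<lambda>p. c * b p) = c * gsum n \<theta> P a b"
  by (simp add: gsum_def algebra_simps sum_distrib_left)

lemma gsum_support:
  assumes "finite P" shows "gsum n \<theta> P a b = gsum n \<theta> {p\<in>P. (a p, b p) \<noteq> (0, 0)} a b"
  unfolding gsum_def by (rule sum.mono_neutral_right) (use assms in auto)

interpretation rat_span: vector_space rat_scale
  by (rule vector_space_rat_scale)

lemma group_A_closed:
  "0 \<in> group_A n \<theta>"
  "x \<in> group_A n \<theta> \<Longrightarrow> y \<in> group_A n \<theta> \<Longrightarrow> x + y \<in> group_A n \<theta>"
  "r \<in> \<rat> \<Longrightarrow> x \<in> group_A n \<theta> \<Longrightarrow> r * x \<in> group_A n \<theta>"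
proof -
  show "0 \<in> group_A n \<theta>" "x \<in> group_A n \<theta> \<Longrightarrow> y \<in> group_A n \<theta> \<Longrightarrow> x + y \<in> group_A n \<theta>"
    unfolding group_A_def by (rule rat_span.span_zero, rule rat_span.span_add)
  assume "r \<in> \<rat>" "x \<in> group_A n \<theta>"
  then show "r * x \<in> group_A n \<theta>"
    unfolding group_A_def by (auto elim!: Rats_cases simp flip: rat_scale_def intro: rat_span.span_scale)
qed

lemma group_A_gen:
  "xi p \<notin> \<rat> \<Longrightarrow> gen_g n \<theta> p \<in> group_A n \<theta>" "xi p \<notin> \<rat> \<Longrightarrow> gen_h n \<theta> p \<in> group_A n \<theta>"
  unfolding group_A_def by (auto intro!: rat_span.span_base)

lemma group_A_eq:
  "group_A n \<theta> = {gsum n \<theta> P a b | P a b. finite P \<and> (\<forall>p\<in>P. xi p \<notin> \<rat>) \<and> (\<forall>p. a p \<in> \<rat> \<and> b p \<in> \<rat>)}"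
  (is "_ = ?S")
proof
  have "rat_span.subspace ?S"
  proof (rule rat_span.subspaceI)
    show "0 \<in> ?S"
      by (intro CollectI exI[of _ "{}"] exI[of _ "\<lambda>_. 0"]) (simp add: gsum_def)
  next
    fix x y assume "x \<in> ?S" "y \<in> ?S"
    then obtain P a b P' a' b' where x: "x = gsum n \<theta> P a b" "finite P" "\<forall>p\<in>P. xi p \<notin> \<rat>" "\<forall>p. a p \<in> \<rat> \<and> b p \<in> \<rat>"
      and y: "y = gsum n \<theta> P' a' b'" "finite P'" "\<forall>p\<in>P'. xi p \<notin> \<rat>" "\<forall>p. a' p \<in> \<rat> \<and> b' p \<in> \<rat>"
      by blast
    have "x + y = gsum n \<theta> (P \<union> P') (\<lambda>p. mask P a p + mask P' a' p) (\<lambda>p. mask P b p + mask P' b' p)"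
      unfolding gsum_add using x y by (simp add: gsum_mask)
    moreover have "\<forall>p. mask P a p + mask P' a' p \<in> \<rat> \<and> mask P b p + mask P' b' p \<in> \<rat>"
      using x(4) y(4) by (auto intro: Rats_add)
    moreover have "finite (P \<union> P')" "\<forall>p\<in>P \<union> P'. xi p \<notin> \<rat>" using x y by auto
    ultimately show "x + y \<in> ?S" by blast
  next
    fix c x assume "x \<in> ?S"
    then obtain P a b where x: "x = gsum n \<theta> P a b" "finite P" "\<forall>p\<in>P. xi p \<notin> \<rat>" "\<forall>p. a p \<in> \<rat> \<and> b p \<in> \<rat>"
      by blast
    have "rat_scale c x = gsum n \<theta> P (\<lambda>p. of_rat c * a p) (\<lambda>p. of_rat c * b p)"
      by (simp add: gsum_scale rat_scale_def x(1))
    moreover have "\<forall>p. of_rat c * a p \<in> \<rat> \<and> of_rat c * b p \<in> \<rat>"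
      using x(4) by (auto intro: Rats_mult)
    ultimately show "rat_scale c x \<in> ?S" using x(2,3) by blast
  qed
  moreover have "(\<Union>p\<in>{p. xi p \<notin> \<rat>}. {gen_g n \<theta> p, gen_h n \<theta> p}) \<subseteq> ?S"
  proof
    fix x assume "x \<in> (\<Union>p\<in>{p. xi p \<notin> \<rat>}. {gen_g n \<theta> p, gen_h n \<theta> p})"
    then obtain p where p: "xi p \<notin> \<rat>" "x = gen_g n \<theta> p \<or> x = gen_h n \<theta> p" by blast
    have "gen_g n \<theta> p = gsum n \<theta> {p} (\<lambda>_. 1) (\<lambda>_. 0)" "gen_h n \<theta> p = gsum n \<theta> {p} (\<lambda>_. 0) (\<lambda>_. 1)"
      by (simp_all add: gsum_def)
    then have "\<exists>a b. x = gsum n \<theta> {p} a b \<and> (\<forall>p. a p \<in> \<rat> \<and> b p \<in> \<rat>)"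
      using p(2) by (metis Rats_0 Rats_1)
    then obtain a b where "x = gsum n \<theta> {p} a b" "\<forall>p. a p \<in> \<rat> \<and> b p \<in> \<rat>" by blast
    moreover have "finite {p}" "\<forall>q\<in>{p}. xi q \<notin> \<rat>" using p(1) by auto
    ultimately show "x \<in> ?S" by blast
  qed
  ultimately show "group_A n \<theta> \<subseteq> ?S"
    unfolding group_A_def by (rule rat_span.span_minimal[rotated])
next
  show "?S \<subseteq> group_A n \<theta>"
  proof clarify
    fix P and a b :: "seq \<times> seq \<Rightarrow> real"
    assume P: "finite P" "\<forall>p\<in>P. xi p \<notin> \<rat>" "\<forall>p. a p \<in> \<rat> \<and> b p \<in> \<rat>"
    show "gsum n \<theta> P a b \<in> group_A n \<theta>"
      using P(1,2) unfolding gsum_def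
      by (induction P rule: finite_induct) (use P(3) in \<open>auto intro!: group_A_closed group_A_gen\<close>)
  qed
qed

lemma irrational_good:
  assumes "xi p \<notin> \<rat>" "a \<in> \<rat>" "b \<in> \<rat>" "(a, b) \<noteq> (0, 0)" shows "a - b * xi p \<noteq> 0"
proof
  assume "a - b * xi p = 0"
  with assms(4) have "b \<noteq> 0" "xi p = a / b" by (auto simp: field_simps)
  with assms show False using Rats_divide by metis
qed

text \<open>
  If a member of the group also had a representation with a rational multiplier, the difference of the two
  would represent 0.  The summand with the rational multiplier cannot cancel, because only irrational
  multipliers occur in the other sum; after removal of zero coefficients this is an admissible
  representation of 0.
\<close>

lemma group_A_eq_F:
  assumes zero: "0 \<notin> F_set n \<theta>"
  shows "group_A n \<theta> = (F_set n \<theta> \<union> {0}) - F_rat n \<theta>"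
proof (intro equalityI subsetI)
  fix x assume "x \<in> group_A n \<theta>"
  then obtain P a b where x: "x = gsum n \<theta> P a b" and P: "finite P" "\<forall>p\<in>P. xi p \<notin> \<rat>" "\<forall>p. a p \<in> \<rat> \<and> b p \<in> \<rat>"
    unfolding group_A_eq by blast
  have rat_ab: "a p \<in> \<rat>" "b p \<in> \<rat>" for p using P(3) by blast+
  let ?P = "{p\<in>P. (a p, b p) \<noteq> (0, 0)}"
  have x': "x = gsum n \<theta> ?P a b" unfolding x by (rule gsum_support[OF P(1)])
  have "x \<in> F_set n \<theta> \<union> {0}"
  proof (cases "?P = {}")
    case True
    have "x = 0" using x' unfolding True by (simp add: gsum_def)
    then show ?thesis by simp
  next
    case False
    have "a p - b p * xi p \<noteq> 0" if "p \<in> ?P" for p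
      by (rule irrational_good) (use that P(2) in \<open>auto intro: rat_ab\<close>)
    moreover have "finite ?P" using P(1) by simp
    ultimately have "good_coefs ?P a b" unfolding good_coefs_def using False rat_ab by blast
    then show ?thesis unfolding F_set_iff Un_iff using x' by blast
  qed
  moreover have "x \<notin> F_rat n \<theta>"
  proof
    assume "x \<in> F_rat n \<theta>"
    then obtain Q c d q where Q: "good_coefs Q c d" "x = gsum n \<theta> Q c d" "q \<in> Q" "xi q \<in> \<rat>"
      unfolding F_rat_iff by blast
    define u v where "u = (\<lambda>p. mask Q c p + mask P (\<lambda>p. (-1) * a p) p)"
      and "v = (\<lambda>p. mask Q d p + mask P (\<lambda>p. (-1) * b p) p)"
    have fin: "finite (P \<union> Q)" using P Q by (simp add: good_coefs_def)
    have "gsum n \<theta> (P \<union> Q) u v = x + (-1) * x"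
      unfolding u_def v_def gsum_add gsum_mask[OF fin Un_upper1] gsum_mask[OF fin Un_upper2] gsum_scale
      by (simp only: x[symmetric] Q(2)[symmetric])
    then have 0: "gsum n \<theta> {p\<in>P \<union> Q. (u p, v p) \<noteq> (0, 0)} u v = 0"
      using gsum_support[OF fin, of n \<theta> u v] by simp
    have "good_coefs {p\<in>P \<union> Q. (u p, v p) \<noteq> (0, 0)} u v"
      unfolding good_coefs_def
    proof (intro conjI ballI)
      have "q \<notin> P" using P Q by blast
      then have "u q = c q" "v q = d q" using Q(3) by (auto simp: u_def v_def)
      moreover have "c q - d q * xi q \<noteq> 0" using Q by (auto simp: good_coefs_def)
      ultimately have "q \<in> {p\<in>P \<union> Q. (u p, v p) \<noteq> (0, 0)}" using Q(3) by auto
      then show "{p\<in>P \<union> Q. (u p, v p) \<noteq> (0, 0)} \<noteq> {}" by blast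
    next
      fix p assume p: "p \<in> {p\<in>P \<union> Q. (u p, v p) \<noteq> (0, 0)}"
      have rat: "c p \<in> \<rat> \<and> d p \<in> \<rat>" if "p \<in> Q" using Q(1) that by (auto simp: good_coefs_def)
      show u: "u p \<in> \<rat>" and v: "v p \<in> \<rat>"
        using rat by (auto simp: u_def v_def intro: rat_ab Rats_diff)
      show "u p - v p * xi p \<noteq> 0"
      proof (cases "p \<in> P")
        case True
        show ?thesis by (rule irrational_good) (use True P(2) u v p in auto)
      next
        case False
        then show ?thesis using p Q(1) by (auto simp: u_def v_def good_coefs_def)
      qed
    qed (use fin in simp)
    then have "0 \<in> F_set n \<theta>" unfolding F_set_iff using 0[symmetric] by blast
    with zero show False by blast
  qed
  ultimately show "x \<in> (F_set n \<theta> \<union> {0}) - F_rat n \<theta>" by blast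
next
  fix x assume x: "x \<in> (F_set n \<theta> \<union> {0}) - F_rat n \<theta>"
  show "x \<in> group_A n \<theta>"
  proof (cases "x = 0")
    case False
    with x obtain P a b where P: "good_coefs P a b" "x = gsum n \<theta> P a b" by (auto simp: F_set_iff)
    moreover have "x \<notin> F_rat n \<theta>" using x by blast
    ultimately have "\<forall>p\<in>P. xi p \<notin> \<rat>" unfolding F_rat_iff by blast
    moreover have "x = gsum n \<theta> P (mask P a) (mask P b)"
      using P by (simp add: gsum_mask good_coefs_def)
    moreover have "\<forall>p. mask P a p \<in> \<rat> \<and> mask P b p \<in> \<rat>" using P(1) by (auto simp: good_coefs_def)
    ultimately show ?thesis
      unfolding group_A_eq using P(1) unfolding good_coefs_def by blast
  qed (simp add: group_A_closed)
qed

context nested_tables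
begin

definition entry_of :: "nat \<Rightarrow> (seq \<times> seq \<Rightarrow> nat) \<Rightarrow> (seq \<times> seq \<Rightarrow> nat) \<Rightarrow> seq \<times> seq \<Rightarrow> entry" where
  "entry_of j A B p = (cell (fst p) (N j), cell (snd p) (N j), A p, B p)"

lemma eventually_cells_differ:
  assumes "p \<noteq> p'"
  shows "eventually (\<lambda>j. (cell (fst p) (N j), cell (snd p) (N j)) \<noteq> (cell (fst p') (N j), cell (snd p') (N j))) sequentially"
proof -
  obtain k where k: "fst p k \<noteq> fst p' k \<or> snd p k \<noteq> snd p' k"
    using assms by (auto simp: prod_eq_iff fun_eq_iff)
  show ?thesis
    unfolding eventually_sequentially
  proof (intro exI allI impI)
    fix j assume "Suc k \<le> j"
    then have "k < N j" using N_ge[of j] by simp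
    then show "(cell (fst p) (N j), cell (snd p) (N j)) \<noteq> (cell (fst p') (N j), cell (snd p') (N j))"
      using k by (auto dest: cell_eq_nth)
  qed
qed

lemma eventually_nonvanishing:
  assumes "a - b * xi p \<noteq> 0" "\<And>j. coef_a (e j) = a" "\<And>j. coef_b (e j) = b" "\<And>j. fst (e j) = cell (fst p) (N j)"
  shows "eventually (\<lambda>j. nonvanishing (N j) (e j)) sequentially"
proof -
  obtain M where "(1/2) ^ M < \<bar>a - b * xi p\<bar> / (\<bar>b\<bar> + 1)"
    using real_arch_pow_inv[of "\<bar>a - b * xi p\<bar> / (\<bar>b\<bar> + 1)" "1/2"] assms(1) by (auto simp: divide_pos_pos)
  then have M: "(\<bar>b\<bar> + 1) * (1/2) ^ M < \<bar>a - b * xi p\<bar>" by (simp add: field_simps)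
  show ?thesis
    unfolding eventually_sequentially
  proof (intro exI allI impI)
    fix j assume "M \<le> j"
    then have "(1/2 :: real) ^ N j \<le> (1/2) ^ M" using N_ge[of j] by (intro power_decreasing) auto
    then have "\<bar>b\<bar> * (1/2) ^ N j \<le> (\<bar>b\<bar> + 1) * (1/2) ^ M" by (intro mult_mono) auto
    with M have small: "\<bar>b\<bar> * (1 / 2 ^ N j) < \<bar>a - b * xi p\<bar>" by (simp add: power_one_over)
    let ?s = "cell (fst p) (N j)"
    have close: "\<bar>(a - b * (1 + s)) - (a - b * xi p)\<bar> < \<bar>a - b * xi p\<bar>"
      if "\<bar>seq_real (fst p) - s\<bar> \<le> 1 / 2 ^ N j" for s
    proof -
      have "(a - b * (1 + s)) - (a - b * xi p) = b * (seq_real (fst p) - s)" by (simp add: xi_def algebra_simps)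
      then have "\<bar>(a - b * (1 + s)) - (a - b * xi p)\<bar> \<le> \<bar>b\<bar> * (1 / 2 ^ N j)"
        using that by (simp only: abs_mult) (intro mult_left_mono, simp_all)
      with small show ?thesis by linarith
    qed
    have 1: "\<bar>(a - b * (1 + real ?s * (1 / 2 ^ N j))) - (a - b * xi p)\<bar> < \<bar>a - b * xi p\<bar>"
      by (rule close[OF cell_close])
    have 2: "\<bar>(a - b * (1 + real (Suc ?s) * (1 / 2 ^ N j))) - (a - b * xi p)\<bar> < \<bar>a - b * xi p\<bar>"
      using seq_real_bounds[of "fst p" "N j"] by (intro close) (simp add: add_divide_distrib abs_le_iff)
    show "nonvanishing (N j) (e j)"
      unfolding nonvanishing_def assms(2-4)
    proof (cases "a - b * xi p > 0")
      case True
      then show "0 < (a - b * (1 + real ?s * (1 / 2 ^ N j))) * (a - b * (1 + real (Suc ?s) * (1 / 2 ^ N j)))"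
        using 1 2 by (intro mult_pos_pos) linarith+
    next
      case False
      then show "0 < (a - b * (1 + real ?s * (1 / 2 ^ N j))) * (a - b * (1 + real (Suc ?s) * (1 / 2 ^ N j)))"
        using 1 2 by (intro mult_neg_neg) linarith+
    qed
  qed
qed

lemma coef_codesI: "c < j \<Longrightarrow> c \<in> set (coef_codes j)"
proof -
  assume c: "c < j"
  obtain z d where zd: "prod_decode c = (z, d)" by fastforce
  then have code: "c = prod_encode (z, d)" by (metis prod_decode_inverse)
  then have "z < j" "d < j" using c le_prod_encode_1[of z d] le_prod_encode_2[of d z] by linarith+
  then show ?thesis
    unfolding coef_codes_def code by (auto simp: image_iff simp del: upt_Suc intro!: bexI[of _ z])
qed

lemma sum_value_gsum:
  assumes "distinct ps"
  shows "sum_value (map (entry_of j A B) ps) ps = gsum N theta (set ps) (\<lambda>p. rat_decode (A p)) (\<lambda>p. rat_decode (B p))"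
  using assms
  by (induction ps) (simp_all add: gsum_def term_value_def entry_of_def coef_a_def coef_b_def)

text \<open>
  At all sufficiently fine levels the cells of distinct parameters are distinct, the coefficients are
  nonzero on whole cells, and the codes of the coefficients are among those treated by the stage.
\<close>

lemma rep_entries:
  assumes "good_coefs P a b"
  shows "\<exists>ps A B. distinct ps \<and> set ps = P \<and> (\<forall>p\<in>P. rat_decode (A p) = a p \<and> rat_decode (B p) = b p) \<and>
    eventually (\<lambda>j. admissible_entries (N j) (map (entry_of j A B) ps) \<and>
       (\<forall>p\<in>P. A p \<in> set (coef_codes (Suc j)) \<and> B p \<in> set (coef_codes (Suc j)))) sequentially"
proof -
  have P: "finite P" "P \<noteq> {}" "\<forall>p\<in>P. a p \<in> \<rat> \<and> b p \<in> \<rat> \<and> a p - b p * xi p \<noteq> 0"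
    using assms by (auto simp: good_coefs_def)
  obtain ps where ps: "set ps = P" "distinct ps" using finite_distinct_list[OF P(1)] by blast
  have "\<forall>p\<in>P. \<exists>c. rat_decode c = a p" "\<forall>p\<in>P. \<exists>c. rat_decode c = b p"
    using P(3) rat_decode_surj by metis+
  then obtain A B where AB: "\<forall>p\<in>P. rat_decode (A p) = a p" "\<forall>p\<in>P. rat_decode (B p) = b p"
    by (metis bchoice)
  have "eventually (\<lambda>j. \<forall>p\<in>P. \<forall>p'\<in>P. p \<noteq> p' \<longrightarrow>
      (cell (fst p) (N j), cell (snd p) (N j)) \<noteq> (cell (fst p') (N j), cell (snd p') (N j))) sequentially"
    by (intro eventually_ball_finite P ballI) (use eventually_cells_differ in \<open>auto simp: eventually_const_iff\<close>)
  moreover have "eventually (\<lambda>j. \<forall>p\<in>P. nonvanishing (N j) (entry_of j A B p)) sequentially"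
    by (intro eventually_ball_finite P ballI eventually_nonvanishing[of "a _" "b _"])
       (use P AB in \<open>auto simp: entry_of_def coef_a_def coef_b_def\<close>)
  moreover have "eventually (\<lambda>j. \<forall>p\<in>P. A p \<le> j \<and> B p \<le> j) sequentially"
    by (intro eventually_ball_finite P ballI eventually_conj eventually_ge_at_top)
  ultimately have "eventually (\<lambda>j. admissible_entries (N j) (map (entry_of j A B) ps) \<and>
       (\<forall>p\<in>P. A p \<in> set (coef_codes (Suc j)) \<and> B p \<in> set (coef_codes (Suc j)))) sequentially"
  proof eventually_elim
    case (elim j)
    have "inj_on (\<lambda>p. (cell (fst p) (N j), cell (snd p) (N j))) P"
      using elim(1) by (auto intro: inj_onI)
    then have "distinct (map entry_cell (map (entry_of j A B) ps))"
      using ps by (simp add: distinct_map comp_inj_on_iff o_def entry_of_def)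
    then show ?case
      using elim P(2) ps by (auto simp: admissible_entries_def cell_less entry_of_def intro!: coef_codesI)
  qed
  moreover have "\<forall>p\<in>P. rat_decode (A p) = a p \<and> rat_decode (B p) = b p" using AB by blast
  ultimately show ?thesis using ps by blast
qed

lemma in_cells_entry_of: "list_all2 (in_cells (N j)) (map (entry_of j A B) ps) ps"
  by (simp add: list_all2_conv_all_nth in_cells_def entry_of_def)

lemma good_coefs_of_entries:
  assumes adm: "admissible_entries (N j) C" and cells: "list_all2 (in_cells (N j)) C ps"
  shows "\<exists>a b. good_coefs (set ps) a b \<and> sum_value C ps = gsum N theta (set ps) a b"
proof -
  have len: "length C = length ps" using cells by (rule list_all2_lengthD)
  have cell: "fst (C ! i) = cell (fst (ps ! i)) (N j)" "fst (snd (C ! i)) = cell (snd (ps ! i)) (N j)"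
    if "i < length ps" for i
    using cells that by (auto simp: list_all2_conv_all_nth in_cells_def)
  have dist: "distinct ps"
  proof -
    have "map entry_cell C = map (\<lambda>p. (cell (fst p) (N j), cell (snd p) (N j))) ps"
      using len cell by (intro nth_equalityI) auto
    then have "distinct (map (\<lambda>p. (cell (fst p) (N j), cell (snd p) (N j))) ps)"
      using adm by (simp add: admissible_entries_def)
    then show ?thesis by (simp add: distinct_map)
  qed
  define E where "E p = the (map_of (zip ps C) p)" for p
  have E: "E (ps ! i) = C ! i" if "i < length ps" for i
    using map_of_zip_nth[OF len[symmetric] dist, of i] that len by (simp add: E_def)
  have "good_coefs (set ps) (\<lambda>p. coef_a (E p)) (\<lambda>p. coef_b (E p))"
    unfolding good_coefs_def
  proof (intro conjI ballI)
    show "set ps \<noteq> {}" using adm len by (auto simp: admissible_entries_def)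
    fix p assume "p \<in> set ps"
    then obtain i where i: "i < length ps" "p = ps ! i" by (auto simp: in_set_conv_nth)
    show "coef_a (E p) \<in> \<rat>" "coef_b (E p) \<in> \<rat>" by (simp_all add: coef_a_def coef_b_def rat_decode_in_Rats)
    have "nonvanishing (N j) (C ! i)" using adm i(1) len by (simp add: admissible_entries_def)
    then obtain \<delta> where "\<delta> > 0" "\<And>x. real (fst (C ! i)) * (1 / 2 ^ N j) \<le> x \<Longrightarrow>
        x \<le> real (Suc (fst (C ! i))) * (1 / 2 ^ N j) \<Longrightarrow> \<delta> \<le> \<bar>coef_a (C ! i) - coef_b (C ! i) * (1 + x)\<bar>"
      using linear_away_from_0 unfolding nonvanishing_def by blast
    moreover have "real (fst (C ! i)) * (1 / 2 ^ N j) \<le> seq_real (fst p)"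
      "seq_real (fst p) \<le> real (Suc (fst (C ! i))) * (1 / 2 ^ N j)"
      using seq_real_bounds[of "fst p" "N j"] cell(1)[OF i(1)] by (simp_all add: i(2) add_ac)
    ultimately show "coef_a (E p) - coef_b (E p) * xi p \<noteq> 0"
      unfolding xi_def i(2) E[OF i(1)] by fastforce
  qed simp
  moreover have "sum_value C ps = gsum N theta (set ps) (\<lambda>p. coef_a (E p)) (\<lambda>p. coef_b (E p))"
  proof -
    have "sum_value C ps = (\<Sum>i<length ps. term_value (C ! i) (ps ! i))"
      unfolding sum_value_def using len by (simp add: sum_list_sum_nth atLeast0LessThan)
    also have "\<dots> = (\<Sum>i<length ps. term_value (E (ps ! i)) (ps ! i))"
      using E by simp
    also have "\<dots> = (\<Sum>p\<in>set ps. term_value (E p) p)"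
      by (rule sum.reindex_bij_betw) (use bij_betw_nth[OF dist, of "{..<length ps}" "set ps"] in \<open>simp add: lessThan_def\<close>)
    finally show ?thesis by (simp add: gsum_def term_value_def)
  qed
  ultimately show ?thesis by blast
qed

lemma F_set_cell_sums:
  "x \<in> F_set N theta \<longleftrightarrow> (\<exists>j C. admissible_entries (N j) C \<and> x \<in> cell_sums j C None)"
proof
  assume "x \<in> F_set N theta"
  then obtain P a b where P: "good_coefs P a b" "x = gsum N theta P a b" unfolding F_set_iff by blast
  obtain ps A B where ps: "distinct ps" "set ps = P" "\<forall>p\<in>P. rat_decode (A p) = a p \<and> rat_decode (B p) = b p"
    and ev: "eventually (\<lambda>j. admissible_entries (N j) (map (entry_of j A B) ps) \<and>
       (\<forall>p\<in>P. A p \<in> set (coef_codes (Suc j)) \<and> B p \<in> set (coef_codes (Suc j)))) sequentially"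
    using rep_entries[OF P(1)] by blast
  obtain j where j: "admissible_entries (N j) (map (entry_of j A B) ps)"
    using eventually_happens'[OF _ ev] by auto
  have "sum_value (map (entry_of j A B) ps) ps = x"
    unfolding sum_value_gsum[OF ps(1)] P(2) ps(2) gsum_def using ps(3) by simp
  then have "x \<in> cell_sums j (map (entry_of j A B) ps) None"
    using in_cells_entry_of by (auto simp: cell_sums_def constraint_def)
  with j show "\<exists>j C. admissible_entries (N j) C \<and> x \<in> cell_sums j C None" by blast
next
  assume "\<exists>j C. admissible_entries (N j) C \<and> x \<in> cell_sums j C None"
  then show "x \<in> F_set N theta"
    unfolding F_set_iff cell_sums_def using good_coefs_of_entries by blast
qed

lemma F_rat_cell_sums:
  "x \<in> F_rat N theta \<longleftrightarrow>
     (\<exists>j C i c. admissible_entries (N j) C \<and> x \<in> cell_sums j C (Some (i, rat_decode c)))"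
proof
  assume "x \<in> F_rat N theta"
  then obtain P a b q where P: "good_coefs P a b" "x = gsum N theta P a b" "q \<in> P" "xi q \<in> \<rat>"
    unfolding F_rat_iff by blast
  obtain ps A B where ps: "distinct ps" "set ps = P" "\<forall>p\<in>P. rat_decode (A p) = a p \<and> rat_decode (B p) = b p"
    and ev: "eventually (\<lambda>j. admissible_entries (N j) (map (entry_of j A B) ps) \<and>
       (\<forall>p\<in>P. A p \<in> set (coef_codes (Suc j)) \<and> B p \<in> set (coef_codes (Suc j)))) sequentially"
    using rep_entries[OF P(1)] by blast
  obtain j where j: "admissible_entries (N j) (map (entry_of j A B) ps)"
    using eventually_happens'[OF _ ev] by auto
  obtain c where c: "rat_decode c = xi q" using rat_decode_surj[OF P(4)] .
  obtain i where i: "i < length ps" "ps ! i = q" using P(3) ps(2) by (auto simp: in_set_conv_nth)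
  have "sum_value (map (entry_of j A B) ps) ps = x"
    unfolding sum_value_gsum[OF ps(1)] P(2) ps(2) gsum_def using ps(3) by simp
  then have "x \<in> cell_sums j (map (entry_of j A B) ps) (Some (i, rat_decode c))"
    using in_cells_entry_of i c by (auto simp: cell_sums_def constraint_def)
  with j show "\<exists>j C i c. admissible_entries (N j) C \<and> x \<in> cell_sums j C (Some (i, rat_decode c))" by blast
next
  assume "\<exists>j C i c. admissible_entries (N j) C \<and> x \<in> cell_sums j C (Some (i, rat_decode c))"
  then obtain j C i c ps where C: "admissible_entries (N j) C" "list_all2 (in_cells (N j)) C ps"
    "i < length ps" "xi (ps ! i) = rat_decode c" "x = sum_value C ps"
    by (auto simp: cell_sums_def constraint_def)
  obtain a b where "good_coefs (set ps) a b" "sum_value C ps = gsum N theta (set ps) a b"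
    using good_coefs_of_entries[OF C(1,2)] by blast
  moreover have "ps ! i \<in> set ps" "xi (ps ! i) \<in> \<rat>" using C rat_decode_in_Rats by auto
  ultimately show "x \<in> F_rat N theta" unfolding F_rat_iff C(5) by blast
qed

end

section \<open>The stage requirement\<close>

locale certified_tables = nested_tables +
  fixes q :: "nat \<Rightarrow> real"
  assumes q_enum: "q ` {1..} = \<rat> - {0}"
    and cert: "\<And>j. \<exists>L. \<forall>C\<in>set (lists_upto (all_entries (Suc j) (N j)) (2 ^ N j * 2 ^ N j)).
         admissible_entries (N j) C \<longrightarrow>
         (\<forall>D. refines (N (Suc j) - N j) D C \<longrightarrow> certified q (Suc j) (N (Suc j)) (T (Suc j)) L D)"
begin

text \<open>
  Distinct cells bound the length of the list, so \<open>lists_upto\<close> covers every constraint.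
\<close>

lemma admissible_certified:
  assumes "admissible_entries (N j) C"
    and "\<forall>e\<in>set C. fst (snd (snd e)) \<in> set (coef_codes (Suc j)) \<and> snd (snd (snd e)) \<in> set (coef_codes (Suc j))"
    and "refines (N (Suc j) - N j) D C"
  shows "\<exists>L. certified q (Suc j) (N (Suc j)) (T (Suc j)) L D"
proof -
  have "length C = card (set (map entry_cell C))"
    using assms(1) by (metis admissible_entries_def distinct_card length_map)
  also have "\<dots> \<le> card ({..<2 ^ N j :: nat} \<times> {..<2 ^ N j :: nat})"
    by (rule card_mono) (use assms(1) in \<open>auto simp: admissible_entries_def\<close>)
  finally have "length C \<le> 2 ^ N j * 2 ^ N j" by (simp add: card_cartesian_product)
  moreover have "set C \<subseteq> set (all_entries (Suc j) (N j))"
  proof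
    fix e assume "e \<in> set C"
    moreover obtain s t a b where "e = (s, t, a, b)" by (metis surj_pair)
    ultimately show "e \<in> set (all_entries (Suc j) (N j))"
      using assms(1,2) by (auto simp: set_all_entries admissible_entries_def)
  qed
  ultimately have "C \<in> set (lists_upto (all_entries (Suc j) (N j)) (2 ^ N j * 2 ^ N j))"
    by (rule lists_uptoI)
  then show ?thesis using cert[of j] assms by blast
qed

lemma certified_in_G:
  assumes "certified q J n U L D" "\<bar>x - center n U D\<bar> \<le> weight D / 2 ^ n"
  shows "x \<in> G_set q J"
  unfolding G_set_def
proof
  fix k assume "k \<in> {1..J}"
  then have "k \<in> set [1..<Suc J]" by auto
  then obtain l where l: "l \<in> set [1..<Suc L]" "\<bar>center n U D - q l\<bar> + weight D * (1 / 2 ^ n) < radius q k l"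
    using assms(1) unfolding certified_def by blast
  then have "\<bar>x - q l\<bar> < radius q k l" using assms(2) by simp
  then have "x \<in> {q l - radius q k l <..< q l + radius q k l}" by auto
  then show "x \<in> O_set q k" unfolding O_set_def using l(1) by auto
qed

text \<open>
  A representation is treated by all late stages; those beyond \<open>k\<close> put the sum into \<open>G_set q k\<close>.
\<close>

lemma F_set_in_G:
  assumes "x \<in> F_set N theta" shows "x \<in> G_set q k"
proof -
  obtain P a b where P: "good_coefs P a b" "x = gsum N theta P a b" using assms unfolding F_set_iff by blast
  obtain ps A B where ps: "distinct ps" "set ps = P" "\<forall>p\<in>P. rat_decode (A p) = a p \<and> rat_decode (B p) = b p"
    and ev: "eventually (\<lambda>j. admissible_entries (N j) (map (entry_of j A B) ps) \<and>
       (\<forall>p\<in>P. A p \<in> set (coef_codes (Suc j)) \<and> B p \<in> set (coef_codes (Suc j)))) sequentially"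
    using rep_entries[OF P(1)] by blast
  obtain j where j: "k \<le> j" "admissible_entries (N j) (map (entry_of j A B) ps)"
     "\<forall>p\<in>P. A p \<in> set (coef_codes (Suc j)) \<and> B p \<in> set (coef_codes (Suc j))"
    using eventually_happens'[OF _ eventually_conj[OF eventually_ge_at_top[of k] ev]] by auto
  let ?C = "map (entry_of j A B) ps"
  note D = at_level_props[OF in_cells_entry_of, of j "Suc j" A B ps]
  obtain L where "certified q (Suc j) (N (Suc j)) (T (Suc j)) L (at_level (Suc j) ?C ps)"
    using admissible_certified[OF j(2) _ D(2)] j(3) ps(2) by (auto simp: entry_of_def)
  moreover have "sum_value ?C ps = x"
    unfolding sum_value_gsum[OF ps(1)] P(2) ps(2) gsum_def using ps(3) by simp
  moreover have "\<bar>sum_value (at_level (Suc j) ?C ps) ps - center (N (Suc j)) (T (Suc j)) (at_level (Suc j) ?C ps)\<bar>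
      \<le> weight (at_level (Suc j) ?C ps) / 2 ^ N (Suc j)"
    by (rule sum_value_approx) (rule D(1), simp)
  ultimately have "x \<in> G_set q (Suc j)"
    using certified_in_G D(3) by simp
  moreover have "G_set q (Suc j) \<subseteq> G_set q k" using j(1) by (auto simp: G_set_def)
  ultimately show ?thesis by blast
qed

lemma F_set_in_O: "x \<in> F_set N theta \<Longrightarrow> 1 \<le> k \<Longrightarrow> x \<in> O_set q k"
  using F_set_in_G[of x k] by (auto simp: G_set_def)

text \<open>
  The radius of an interval of \<open>O_set q 1\<close> is at most half the absolute value of its centre.
\<close>

lemma zero_notin_F: "0 \<notin> F_set N theta"
proof
  assume "0 \<in> F_set N theta"
  then have "0 \<in> O_set q 1" by (rule F_set_in_O) simp
  then obtain l where "l \<ge> 1" "\<bar>q l\<bar> < radius q 1 l" by (auto simp: O_set_def)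
  then show False by (auto simp: radius_def)
qed

lemma nonvanishing_of_INF:
  assumes pos: "(INF \<xi>\<in>(\<lambda>x. 1 + x) ` dyadic \<sigma>. \<bar>coef_a e - coef_b e * \<xi>\<bar>) > 0"
    and s: "fst e = str_nat \<sigma>" and n: "length \<sigma> = n"
  shows "nonvanishing n e"
proof -
  let ?x0 = "real (fst e) * (1 / 2 ^ n)" and ?x1 = "real (Suc (fst e)) * (1 / 2 ^ n)"
  have dy: "dyadic \<sigma> = {?x0..?x1}"
    by (simp add: dyadic_def str_real_str_nat s n add_divide_distrib)
  have nz: "coef_a e - coef_b e * (1 + x) \<noteq> 0" if "?x0 \<le> x" "x \<le> ?x1" for x
  proof
    assume 0: "coef_a e - coef_b e * (1 + x) = 0"
    have "(INF \<xi>\<in>(\<lambda>x. 1 + x) ` dyadic \<sigma>. \<bar>coef_a e - coef_b e * \<xi>\<bar>) \<le> \<bar>coef_a e - coef_b e * (1 + x)\<bar>"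
      by (rule cINF_lower) (use that in \<open>auto simp: dy intro!: bdd_belowI[of _ 0]\<close>)
    with pos 0 show False by simp
  qed
  show ?thesis
    unfolding nonvanishing_def
  proof (rule ccontr)
    let ?f = "\<lambda>x. coef_a e - coef_b e * (1 + x)"
    have le: "?x0 \<le> ?x1" by (simp add: field_simps)
    have cont: "continuous_on {?x0..?x1} ?f" by (intro continuous_intros)
    assume "\<not> 0 < ?f ?x0 * ?f ?x1"
    then have "?f ?x0 \<le> 0 \<and> 0 \<le> ?f ?x1 \<or> ?f ?x1 \<le> 0 \<and> 0 \<le> ?f ?x0"
      by (auto simp: zero_less_mult_iff not_less)
    then obtain x where "?x0 \<le> x" "x \<le> ?x1" "?f x = 0"
      using IVT'[of ?f ?x0 0 ?x1, OF _ _ le cont] IVT2'[of ?f ?x1 0 ?x0, OF _ _ le cont] by blast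
    with nz show False by blast
  qed
qed

lemma Q_set_code: "x \<in> Q_set j \<Longrightarrow> \<exists>c\<in>set (coef_codes j). rat_decode c = x"
proof -
  assume "x \<in> Q_set j"
  then obtain k d where kd: "x = real_of_int k / real d" "\<bar>k\<bar> \<le> int j" "1 \<le> d" "d \<le> j"
    by (auto simp: Q_set_def)
  have "int_encode k < 2 * j + 2"
    using kd(2) by (auto simp: int_encode_def sum_encode_def)
  moreover have "d - 1 < j" using kd(3,4) by linarith
  ultimately have "prod_encode (int_encode k, d - 1) \<in> set (coef_codes j)"
    unfolding coef_codes_def by (auto simp: image_iff simp del: upt_Suc)
  moreover have "rat_decode (prod_encode (int_encode k, d - 1)) = x"
    using kd(1,3) by (simp add: rat_decode_def)
  ultimately show ?thesis by blast
qed

lemma finite_strings: "finite (strings n)"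
  using finite_lists_length_eq[of "UNIV :: bool set" n] by (simp add: strings_def)

text \<open>
  The families indexed by all pairs of strings are restricted to the pairs with nonzero coefficients; these
  form a constraint that the stage has treated.
\<close>

lemma stage_requirement_Suc: "stage_requirement q N theta (Suc i)"
  unfolding stage_requirement_def Let_def diff_Suc_1
proof (intro allI impI, elim conjE)
  let ?I = "strings (N i) \<times> strings (N i)" and ?M = "N (Suc i)"
  fix a b :: "str \<times> str \<Rightarrow> real" and \<gamma> \<alpha> :: "str \<times> str \<Rightarrow> seq" and u :: "str \<times> str \<Rightarrow> real"
  assume ab: "\<forall>c\<in>?I. a c \<in> Q_set (Suc i) \<and> b c \<in> Q_set (Suc i)"
    and ne: "\<exists>c\<in>?I. (a c, b c) \<noteq> (0, 0)"
    and pos: "\<forall>c\<in>?I. (a c, b c) \<noteq> (0, 0) \<longrightarrow> 0 < (INF \<xi>\<in>(+) 1 ` dyadic (fst c). \<bar>a c - b c * \<xi>\<bar>)"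
    and pts: "\<forall>c\<in>?I. \<gamma> c \<in> cylinder (fst c) \<and> \<alpha> c \<in> cylinder (snd c) \<and>
        u c \<in> dyadic (theta (Suc i) (initial (\<gamma> c) ?M) (initial (\<alpha> c) ?M))"
  define S where "S = {c\<in>?I. (a c, b c) \<noteq> (0, 0)}"
  have finI: "finite ?I" by (intro finite_cartesian_product finite_strings)
  obtain xs where xs: "set xs = S" "distinct xs"
    using finite_distinct_list[of S] finI by (auto simp: S_def)
  have "\<forall>c\<in>?I. \<exists>k. k \<in> set (coef_codes (Suc i)) \<and> rat_decode k = a c"
    "\<forall>c\<in>?I. \<exists>k. k \<in> set (coef_codes (Suc i)) \<and> rat_decode k = b c"
    using ab Q_set_code by blast+
  then obtain A B where A: "\<forall>c\<in>?I. A c \<in> set (coef_codes (Suc i)) \<and> rat_decode (A c) = a c"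
    and B: "\<forall>c\<in>?I. B c \<in> set (coef_codes (Suc i)) \<and> rat_decode (B c) = b c"
    by (metis (no_types, lifting) bchoice)
  have A': "A c \<in> set (coef_codes (Suc i))" "rat_decode (A c) = a c"
    and B': "B c \<in> set (coef_codes (Suc i))" "rat_decode (B c) = b c"
    and pos': "(a c, b c) \<noteq> (0, 0) \<Longrightarrow> 0 < (INF \<xi>\<in>(+) 1 ` dyadic (fst c). \<bar>a c - b c * \<xi>\<bar>)"
    and pts': "\<gamma> c \<in> cylinder (fst c)" "\<alpha> c \<in> cylinder (snd c)" if "c \<in> ?I" for c
    using A B pos pts that by blast+
  define e where "e c = (str_nat (fst c), str_nat (snd c), A c, B c)" for c
  define d where "d c = (cell (\<gamma> c) ?M, cell (\<alpha> c) ?M, A c, B c)" for c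
  have len: "length (fst c) = N i" "length (snd c) = N i" if "c \<in> ?I" for c
    using that by (auto simp: strings_def)
  have xsI: "c \<in> ?I" if "c \<in> set xs" for c using that by (auto simp: xs S_def)
  have adm: "admissible_entries (N i) (map e xs)"
    unfolding admissible_entries_def
  proof (intro conjI)
    show "map e xs \<noteq> []" using ne xs(1) by (auto simp: S_def)
    have "inj_on (\<lambda>c. entry_cell (e c)) (set xs)"
    proof (rule inj_onI)
      fix c c' assume c: "c \<in> set xs" "c' \<in> set xs" "entry_cell (e c) = entry_cell (e c')"
      then have "fst c = fst c'" "snd c = snd c'"
        using len[OF xsI[OF c(1)]] len[OF xsI[OF c(2)]] by (auto simp: e_def intro: str_nat_inject)
      then show "c = c'" by (rule prod_eqI)
    qed
    then show "distinct (map entry_cell (map e xs))"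
      using xs(2) by (simp add: distinct_map o_def comp_inj_on_iff[symmetric] inj_on_def)
    show "\<forall>f\<in>set (map e xs). fst f < 2 ^ N i \<and> fst (snd f) < 2 ^ N i \<and> nonvanishing (N i) f"
    proof
      fix f assume "f \<in> set (map e xs)"
      then obtain c where c: "c \<in> set xs" "f = e c" by auto
      have cI: "c \<in> ?I" by (rule xsI[OF c(1)])
      have "nonvanishing (N i) (e c)"
      proof (rule nonvanishing_of_INF)
        have "(a c, b c) \<noteq> (0, 0)" using c(1) xs(1) by (simp add: S_def)
        then show "0 < (INF \<xi>\<in>(+) 1 ` dyadic (fst c). \<bar>coef_a (e c) - coef_b (e c) * \<xi>\<bar>)"
          using pos'[OF cI] A'[OF cI] B'[OF cI] by (simp add: coef_a_def coef_b_def e_def)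
      qed (simp_all add: e_def len cI)
      then show "fst f < 2 ^ N i \<and> fst (snd f) < 2 ^ N i \<and> nonvanishing (N i) f"
        using str_nat_less[of "fst c"] str_nat_less[of "snd c"] len[OF cI] by (simp add: c(2) e_def)
    qed
  qed
  have "refines (?M - N i) (map d xs) (map e xs)"
    unfolding refines_def list_all2_map1 list_all2_map2
  proof (rule list.rel_refl_strong)
    fix c assume "c \<in> set xs"
    then have cI: "c \<in> ?I" by (rule xsI)
    then have "cell (\<gamma> c) (N i) = str_nat (fst c)" "cell (\<alpha> c) (N i) = str_nat (snd c)"
      using pts'[OF cI] len[OF cI] by (auto simp: cylinder_cell)
    then show "refines_entry (?M - N i) (d c) (e c)"
      using N_less[of i] by (simp add: refines_entry_def d_def e_def cell_div)
  qed
  moreover have "\<forall>f\<in>set (map e xs). fst (snd (snd f)) \<in> set (coef_codes (Suc i)) \<and>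
      snd (snd (snd f)) \<in> set (coef_codes (Suc i))"
    using A'(1)[OF xsI] B'(1)[OF xsI] by (auto simp: e_def)
  ultimately obtain L where L: "certified q (Suc i) ?M (T (Suc i)) L (map d xs)"
    using admissible_certified[OF adm] by blast
  let ?t = "\<lambda>c. (a c - b c * (1 + seq_real (\<gamma> c))) * u c + b c * seq_real (\<alpha> c)"
  have "\<bar>(\<Sum>c\<leftarrow>ys. ?t c) - center ?M (T (Suc i)) (map d ys)\<bar> \<le> weight (map d ys) / 2 ^ ?M"
    if "set ys \<subseteq> set xs" for ys
    using that
  proof (induction ys)
    case (Cons c ys)
    then have cI: "c \<in> ?I" using xsI by simp
    let ?V = "T (Suc i) (cell (\<gamma> c) ?M) (cell (\<alpha> c) ?M)"
    have "u c \<in> dyadic (theta (Suc i) (initial (\<gamma> c) ?M) (initial (\<alpha> c) ?M))" using pts cI by blast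
    then have "u c \<in> {real ?V / 2 ^ (?M + 2)..(real ?V + 1) / 2 ^ (?M + 2)}"
      by (simp only: dyadic_def str_real_str_nat theta_def length_nat_str str_nat_nat_str[OF T_cell_less]
            cell_def[symmetric] add_divide_distrib)
    then have "\<bar>?t c - term_center ?M (T (Suc i)) (d c)\<bar> \<le> term_weight (d c) / 2 ^ ?M"
      using term_center_approx[OF T_bounded[of "Suc i"], where e = "d c" and x = "seq_real (\<gamma> c)"
          and y = "seq_real (\<alpha> c)" and u = "u c"] A'[OF cI] B'[OF cI]
      by (simp add: d_def cell_less seq_real_bounds coef_a_def coef_b_def)
    with Cons show ?case by (simp add: add_divide_distrib)
  qed simp
  from this[OF subset_refl] have "(\<Sum>c\<leftarrow>xs. ?t c) \<in> G_set q (Suc i)"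
    by (rule certified_in_G[OF L])
  moreover have "(\<Sum>c\<leftarrow>xs. ?t c) = (\<Sum>c\<in>?I. ?t c)"
  proof -
    have "(\<Sum>c\<leftarrow>xs. ?t c) = (\<Sum>c\<in>S. ?t c)"
      using xs by (simp add: sum_list_distinct_conv_sum_set)
    also have "\<dots> = (\<Sum>c\<in>?I. ?t c)"
      by (rule sum.mono_neutral_left) (use finI in \<open>auto simp: S_def\<close>)
    finally show ?thesis .
  qed
  ultimately show "(\<Sum>c\<in>?I. ?t c) \<in> G_set q (Suc i)" by simp
qed

lemma construction: "construction q N (\<lambda>j. N j + 2) theta"
  unfolding construction_def
proof (intro conjI allI impI ballI)
  show "strict_mono (\<lambda>j. N j + 2)" using N_strict_mono by (simp add: strict_mono_def)
  show "theta 0 [] [] = [False, True]"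
    by (simp add: theta_def N_0 T_0 numeral_2_eq_2)
  show "theta j \<sigma> \<tau> \<in> strings (N j + 2)" for j \<sigma> \<tau> by (simp add: strings_def theta_def del: nat_str.simps)
  fix j :: nat assume "1 \<le> j"
  then obtain i where j: "j = Suc i" by (cases j) auto
  show "stage_requirement q N theta j" unfolding j by (rule stage_requirement_Suc)
  fix \<sigma> \<tau> assume st: "\<sigma> \<in> strings (N j)" "\<tau> \<in> strings (N j)"
  let ?v = "T j (str_nat \<sigma>) (str_nat \<tau>)" and ?d = "N (Suc i) - N i"
  have len: "length \<sigma> = N (Suc i)" "length \<tau> = N (Suc i)" using st by (auto simp: strings_def j)
  have N: "N i \<le> N (Suc i)" using N_less[of i] by simp
  have "T i (str_nat (take (N i) \<sigma>)) (str_nat (take (N i) \<tau>)) = ?v div 2 ^ ?d"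
    using T_extends[of i] str_nat_less[of \<sigma>] str_nat_less[of \<tau>] N
    by (simp add: extends_def str_nat_take len j)
  then have "theta i (take (N i) \<sigma>) (take (N i) \<tau>) = take (N i + 2) (theta j \<sigma> \<tau>)"
    using take_nat_str[of "N i + 2" ?d ?v] N unfolding theta_def by (simp add: j del: nat_str.simps)
  then show "prefix (theta (j - 1) (take (N (j - 1)) \<sigma>) (take (N (j - 1)) \<tau>)) (theta j \<sigma> \<tau>)"
    by (simp add: j take_is_prefix)
qed (simp_all add: N_0 N_strict_mono)

end

section \<open>Effectiveness\<close>

locale computable_tables = certified_tables +
  fixes tab :: "nat \<Rightarrow> nat list"
  assumes computable_N: "computable N" and computable_tab: "computable tab"
    and T_tab: "\<And>j. T j = lookup (N j) (tab j)"
begin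

text \<open>
  The code 0 stands for the absence of a constraint.
\<close>

definition decode_constraint :: "nat \<Rightarrow> (nat \<times> real) option" where
  "decode_constraint v = (case v of 0 \<Rightarrow> None
     | Suc w \<Rightarrow> Some (fst (prod_decode w), rat_decode (snd (prod_decode w))))"

definition decode_entries :: "nat \<Rightarrow> entry list" where
  "decode_entries c = map (\<lambda>e. (fst (prod_decode e), fst (prod_decode (snd (prod_decode e))),
      prod_decode (snd (prod_decode (snd (prod_decode e)))))) (list_decode c)"

lemma decode_entries_surj: "\<exists>c. decode_entries c = C"
proof -
  have "decode_entries (list_encode (map (\<lambda>e. prod_encode (fst e, prod_encode (fst (snd e), prod_encode (snd (snd e))))) C)) = C"
    by (simp add: decode_entries_def o_def)
  then show ?thesis by blast
qed

text \<open>
  The interval with endpoint codes \<open>c\<close>, \<open>d\<close> misses all enclosures of level \<open>l\<close>.  Inadmissible lists enumerate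
  every interval, so that they contribute nothing to the union of the complements.
\<close>

definition off_sums :: "nat \<Rightarrow> nat \<Rightarrow> entry list \<Rightarrow> nat \<Rightarrow> nat \<Rightarrow> nat \<Rightarrow> bool" where
  "off_sums l j C v c d \<longleftrightarrow> \<not> admissible_entries (N j) C \<or>
     j \<le> l \<and> (\<forall>D\<in>set (refinements (N l - N j) C). near_constraint l (decode_constraint v) D \<longrightarrow>
        outside (center (N l) (T l) D - weight D * (1 / 2 ^ N l)) (center (N l) (T l) D + weight D * (1 / 2 ^ N l)) c d)"

lemma near_constraint_decode:
  "near_constraint l (decode_constraint v) D \<longleftrightarrow> v = 0 \<or>
     (case drop (fst (prod_decode (v - 1))) D of [] \<Rightarrow> False
      | e # es \<Rightarrow> \<bar>1 + real (fst e) * (1 / 2 ^ N l) - rat_decode (snd (prod_decode (v - 1)))\<bar> \<le> 1 / 2 ^ N l)"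
proof (cases v)
  case (Suc w)
  show ?thesis
  proof (cases "fst (prod_decode w) < length D")
    case True
    then show ?thesis
      by (simp add: near_constraint_def decode_constraint_def Suc Cons_nth_drop_Suc[symmetric])
  qed (simp add: near_constraint_def decode_constraint_def Suc)
qed (simp add: near_constraint_def decode_constraint_def)

lemma computable_level_at [computable_intros]: "computable f \<Longrightarrow> computable (\<lambda>x. N (f x))"
  by (rule computable_compose[OF computable_N])

lemma computable_tab_at [computable_intros]: "computable f \<Longrightarrow> computable (\<lambda>x. tab (f x))"
  by (rule computable_compose[OF computable_tab])

lemma computable_off_sums:
  assumes "computable l" "computable j" "computable C" "computable v" "computable c" "computable d"
  shows "computable (\<lambda>x. off_sums (l x) (j x) (C x) (v x) (c x) (d x))"
proof -
  note pair_compose = computable_compose[of "\<lambda>p. F (fst p) (snd p)" "\<lambda>x. (f x, g x)" for F f g, simplified]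
  have "computable (\<lambda>p::nat \<times> nat \<times> entry list \<times> nat \<times> nat \<times> nat.
      off_sums (fst p) (fst (snd p)) (fst (snd (snd p))) (fst (snd (snd (snd p))))
        (fst (snd (snd (snd (snd p))))) (snd (snd (snd (snd (snd p))))))"
    unfolding off_sums_def near_constraint_decode outside_def T_tab
    by (intro computable_intros rat_const_intros pair_compose[OF computable_admissible]
        pair_compose[OF computable_refinements])
  moreover have "computable (\<lambda>x. (l x, j x, C x, v x, c x, d x))" by (intro computable_intros assms)
  ultimately show ?thesis by (drule_tac computable_compose) auto
qed

text \<open>
  A point outside the compact set of sums is outside finitely many closed intervals at some level, hence
  has a rational neighbourhood that misses all of them.
\<close>

lemma off_sums_open:
  assumes adm: "admissible_entries (N j) C"
  shows "(\<exists>l c d. off_sums l j C v c d \<and> rat_decode c < x \<and> x < rat_decode d) \<longleftrightarrow>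
     x \<notin> cell_sums j C (decode_constraint v)"
proof
  assume "\<exists>l c d. off_sums l j C v c d \<and> rat_decode c < x \<and> x < rat_decode d"
  then obtain l c d where l: "off_sums l j C v c d" "rat_decode c < x" "x < rat_decode d" by blast
  then have "j \<le> l" and out: "\<And>D. refines (N l - N j) D C \<Longrightarrow> near_constraint l (decode_constraint v) D \<Longrightarrow>
      outside (center (N l) (T l) D - weight D * (1 / 2 ^ N l)) (center (N l) (T l) D + weight D * (1 / 2 ^ N l)) c d"
    using adm by (auto simp: off_sums_def set_refinements)
  have "\<not> near_sum j C (decode_constraint v) l x"
  proof
    assume "near_sum j C (decode_constraint v) l x"
    then obtain D where "refines (N l - N j) D C" "near_constraint l (decode_constraint v) D"
     "\<bar>x - center (N l) (T l) D\<bar> \<le> weight D * (1 / 2 ^ N l)" by (auto simp: near_sum_def)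
    with out[OF this(1,2)] l(2,3) show False unfolding outside_def by linarith
  qed
  then show "x \<notin> cell_sums j C (decode_constraint v)" using sums_near \<open>j \<le> l\<close> by blast
next
  assume x: "x \<notin> cell_sums j C (decode_constraint v)"
  have "cells_below (N j) C" using adm by (auto simp: admissible_entries_def cells_below_def)
  then obtain l where l: "j \<le> l" "\<not> near_sum j C (decode_constraint v) l x"
    using near_imp_sums x by blast
  define Ds where "Ds = {D\<in>set (refinements (N l - N j) C). near_constraint l (decode_constraint v) D}"
  define lo hi where "lo D = center (N l) (T l) D - weight D * (1 / 2 ^ N l)"
    and "hi D = center (N l) (T l) D + weight D * (1 / 2 ^ N l)" for D
  have "finite Ds" by (simp add: Ds_def)
  then have "open (\<Inter>D\<in>Ds. - {lo D..hi D})" by (intro open_INT) auto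
  moreover have "x \<in> (\<Inter>D\<in>Ds. - {lo D..hi D})"
  proof
    fix D assume "D \<in> Ds"
    then have "\<not> \<bar>x - center (N l) (T l) D\<bar> \<le> weight D * (1 / 2 ^ N l)"
      using l(2) by (auto simp: near_sum_def Ds_def set_refinements)
    then show "x \<in> - {lo D..hi D}" by (auto simp: lo_def hi_def)
  qed
  ultimately obtain e where e: "e > 0" "ball x e \<subseteq> (\<Inter>D\<in>Ds. - {lo D..hi D})"
    using openE by blast
  obtain c where c: "x - e < rat_decode c" "rat_decode c < x" by (rule rat_decode_between[of "x - e" x]) (use e in simp)
  obtain d where d: "x < rat_decode d" "rat_decode d < x + e" by (rule rat_decode_between[of x "x + e"]) (use e in simp)
  have "outside (lo D) (hi D) c d" if "D \<in> Ds" for D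
  proof (rule ccontr)
    assume "\<not> outside (lo D) (hi D) c d"
    then have *: "lo D < rat_decode d" "rat_decode c < hi D" by (auto simp: outside_def)
    have "lo D \<le> hi D" using weight_nonneg[of D] by (simp add: lo_def hi_def)
    then have "max (lo D) (min x (hi D)) \<in> ball x e" "max (lo D) (min x (hi D)) \<in> {lo D..hi D}"
      using * c d by (auto simp: dist_real_def max_def min_def)
    then show False using e(2) that by blast
  qed
  then have "off_sums l j C v c d"
    using l(1) by (auto simp: off_sums_def Ds_def lo_def hi_def)
  with c d show "\<exists>l c d. off_sums l j C v c d \<and> rat_decode c < x \<and> x < rat_decode d" by blast
qed

lemma rat_open_iff:
  "x \<in> rat_open P i \<longleftrightarrow> (\<exists>k c d. P k i c d \<and> rat_decode c < x \<and> x < rat_decode d)"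
  unfolding rat_open_def by (auto simp: split_paired_Ex)

lemma rat_open_off_sums:
  "rat_open (\<lambda>l i. off_sums l (J i) (C i) (V i)) i =
     (if admissible_entries (N (J i)) (C i) then - cell_sums (J i) (C i) (decode_constraint (V i)) else UNIV)"
proof (cases "admissible_entries (N (J i)) (C i)")
  case True
  have "x \<in> rat_open (\<lambda>l i. off_sums l (J i) (C i) (V i)) i \<longleftrightarrow>
      (\<exists>l c d. off_sums l (J i) (C i) (V i) c d \<and> rat_decode c < x \<and> x < rat_decode d)" for x
    by (rule rat_open_iff)
  then show ?thesis using off_sums_open[OF True] True by auto
next
  case False
  have "x \<in> rat_open (\<lambda>l i. off_sums l (J i) (C i) (V i)) i" for x
  proof -
    obtain c where "x - 1 < rat_decode c" "rat_decode c < x" by (rule rat_decode_between[of "x - 1" x]) simp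
    moreover obtain d where "x < rat_decode d" "rat_decode d < x + 1" by (rule rat_decode_between[of x "x + 1"]) simp
    ultimately show ?thesis unfolding rat_open_iff off_sums_def using False by blast
  qed
  with False show ?thesis by auto
qed

lemma Sigma2_F_set: "Sigma2_search (F_set N theta)"
proof -
  let ?P = "\<lambda>l i. off_sums l (fst (prod_decode i)) (decode_entries (snd (prod_decode i))) 0"
  have "computable4 ?P"
    by (rule computable4I) (intro computable_off_sums computable_intros, unfold decode_entries_def, intro computable_intros)
  moreover have "F_set N theta = (\<Union>i. - rat_open ?P i)"
  proof (intro set_eqI)
    fix x
    have "x \<in> (\<Union>i. - rat_open ?P i) \<longleftrightarrow> (\<exists>i. admissible_entries (N (fst (prod_decode i))) (decode_entries (snd (prod_decode i)))
        \<and> x \<in> cell_sums (fst (prod_decode i)) (decode_entries (snd (prod_decode i))) None)"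
      unfolding rat_open_off_sums by (auto simp: decode_constraint_def)
    also have "\<dots> \<longleftrightarrow> x \<in> F_set N theta"
      unfolding F_set_cell_sums
    proof
      assume "\<exists>j C. admissible_entries (N j) C \<and> x \<in> cell_sums j C None"
      then obtain j C where "admissible_entries (N j) C" "x \<in> cell_sums j C None" by blast
      moreover obtain c where "decode_entries c = C" using decode_entries_surj by blast
      ultimately show "\<exists>i. admissible_entries (N (fst (prod_decode i))) (decode_entries (snd (prod_decode i)))
        \<and> x \<in> cell_sums (fst (prod_decode i)) (decode_entries (snd (prod_decode i))) None"
        by (intro exI[of _ "prod_encode (j, c)"]) simp
    qed blast
    finally show "x \<in> F_set N theta \<longleftrightarrow> x \<in> (\<Union>i. - rat_open ?P i)" by simp
  qed
  ultimately show ?thesis unfolding Sigma2_search_def by blast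
qed

lemma Sigma2_F_rat: "Sigma2_search (F_rat N theta)"
proof -
  let ?j = "\<lambda>i. fst (prod_decode i)" and ?C = "\<lambda>i. decode_entries (fst (prod_decode (snd (prod_decode i))))"
    and ?w = "\<lambda>i. snd (prod_decode (snd (prod_decode i)))"
  let ?P = "\<lambda>l i. off_sums l (?j i) (?C i) (Suc (?w i))"
  have "computable4 ?P"
    by (rule computable4I) (intro computable_off_sums computable_intros, unfold decode_entries_def, intro computable_intros)
  moreover have "F_rat N theta = (\<Union>i. - rat_open ?P i)"
  proof (intro set_eqI)
    fix x
    have "x \<in> (\<Union>i. - rat_open ?P i) \<longleftrightarrow> (\<exists>i. admissible_entries (N (?j i)) (?C i)
        \<and> x \<in> cell_sums (?j i) (?C i) (Some (fst (prod_decode (?w i)), rat_decode (snd (prod_decode (?w i))))))"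
      unfolding rat_open_off_sums by (auto simp: decode_constraint_def)
    also have "\<dots> \<longleftrightarrow> x \<in> F_rat N theta"
      unfolding F_rat_cell_sums
    proof
      assume "\<exists>j C i c. admissible_entries (N j) C \<and> x \<in> cell_sums j C (Some (i, rat_decode c))"
      then obtain j C k e where "admissible_entries (N j) C" "x \<in> cell_sums j C (Some (k, rat_decode e))" by blast
      moreover obtain c where "decode_entries c = C" using decode_entries_surj by blast
      ultimately show "\<exists>i. admissible_entries (N (?j i)) (?C i)
        \<and> x \<in> cell_sums (?j i) (?C i) (Some (fst (prod_decode (?w i)), rat_decode (snd (prod_decode (?w i)))))"
        by (intro exI[of _ "prod_encode (j, prod_encode (c, prod_encode (k, e)))"]) simp
    qed blast
    finally show "x \<in> F_rat N theta \<longleftrightarrow> x \<in> (\<Union>i. - rat_open ?P i)" by simp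
  qed
  ultimately show ?thesis unfolding Sigma2_search_def by blast
qed

end

section \<open>Dimension, multipliers and Borel class\<close>

context certified_tables
begin

abbreviation A :: "real set" where "A \<equiv> group_A N theta"

lemma A_eq: "A = (F_set N theta \<union> {0}) - F_rat N theta"
  by (rule group_A_eq_F[OF zero_notin_F])

lemma gg_in_F_rat: "xi p \<in> \<rat> \<Longrightarrow> gg p \<in> F_rat N theta"
  unfolding F_rat_iff
  by (intro exI[of _ "{p}"] exI[of _ "\<lambda>_. 1"] exI[of _ "\<lambda>_. 0"]) (simp add: good_coefs_def gsum_def)

lemma gg_notin_A: "xi p \<in> \<rat> \<Longrightarrow> gg p \<notin> A"
  using gg_in_F_rat A_eq by blast

lemma rational_xi: "\<exists>p. xi p \<in> \<rat>"
proof -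
  obtain \<gamma> where "seq_real \<gamma> = 0" using seq_real_surj[of 0] by auto
  then show ?thesis by (intro exI[of _ "(\<gamma>, \<gamma>)"]) (simp add: xi_def)
qed

lemma exists_notin_A: "\<exists>z. z \<notin> A"
  using rational_xi gg_notin_A by blast

lemma integer_shift_of_multiplier: "\<exists>k \<gamma>. x = of_int k + (1 + seq_real \<gamma>)"
proof -
  obtain \<gamma> where "seq_real \<gamma> = x - of_int \<lfloor>x\<rfloor>"
    by (rule seq_real_surj[of "x - of_int \<lfloor>x\<rfloor>"]) linarith+
  then show ?thesis by (intro exI[of _ "\<lfloor>x\<rfloor> - 1"] exI[of _ \<gamma>]) simp
qed

text \<open>
  For irrational \<open>x\<close>, adding an integer \<open>k\<close> to the multiplier does not change the sets in question, so it may be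
  assumed to be of the form \<open>1 + \<gamma>\<close>; then \<open>\<beta> = h + (1 + \<gamma>) * g\<close>, and rational multiples of the numbers
  \<open>\<beta>\<close> exhaust the line.  For rational \<open>x\<close> the sums stay inside the group, which is proper.
\<close>

lemma X_set_A: "X_set A = UNIV - \<rat>"
proof (intro equalityI subsetI)
  fix x assume x: "x \<in> X_set A"
  show "x \<in> UNIV - \<rat>"
  proof
    show "x \<notin> \<rat>"
    proof
      assume "x \<in> \<rat>"
      then have "{a + x * b | a b. a \<in> A \<and> b \<in> A} \<subseteq> A" by (auto intro: group_A_closed)
      with x show False unfolding X_set_def using exists_notin_A by blast
    qed
  qed simp
next
  fix x :: real assume "x \<in> UNIV - \<rat>"
  then have irr: "x \<notin> \<rat>" by simp
  then obtain k \<gamma> where x: "x = of_int k + (1 + seq_real \<gamma>)" using integer_shift_of_multiplier by blast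
  have \<gamma>: "1 + seq_real \<gamma> \<notin> \<rat>" using irr unfolding x by auto
  have "y \<in> {a + x * b | a b. a \<in> A \<and> b \<in> A}" for y
  proof -
    define c where "c = (if y \<ge> 0 then real_of_int (\<lfloor>y\<rfloor> + 1) else real_of_int (\<lfloor>y\<rfloor> - 1))"
    have c: "c \<in> \<rat>" "c \<noteq> 0" "0 \<le> y / c" "y / c < 1"
      unfolding c_def by (auto simp: divide_simps) linarith+
    obtain \<beta> where \<beta>: "seq_real \<beta> = y / c" using seq_real_surj c(3,4) by blast
    let ?p = "(\<gamma>, \<beta>)"
    have g: "gg ?p \<in> A" and h: "hh ?p \<in> A" using \<gamma> by (auto intro!: group_A_gen simp: xi_def)
    have "y / c = hh ?p + (1 + seq_real \<gamma>) * gg ?p" by (simp add: gen_h_def xi_def \<beta>)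
    then have "y = c * hh ?p + (1 + seq_real \<gamma>) * (c * gg ?p)" using c(2) by (simp add: field_simps)
    also have "\<dots> = (c * hh ?p + (- of_int k) * (c * gg ?p)) + x * (c * gg ?p)" by (simp add: x algebra_simps)
    finally have "y = (c * hh ?p + (- of_int k) * (c * gg ?p)) + x * (c * gg ?p)" .
    moreover have "c * gg ?p \<in> A" "c * hh ?p + (- of_int k) * (c * gg ?p) \<in> A"
      using g h c(1) by (intro group_A_closed; simp)+
    ultimately show ?thesis by blast
  qed
  then show "x \<in> X_set A" by (auto simp: X_set_def)
qed

lemma A_subset_O: "1 \<le> k \<Longrightarrow> A \<subseteq> insert 0 (O_set q k)"
  using F_set_in_O A_eq by blast

text \<open>
  The intervals of a single \<open>O_set q k\<close> with \<open>s * k \<ge> 1\<close> form a good cover: their \<open>s\<close>-th powers of diameters are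
  bounded by a geometric series with sum \<open>2 / 2 ^ k\<close>.
\<close>

lemma hausdorff_measure_A:
  assumes s: "s > 0" shows "hausdorff_measure s A = 0"
proof -
  have "hausdorff_premeasure s \<delta> A \<le> ennreal e" if \<delta>: "\<delta> > 0" and e: "e > 0" for \<delta> e
  proof -
    obtain k1 :: nat where k1: "(1/2) ^ k1 < min \<delta> (e / 2)"
      using real_arch_pow_inv[of "min \<delta> (e / 2)" "1/2"] \<delta> e by auto
    obtain k2 :: nat where k2: "1 / s \<le> real k2" using real_arch_simple by blast
    define k where "k = max 1 (max k1 k2)"
    have k: "1 \<le> k" "1 \<le> s * real k"
    proof -
      have "1 \<le> s * real k2" using k2 s by (simp add: field_simps)
      also have "\<dots> \<le> s * real k" using s by (intro mult_left_mono) (auto simp: k_def)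
      finally show "1 \<le> s * real k" .
    qed (simp add: k_def)
    have "(1/2 :: real) ^ k \<le> (1/2) ^ k1" by (rule power_decreasing) (auto simp: k_def)
    moreover have "(1/2) ^ k1 < \<delta>" "(1/2) ^ k1 < e / 2" using k1 by simp_all
    ultimately have small: "(1/2) ^ k < \<delta>" "2 * (1/2) ^ k < e" by linarith+
    \<comment> \<open>the index 0 is free for the point 0, which belongs to the group but to none of the open sets\<close>
    define U where "U l = (if l = 0 then {0} else {q l - radius q k l <..< q l + radius q k l})" for l
    have r: "0 \<le> radius q k l" "2 * radius q k l \<le> (1/2) ^ (k * (k + l))" for l
    proof -
      show "0 \<le> radius q k l" by (simp add: radius_def)
      have "radius q k l \<le> 1 / 2 ^ (k * (k + l) + 2)" by (simp add: radius_def)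
      also have "\<dots> = (1/2) ^ (k * (k + l)) / 4" by (simp add: power_add power_one_over)
      finally have "2 * radius q k l \<le> (1/2) ^ (k * (k + l)) / 2" by simp
      moreover have "0 \<le> (1/2 :: real) ^ (k * (k + l))" by simp
      ultimately show "2 * radius q k l \<le> (1/2) ^ (k * (k + l))" by linarith
    qed
    have diam: "diameter (U l) \<le> (1/2) ^ (k * (k + l))" for l
    proof (cases "l = 0")
      case False
      have "diameter (U l) \<le> 2 * radius q k l"
        by (rule diameter_le) (use False r(1)[of l] in \<open>auto simp: U_def dist_real_def\<close>)
      with r(2)[of l] show ?thesis by linarith
    qed (simp add: U_def)
    have diam0: "0 \<le> diameter (U l)" for l
      by (rule diameter_ge_0) (auto simp: U_def)
    have summand: "ennreal (diameter (U l) powr s) \<le> ennreal ((1/2) ^ k * (1/2) ^ l)" for l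
    proof (rule ennreal_leI)
      have "diameter (U l) powr s \<le> ((1/2) ^ (k * (k + l))) powr s"
        by (rule powr_mono2) (use s diam diam0 in auto)
      also have "\<dots> = (1/2) powr (s * real k * real (k + l))"
        by (simp add: powr_powr mult_ac flip: powr_realpow)
      also have "\<dots> \<le> (1/2) powr (1 * real (k + l))"
        by (rule powr_mono') (use mult_right_mono[OF k(2), of "real (k + l)"] in auto)
      also have "\<dots> = (1/2) ^ (k + l)" by (simp add: powr_realpow del: of_nat_add)
      finally show "diameter (U l) powr s \<le> (1/2) ^ k * (1/2) ^ l" by (simp add: power_add)
    qed
    have "A \<subseteq> (\<Union>l. U l)"
    proof
      fix x assume "x \<in> A"
      then consider "x = 0" | "x \<in> O_set q k" using A_subset_O[OF k(1)] by blast
      then show "x \<in> (\<Union>l. U l)"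
      proof cases
        case 1
        then have "x \<in> U 0" by (simp add: U_def)
        then show ?thesis by blast
      next
        case 2
        then obtain l where "l \<ge> 1" "x \<in> {q l - radius q k l <..< q l + radius q k l}"
          unfolding O_set_def by blast
        then have "x \<in> U l" by (simp add: U_def)
        then show ?thesis by blast
      qed
    qed
    moreover have "bounded (U l) \<and> diameter (U l) \<le> \<delta>" for l
    proof
      show "bounded (U l)" by (simp add: U_def)
      have "(1/2 :: real) ^ (k * (k + l)) \<le> (1/2) ^ k"
        using k(1) by (intro power_decreasing) (auto simp: algebra_simps le_add1 trans_le_add1)
      with diam[of l] small show "diameter (U l) \<le> \<delta>" by linarith
    qed
    ultimately have "hausdorff_premeasure s \<delta> A \<le> (\<Sum>l. ennreal (diameter (U l) powr s))"
      unfolding hausdorff_premeasure_def by (intro INF_lower) blast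
    also have "\<dots> \<le> (\<Sum>l. ennreal ((1/2) ^ k * (1/2) ^ l))"
      by (intro suminf_le summand summableI)
    also have "\<dots> = ennreal (\<Sum>l. (1/2) ^ k * (1/2) ^ l)"
      by (rule suminf_ennreal2) (auto intro!: summable_mult summable_geometric)
    also have "(\<Sum>l. (1/2 :: real) ^ k * (1/2) ^ l) = (1/2) ^ k * 2"
      by (subst suminf_mult) (auto simp: suminf_geometric)
    also have "ennreal ((1/2) ^ k * 2) \<le> ennreal e" using small by (intro ennreal_leI) simp
    finally show ?thesis .
  qed
  then have "hausdorff_premeasure s \<delta> A = 0" if "\<delta> > 0" for \<delta>
    using that by (metis ennreal_le_epsilon add.left_neutral le_zero_eq zero_le)
  then show ?thesis by (simp add: hausdorff_measure_def)
qed

lemma hausdorff_dim_A: "hausdorff_dim A = 0"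
proof -
  have "hausdorff_dim A \<le> ennreal e" if "e > 0" for e
    unfolding hausdorff_dim_def by (rule Inf_lower) (use that hausdorff_measure_A in blast)
  then show ?thesis by (metis ennreal_le_epsilon add.left_neutral le_zero_eq zero_le)
qed

text \<open>
  Rational multiples of a single positive generator are already dense.
\<close>

lemma A_dense: "closure A = UNIV"
proof -
  obtain \<gamma> where "1 + seq_real \<gamma> \<notin> \<rat>"
  proof -
    obtain x :: real where "x \<notin> \<rat>"
      using countable_rat uncountable_UNIV_real by (metis UNIV_I countable_subset subsetI)
    moreover from this obtain k \<gamma> where "x = of_int k + (1 + seq_real \<gamma>)" using integer_shift_of_multiplier by blast
    ultimately have "1 + seq_real \<gamma> \<notin> \<rat>" by auto
    then show thesis by (rule that)
  qed
  then have gA: "gg (\<gamma>, \<gamma>) \<in> A" by (intro group_A_gen) (simp add: xi_def)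
  have "1 / 4 \<le> gg (\<gamma>, \<gamma>)" using gg_bounds(1)[where l = 0 and p = "(\<gamma>, \<gamma>)"] by (simp add: N_0 T_0)
  then have pos: "0 < gg (\<gamma>, \<gamma>)" by linarith
  have "\<exists>y\<in>A. dist y x < e" if "e > 0" for x e
  proof -
    obtain r where r: "r \<in> \<rat>" "(x - e) / gg (\<gamma>, \<gamma>) < r" "r < x / gg (\<gamma>, \<gamma>)"
      using Rats_dense_in_real[of "(x - e) / gg (\<gamma>, \<gamma>)" "x / gg (\<gamma>, \<gamma>)"] pos \<open>e > 0\<close>
      by (auto simp: divide_strict_right_mono)
    then have "x - e < r * gg (\<gamma>, \<gamma>)" "r * gg (\<gamma>, \<gamma>) < x" using pos by (simp_all add: field_simps)
    moreover have "r * gg (\<gamma>, \<gamma>) \<in> A" by (rule group_A_closed(3)[OF r(1) gA])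
    ultimately show ?thesis by (intro bexI[of _ "r * gg (\<gamma>, \<gamma>)"]) (auto simp: dist_real_def)
  qed
  then show ?thesis by (auto simp: closure_approachable)
qed

text \<open>
  A dense \<open>G\<^sub>\<delta>\<close> subgroup would meet its cosets by Baire's theorem, so it would be the whole line.
\<close>

lemma not_gdelta_A: "\<not> gdelta A"
proof
  assume "gdelta A"
  then obtain F :: "nat \<Rightarrow> real set" where F: "\<And>n. open (F n)" "A = (\<Inter>n. F n)"
    by (auto elim!: gdelta.cases)
  obtain z where z: "z \<notin> A" using exists_notin_A by blast
  let ?H = "range F \<union> range (\<lambda>n. (+) z ` F n)"
  have dense: "closure (F n) = UNIV" for n
    using A_dense closure_mono[of A "F n"] F(2) by blast
  have "UNIV \<subseteq> closure (\<Inter>?H)"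
  proof (rule Baire)
    fix T assume "T \<in> ?H"
    then show "openin (top_of_set UNIV) T \<and> UNIV \<subseteq> closure T"
      using F(1) dense by (auto simp: open_translation closure_translation)
  qed auto
  then have "\<Inter>?H \<noteq> {}" by force
  then obtain x where x: "x \<in> \<Inter>?H" by blast
  then have "x \<in> F n" for n by (rule InterD) simp
  then have "x \<in> A" using F(2) by blast
  have "x - z \<in> F n" for n
  proof -
    have "x \<in> (+) z ` F n" using x by (rule InterD) simp
    then show ?thesis by auto
  qed
  then have "x - z \<in> A" using F(2) by blast
  then have "(-1) * (x - z) \<in> A" by (rule group_A_closed(3)[rotated]) simp
  with \<open>x \<in> A\<close> have "x + (-1) * (x - z) \<in> A" by (rule group_A_closed(2))
  with z show False by simp
qed

lemma gg_close:
  assumes "cell (fst p) (N l) = cell (fst p') (N l)" "cell (snd p) (N l) = cell (snd p') (N l)"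
  shows "\<bar>gg p - gg p'\<bar> \<le> 1 / 2 ^ (N l + 2)"
  using gg_bounds[where l = l and p = p] gg_bounds[where l = l and p = p'] assms
  by (simp add: add_divide_distrib abs_le_iff)

text \<open>
  Along the curve of generators with \<open>\<beta> = 0\<close>, membership in the group is irrationality of the
  multiplier.  If the group were the union of closed sets \<open>F k\<close>, each of them would be avoided near points
  with rational multiplier, which are dense.  Nested cells that avoid in turn \<open>F k\<close> and the \<open>k\<close>-th
  rational lead to a generator with irrational multiplier outside all \<open>F k\<close>.
\<close>

lemma not_fsigma_A: "\<not> fsigma A"
proof
  assume "fsigma A"
  then obtain F :: "nat \<Rightarrow> real set" where F: "\<And>n. closed (F n)" "A = (\<Union>n. F n)"
    by (auto elim!: fsigma.cases)
  define g where "g \<gamma> = gg (\<gamma>, \<lambda>_. False)" for \<gamma>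
  let ?step = "\<lambda>k x y. snd x < snd y \<and> cell (fst y) (snd x) = cell (fst x) (snd x) \<and>
      (\<forall>\<delta>. cell \<delta> (snd y) = cell (fst y) (snd y) \<longrightarrow> g \<delta> \<notin> F k \<and> seq_real \<delta> \<noteq> rat_decode k)"
  have "\<exists>f. \<forall>k. True \<and> ?step k (f k) (f (Suc k))"
  proof (rule dependent_nat_choice)
    fix x :: "seq \<times> nat" and k :: nat
    obtain \<gamma> m where x: "x = (\<gamma>, m)" by fastforce
    \<comment> \<open>continuing by zeros gives a rational point of the cell\<close>
    obtain \<gamma>0 where \<gamma>0: "cell \<gamma>0 m = cell \<gamma> m" "\<And>i. i \<ge> m \<Longrightarrow> \<not> \<gamma>0 i"
      using cell_surj[OF cell_less[of \<gamma> m]] by blast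
    have "seq_real \<gamma>0 = (\<Sum>i<m. of_bool (\<gamma>0 i) / 2 ^ (i + 1))"
      unfolding seq_real_def by (rule suminf_finite) (use \<gamma>0(2) in auto)
    then have "seq_real \<gamma>0 \<in> \<rat>" by (auto intro!: Rats_sum Rats_divide Rats_power)
    then have "g \<gamma>0 \<notin> A" unfolding g_def by (intro gg_notin_A) (simp add: xi_def)
    then have "g \<gamma>0 \<in> - F k" using F(2) by blast
    then obtain e where e: "e > 0" "ball (g \<gamma>0) e \<subseteq> - F k"
      using F(1) openE open_Compl by blast
    obtain l0 :: nat where l0: "(1/2) ^ l0 < e" using real_arch_pow_inv[of e "1/2"] e(1) by auto
    define l where "l = max l0 m"
    have ml: "m \<le> N l" "l0 \<le> N l + 2" using N_ge[of l] by (auto simp: l_def)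
    have "(1 / 2 ^ (N l + 2) :: real) \<le> (1/2) ^ l0"
      unfolding power_one_over[symmetric] by (rule power_decreasing[OF ml(2)]) auto
    with l0 have le: "1 / 2 ^ (N l + 2) < e" by linarith
    have avoid: "g \<delta> \<notin> F k" if "cell \<delta> (N l) = cell \<gamma>0 (N l)" for \<delta>
    proof -
      have "\<bar>g \<gamma>0 - g \<delta>\<bar> \<le> 1 / 2 ^ (N l + 2)" unfolding g_def by (rule gg_close) (simp_all add: that)
      then have "g \<delta> \<in> ball (g \<gamma>0) e" using le by (auto simp: dist_real_def)
      then show ?thesis using e(2) by blast
    qed
    let ?M = "N l + 2"
    \<comment> \<open>of the first and the last quarter of the dyadic interval, one misses the rational\<close>
    have "\<exists>b::nat. b < 4 \<and> (\<forall>\<delta>. cell \<delta> ?M = 4 * cell \<gamma>0 (N l) + b \<longrightarrow> seq_real \<delta> \<noteq> rat_decode k)"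
    proof (cases "rat_decode k \<le> (real (4 * cell \<gamma>0 (N l)) + 2) / 2 ^ ?M")
      case True
      have "seq_real \<delta> \<noteq> rat_decode k" if "cell \<delta> ?M = 4 * cell \<gamma>0 (N l) + 3" for \<delta>
      proof -
        have "(real (4 * cell \<gamma>0 (N l)) + 2) / 2 ^ ?M < real (cell \<delta> ?M) / 2 ^ ?M"
          unfolding that by (rule divide_strict_right_mono) simp_all
        with True seq_real_bounds(1)[of \<delta> ?M] show ?thesis by linarith
      qed
      then show ?thesis by (intro exI[of _ 3]) simp
    next
      case False
      have "seq_real \<delta> \<noteq> rat_decode k" if "cell \<delta> ?M = 4 * cell \<gamma>0 (N l) + 0" for \<delta>
      proof -
        have "(real (cell \<delta> ?M) + 1) / 2 ^ ?M \<le> (real (4 * cell \<gamma>0 (N l)) + 2) / 2 ^ ?M"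
          unfolding that by (rule divide_right_mono) simp_all
        with False seq_real_bounds(2)[of \<delta> ?M] show ?thesis by linarith
      qed
      then show ?thesis by (intro exI[of _ 0]) simp
    qed
    then obtain b :: nat where b: "b < 4"
      "\<And>\<delta>. cell \<delta> ?M = 4 * cell \<gamma>0 (N l) + b \<Longrightarrow> seq_real \<delta> \<noteq> rat_decode k" by blast
    have "4 * cell \<gamma>0 (N l) + b < 2 ^ ?M" using cell_less[of \<gamma>0 "N l"] b(1) by simp
    then obtain \<gamma>1 where \<gamma>1: "cell \<gamma>1 ?M = 4 * cell \<gamma>0 (N l) + b" using cell_surj by blast
    have down: "cell \<delta> (N l) = cell \<gamma>0 (N l)" if "cell \<delta> ?M = 4 * cell \<gamma>0 (N l) + b" for \<delta>
      using cell_div[of "N l" ?M \<delta>] that b(1) by simp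
    have "?step k x (\<gamma>1, ?M)"
      unfolding x using down \<gamma>1 b(2) avoid ml(1) \<gamma>0(1) cell_eq_mono[OF down[OF \<gamma>1] ml(1)] by auto
    then show "\<exists>y. True \<and> ?step k x y" by blast
  qed simp
  then obtain f where f: "\<And>k. ?step k (f k) (f (Suc k))" by blast
  have "\<exists>!\<delta>. \<forall>l. cell \<delta> (snd (f l)) = cell (fst (f l)) (snd (f l))"
  proof (rule seq_of_nested_cells)
    show "cell (fst (f (Suc l))) (snd (f (Suc l))) div 2 ^ (snd (f (Suc l)) - snd (f l))
        = cell (fst (f l)) (snd (f l))" for l
      using f[of l] by (simp add: cell_div)
  qed (use f cell_less in auto)
  then obtain \<delta> where \<delta>: "\<And>l. cell \<delta> (snd (f l)) = cell (fst (f l)) (snd (f l))" by blast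
  have "g \<delta> \<notin> F k" "seq_real \<delta> \<noteq> rat_decode k" for k
    using f[of k] \<delta>[of "Suc k"] by blast+
  then have "g \<delta> \<notin> A" "seq_real \<delta> \<notin> \<rat>" using F(2) rat_decode_surj by (blast, metis)
  then have "xi (\<delta>, \<lambda>_. False) \<notin> \<rat>"
    unfolding xi_def using Rats_diff[of "1 + seq_real \<delta>" 1] by auto
  then have "g \<delta> \<in> A" unfolding g_def by (rule group_A_gen)
  with \<open>g \<delta> \<notin> A\<close> show False by blast
qed

end

section \<open>The theorem\<close>

text \<open>
  The given program is only required to halt on positive indices; running it on successors yields a total
  function.
\<close>

lemma computable_enumE:
  assumes "computable_enum_nonzero_rats q"
  obtains q' where "computable_rat q'" "\<And>l. 1 \<le> l \<Longrightarrow> q' l = q l" "q' ` {1..} = \<rat> - {0}"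
proof -
  obtain f where f: "\<And>l. 1 \<le> l \<Longrightarrow> \<exists>c. computes f [l] c \<and> rat_decode c = q l"
    and range: "q ` {1..} = \<rat> - {0}"
    using assms unfolding computable_enum_nonzero_rats_def by blast
  have "\<exists>c. computes f [Suc l] c \<and> rat_decode c = q (Suc l)" for l by (rule f) simp
  then obtain c where c: "\<And>l. computes f [Suc l] (c l)" "\<And>l. rat_decode (c l) = q (Suc l)"
    by metis
  have "computes (Comp f [Succ]) [l] (c l)" for l
    by (rule computes.comp[where ys = "[Suc l]"]) (simp_all add: computes.succ c(1))
  then have "total_computable 1 (\<lambda>xs. c (xs ! 0))"
    unfolding total_computable_def by (intro exI[of _ "Comp f [Succ]"]) (auto simp: length_Suc_conv)
  then have cc: "computable c" by (rule computableI) (simp add: enc_nat_def)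
  define q' where "q' l = rat_decode (c (l - 1))" for l
  have q': "q' l = q l" if "1 \<le> l" for l
    using that by (simp add: q'_def c(2))
  show thesis
  proof (rule that[of q'])
    show "computable_rat q'"
      unfolding q'_def[abs_def] by (intro computable_intros computable_compose[OF cc])
    show "q' ` {1..} = \<rat> - {0}" using range q' by (metis (no_types, lifting) atLeast_iff image_cong)
  qed (rule q')
qed

lemma construction_cong:
  assumes "\<And>l. 1 \<le> l \<Longrightarrow> q' l = q l" "construction q' n m \<theta>"
  shows "construction q n m \<theta>"
proof -
  have "O_set q' k = O_set q k" for k
    unfolding O_set_def radius_def using assms(1) by auto
  then have "G_set q' = G_set q" by (simp add: fun_eq_iff G_set_def)
  then show ?thesis using assms(2) by (simp add: construction_def stage_requirement_def)
qed

theorem mainTheorem7: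
  fixes q :: "nat \<Rightarrow> real"
  assumes "computable_enum_nonzero_rats q"
  shows "\<exists>n m \<theta>. construction q n m \<theta> \<and>
           lightface_Delta3 (group_A n \<theta>) \<and>
           hausdorff_dim (group_A n \<theta>) = 0 \<and>
           X_set (group_A n \<theta>) = UNIV - \<rat> \<and>
           lightface_Sigma2 (F_set n \<theta>) \<and>
           lightface_Sigma2 (F_rat n \<theta>) \<and>
           group_A n \<theta> = (F_set n \<theta> \<union> {0}) - F_rat n \<theta> \<and>
           \<not> fsigma (group_A n \<theta>) \<and>
           \<not> gdelta (group_A n \<theta>)"
proof -
  obtain q' where q': "computable_rat q'" "\<And>l. 1 \<le> l \<Longrightarrow> q' l = q l" "q' ` {1..} = \<rat> - {0}"
    using computable_enumE[OF assms] by blast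
  note step = state_step[OF q'(3)]
  interpret computable_tables "level q'" "table q'" q' "\<lambda>j. snd (state q' j)"
  proof
    show "level q' 0 = 0" "table q' 0 0 0 = 1" by (rule level_0 table_0)+
    show "computable (level q')" "computable (\<lambda>j. snd (state q' j))"
      using computable_level[OF q'(1,3) computable_id]
      by (simp, intro computable_intros computable_state q'(1,3))
    show "table q' j = lookup (level q' j) (snd (state q' j))" for j by (simp add: table_def)
  qed (use step q'(3) in auto)
  have "lightface_Delta3 A"
    unfolding A_eq by (intro Sigma2_search_diff_Delta3 Sigma2_search_insert_0 Sigma2_F_set Sigma2_F_rat)
  moreover have "construction q (level q') (\<lambda>j. level q' j + 2) theta"
    by (rule construction_cong[OF q'(2) construction])
  ultimately show ?thesis
    using hausdorff_dim_A X_set_A A_eq not_fsigma_A not_gdelta_A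
      Sigma2_search_imp_lightface[OF Sigma2_F_set] Sigma2_search_imp_lightface[OF Sigma2_F_rat]
    by blast
qed

end
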